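(* Let $(S,\omega)$ be a symplectic manifold with commuting symplectic actions of two Lie groups $G$ (on the right) and $H$ (on the left) that are mutually completely orthogonal, i.e. $\mathfrak g_S=\mathfrak h_S^{\omega}$ and $\mathfrak h_S=\mathfrak g_S^{\omega}$. Assume: (1) $H$ is connected and its action has an equivariant momentum map $\mathbf J_L:S\to\mathfrak h^*$. (2) Although the $G$-action need not admit an equivariant momentum map with values in $\mathfrak g^*$, there are a central extension $\hat{\mathfrak g}$ of $\mathfrak g$ and a $\hat{\mathfrak g}$-equivariant momentum map $\mathbf J_R:S\to\hat{\mathfrak g}^*$ for the induced action of $\hat{\mathfrak g}$ on $S$. (3) Although $\hat{\mathfrak g}$ might not be integrable to a central extension of the (possibly non-connected) Lie group $G$, the coadjoint action of $\mathfrak g$ on $\hat{\mathfrak g}^*$ integrates to a $G$-action on $\hat{\mathfrak g}^*$ for which $\mathbf J_R$ is $G$-equivariant. (4) $G$ acts transitively on the level sets of $\mathbf J_L$, and $H$ acts transitively on the connected components of the level sets of $\mathbf J_R$. Let $\sigma\in\hat{\mathfrak g}^*$ and let $G_\sigma\subset G$ be its stabilizer for the $G$-action on $\hat{\mathfrak g}^*$ in (3), and assume that $\mathbf J_R^{-1}(\sigma)$ is a submanifold of $S$ and that $S_\sigma=\mathbf J_R^{-1}(\sigma)/G_\sigma$ carries the quotient manifold structure. Then the connected components of $S_\sigma=\mathbf J_R^{-1}(\sigma)/G_\sigma$ are symplectically diffeomorphic to coadjoint orbits of $H$.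
   Context: Manifolds and Lie groups may be infinite dimensional (e.g. Fréchet), and symplectic forms may be weak. $\mathfrak g,\mathfrak h$ are the Lie algebras of $G,H$. For $\xi\in\mathfrak g$, $\xi_S$ is the infinitesimal generator on $S$, and $\mathfrak g_S(s)=\{\xi_S(s):\xi\in\mathfrak g\}\subset T_sS$; similarly $\mathfrak h_S(s)$. For $V\subset T_sS$, $V^{\omega}=\{w\in T_sS:\omega(w,v)=0\ \forall v\in V\}$. The Lie algebra $\hat{\mathfrak g}$ acts on $S$ through the projection $\hat{\mathfrak g}\to\mathfrak g$. Since $\hat{\mathfrak g}$ is a central extension, the coadjoint action of $\hat{\mathfrak g}$ on $\hat{\mathfrak g}^*$ factors through an action of $\mathfrak g$, called the coadjoint action of $\mathfrak g$ on $\hat{\mathfrak g}^*$. The quotient $S_\sigma$ is endowed with the symplectic form $\omega_\sigma$ whose pullback to $\mathbf J_R^{-1}(\sigma)$ is the restriction of $\omega$. Coadjoint orbits carry their orbit (Kirillov–Kostant–Souriau) symplectic form. *)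

theory Defs
  imports "HOL-Analysis.Analysis" "HOL-Algebra.Group"
begin

section \<open>Calculus in locally convex spaces\<close>

class lctvs = real_vector + topological_ab_group_add + t2_space +
  assumes tendsto_scaleR_lctvs:
    "((\<lambda>p. fst p *\<^sub>R snd p) \<longlongrightarrow> r *\<^sub>R a) (nhds r \<times>\<^sub>F nhds a)"
  assumes locally_convex_raw: "open U \<Longrightarrow> a \<in> U \<Longrightarrow> \<exists>V. open V \<and>
    (\<forall>x \<in> V. \<forall>y \<in> V. \<forall>r \<ge> 0. \<forall>s \<ge> 0. r + s = 1 \<longrightarrow> r *\<^sub>R x + s *\<^sub>R y \<in> V) \<and> a \<in> V \<and> V \<subseteq> U"

lemma locally_convex:
  fixes a :: "'a::lctvs"
  shows "open U \<Longrightarrow> a \<in> U \<Longrightarrow> \<exists>V. open V \<and> convex V \<and> a \<in> V \<and> V \<subseteq> U"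
  using locally_convex_raw unfolding convex_def by blast

instance real_normed_vector \<subseteq> lctvs
proof
  fix r :: real and a :: 'a
  show "((\<lambda>p. fst p *\<^sub>R snd p) \<longlongrightarrow> r *\<^sub>R a) (nhds r \<times>\<^sub>F nhds a)"
    by (intro tendsto_scaleR filterlim_fst filterlim_snd)
next
  fix U :: "'a set" and a
  assume "open U" "a \<in> U"
  then obtain e where "0 < e" "ball a e \<subseteq> U"
    using open_contains_ball by blast
  then show "\<exists>V. open V \<and>
    (\<forall>x \<in> V. \<forall>y \<in> V. \<forall>r \<ge> 0. \<forall>s \<ge> 0. r + s = 1 \<longrightarrow> r *\<^sub>R x + s *\<^sub>R y \<in> V) \<and> a \<in> V \<and> V \<subseteq> U"
    unfolding convex_def[symmetric] by (intro exI[of _ "ball a e"]) auto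
qed

instance prod :: (topological_monoid_add, topological_monoid_add) topological_monoid_add
proof
  fix a b :: "'a \<times> 'b"
  show "((\<lambda>x. fst x + snd x) \<longlongrightarrow> a + b) (nhds a \<times>\<^sub>F nhds b)"
    unfolding plus_prod_def
    by (intro tendsto_Pair tendsto_add tendsto_fst tendsto_snd filterlim_fst filterlim_snd)
qed

instance prod :: (topological_comm_monoid_add, topological_comm_monoid_add) topological_comm_monoid_add ..

instance prod :: (topological_group_add, topological_group_add) topological_group_add
proof
  fix a :: "'a \<times> 'b"
  show "(uminus \<longlongrightarrow> - a) (nhds a)"
    unfolding uminus_prod_def
    by (intro tendsto_Pair tendsto_minus tendsto_fst tendsto_snd filterlim_ident)
qed

instance prod :: (topological_ab_group_add, topological_ab_group_add) topological_ab_group_add ..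

instance prod :: (lctvs, lctvs) lctvs
proof
  fix r :: real and a :: "'a \<times> 'b"
  have fst: "((\<lambda>p. fst p *\<^sub>R fst (snd p)) \<longlongrightarrow> r *\<^sub>R fst a) (nhds r \<times>\<^sub>F nhds a)"
    using filterlim_compose[OF tendsto_scaleR_lctvs
        filterlim_Pair[OF filterlim_fst tendsto_fst[OF filterlim_snd]]] by simp
  have snd: "((\<lambda>p. fst p *\<^sub>R snd (snd p)) \<longlongrightarrow> r *\<^sub>R snd a) (nhds r \<times>\<^sub>F nhds a)"
    using filterlim_compose[OF tendsto_scaleR_lctvs
        filterlim_Pair[OF filterlim_fst tendsto_snd[OF filterlim_snd]]] by simp
  show "((\<lambda>p. fst p *\<^sub>R snd p) \<longlongrightarrow> r *\<^sub>R a) (nhds r \<times>\<^sub>F nhds a)"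
    unfolding scaleR_prod_def by (intro tendsto_Pair fst snd)
next
  fix U :: "('a \<times> 'b) set" and a
  assume "open U" "a \<in> U"
  then obtain A B where AB: "open A" "open B" "a \<in> A \<times> B" "A \<times> B \<subseteq> U"
    by (rule open_prod_elim)
  from AB(3) have "fst a \<in> A" "snd a \<in> B" by auto
  with AB(1,2) obtain V W where
    "open V" "convex V" "fst a \<in> V" "V \<subseteq> A" "open W" "convex W" "snd a \<in> W" "W \<subseteq> B"
    using locally_convex by meson
  with AB(4) show "\<exists>V. open V \<and>
    (\<forall>x \<in> V. \<forall>y \<in> V. \<forall>r \<ge> 0. \<forall>s \<ge> 0. r + s = 1 \<longrightarrow> r *\<^sub>R x + s *\<^sub>R y \<in> V) \<and> a \<in> V \<and> V \<subseteq> U"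
    unfolding convex_def[symmetric]
    by (intro exI[of _ "V \<times> W"]) (auto intro!: open_Times convex_Times simp: mem_Times_iff)
qed

definition dir_deriv :: "('e::lctvs \<Rightarrow> 'f::lctvs) \<Rightarrow> 'e \<Rightarrow> 'e \<Rightarrow> 'f" where
  "dir_deriv f x v = Lim (at 0) (\<lambda>t::real. (f (x + t *\<^sub>R v) - f x) /\<^sub>R t)"

primrec iter_deriv :: "('e::lctvs \<Rightarrow> 'f::lctvs) \<Rightarrow> 'e list \<Rightarrow> 'e \<Rightarrow> 'f" where
  "iter_deriv f [] = f"
| "iter_deriv f (v # vs) = (\<lambda>x. dir_deriv (iter_deriv f vs) x v)"

text \<open>
  Smoothness in the sense of Michal and Bastiani, for \<open>f\<close> on a relatively open subset \<open>U\<close> of a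
  closed subspace \<open>F\<close>: all iterated directional derivatives along \<open>F\<close> exist on \<open>U\<close>, and the
  \<open>k\<close>-th one is jointly continuous on \<open>U \<times> F ^ k\<close>. The \<open>k\<close>-tuples of vectors of \<open>F\<close> are the first
  \<open>k\<close> entries of sequences in \<open>F\<close>, with the product topology.
\<close>
definition bastiani_smooth :: "'e::lctvs set \<Rightarrow> 'e set \<Rightarrow> ('e \<Rightarrow> 'f::lctvs) \<Rightarrow> bool" where
  "bastiani_smooth F U f \<longleftrightarrow>
     (\<forall>vs v x. set vs \<subseteq> F \<and> v \<in> F \<and> x \<in> U \<longrightarrow>
        (\<exists>l. ((\<lambda>t::real. (iter_deriv f vs (x + t *\<^sub>R v) - iter_deriv f vs x) /\<^sub>R t) \<longlongrightarrow> l) (at 0))) \<and>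
     (\<forall>k. continuous_on (U \<times> {w. range w \<subseteq> F})
        (\<lambda>(x, w :: nat \<Rightarrow> 'e). iter_deriv f (map w [0..<k]) x))"


section \<open>Manifolds\<close>

record ('a, 'e) chart =
  cdom :: "'a set"
  cmap :: "'a \<Rightarrow> 'e"
  cmodel :: "'e set"

definition cinv :: "('a, 'e) chart \<Rightarrow> 'e \<Rightarrow> 'a" where
  "cinv c = inv_into (cdom c) (cmap c)"

definition is_chart :: "('a, 'e::lctvs) chart \<Rightarrow> bool" where
  "is_chart c \<longleftrightarrow> inj_on (cmap c) (cdom c) \<and> subspace (cmodel c) \<and> closed (cmodel c) \<and>
     openin (top_of_set (cmodel c)) (cmap c ` cdom c)"

definition compatible :: "('a, 'e::lctvs) chart \<Rightarrow> ('a, 'e) chart \<Rightarrow> bool" where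
  "compatible c d \<longleftrightarrow>
     openin (top_of_set (cmodel c)) (cmap c ` (cdom c \<inter> cdom d)) \<and>
     bastiani_smooth (cmodel c) (cmap c ` (cdom c \<inter> cdom d)) (cmap d \<circ> cinv c)"

text \<open>
  The model space of a chart is a closed subspace of the type \<open>'e\<close> that may depend on the chart, so
  that a submanifold is again a manifold over \<open>'e\<close>.
\<close>
record ('a, 'e) mfd =
  points :: "'a set"
  charts :: "('a, 'e) chart set"

definition mtop :: "('a, 'e::lctvs) mfd \<Rightarrow> 'a topology" where
  "mtop M = topology (\<lambda>W. W \<subseteq> points M \<and>
     (\<forall>c \<in> charts M. openin (top_of_set (cmodel c)) (cmap c ` (W \<inter> cdom c))))"

definition manifold :: "('a, 'e::lctvs) mfd \<Rightarrow> bool" where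
  "manifold M \<longleftrightarrow> points M = (\<Union>c \<in> charts M. cdom c) \<and> (\<forall>c \<in> charts M. is_chart c) \<and>
     (\<forall>c \<in> charts M. \<forall>d \<in> charts M. compatible c d) \<and> Hausdorff_space (mtop M)"

lemma openin_mtop:
  assumes "manifold M"
  shows "openin (mtop M) W \<longleftrightarrow> W \<subseteq> points M \<and>
     (\<forall>c \<in> charts M. openin (top_of_set (cmodel c)) (cmap c ` (W \<inter> cdom c)))"
proof -
  let ?P = "\<lambda>W. W \<subseteq> points M \<and>
     (\<forall>c \<in> charts M. openin (top_of_set (cmodel c)) (cmap c ` (W \<inter> cdom c)))"
  have inj: "inj_on (cmap c) (cdom c)" if "c \<in> charts M" for c
    using assms that by (simp add: manifold_def is_chart_def)
  have "?P (V \<inter> W)" if V: "?P V" and W: "?P W" for V W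
  proof (intro conjI ballI)
    fix c assume c: "c \<in> charts M"
    have "cmap c ` (V \<inter> W \<inter> cdom c) = cmap c ` (V \<inter> cdom c) \<inter> cmap c ` (W \<inter> cdom c)"
      using inj_on_image_Int[OF inj[OF c], of "V \<inter> cdom c" "W \<inter> cdom c"]
      by (simp add: Int_ac)
    then show "openin (top_of_set (cmodel c)) (cmap c ` (V \<inter> W \<inter> cdom c))"
      using V W c by (simp add: openin_Int)
  qed (use V in auto)
  moreover have "?P (\<Union>\<W>)" if "\<forall>W \<in> \<W>. ?P W" for \<W>
  proof (intro conjI ballI)
    fix c assume c: "c \<in> charts M"
    have "cmap c ` (\<Union>\<W> \<inter> cdom c) = (\<Union>W \<in> \<W>. cmap c ` (W \<inter> cdom c))" by blast
    then show "openin (top_of_set (cmodel c)) (cmap c ` (\<Union>\<W> \<inter> cdom c))"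
      using that c by auto
  qed (use that in auto)
  ultimately have "istopology ?P" unfolding istopology_def by blast
  then show ?thesis unfolding mtop_def by (simp add: topology_inverse')
qed

definition smooth_map :: "('a, 'e::lctvs) mfd \<Rightarrow> ('b, 'f::lctvs) mfd \<Rightarrow> ('a \<Rightarrow> 'b) \<Rightarrow> bool" where
  "smooth_map M N f \<longleftrightarrow> continuous_map (mtop M) (mtop N) f \<and>
     (\<forall>c \<in> charts M. \<forall>d \<in> charts N.
        bastiani_smooth (cmodel c) (cmap c ` (cdom c \<inter> f -` cdom d)) (cmap d \<circ> f \<circ> cinv c))"

definition diffeomorphism :: "('a, 'e::lctvs) mfd \<Rightarrow> ('b, 'f::lctvs) mfd \<Rightarrow> ('a \<Rightarrow> 'b) \<Rightarrow> bool" where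
  "diffeomorphism M N f \<longleftrightarrow> bij_betw f (points M) (points N) \<and> smooth_map M N f \<and>
     smooth_map N M (inv_into (points M) f)"

definition vs_mfd :: "'e set \<Rightarrow> ('e, 'e) mfd" where
  "vs_mfd V = \<lparr>points = V, charts = {\<lparr>cdom = V, cmap = id, cmodel = V\<rparr>}\<rparr>"

abbreviation real_mfd :: "(real, real) mfd" where
  "real_mfd \<equiv> vs_mfd UNIV"

definition prod_mfd :: "('a, 'e) mfd \<Rightarrow> ('b, 'f) mfd \<Rightarrow> ('a \<times> 'b, 'e \<times> 'f) mfd" where
  "prod_mfd M N = \<lparr>points = points M \<times> points N,
     charts = {\<lparr>cdom = cdom c \<times> cdom d, cmap = map_prod (cmap c) (cmap d),
                cmodel = cmodel c \<times> cmodel d\<rparr> | c d. c \<in> charts M \<and> d \<in> charts N}\<rparr>"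

definition max_charts :: "('a, 'e::lctvs) mfd \<Rightarrow> ('a, 'e) chart set" where
  "max_charts M = {c. is_chart c \<and> cdom c \<subseteq> points M \<and>
     (\<forall>d \<in> charts M. compatible c d \<and> compatible d c)}"

text \<open>
  The charts of a submanifold \<open>N\<close> are the adapted charts of \<open>M\<close>, which flatten \<open>N\<close> to a closed
  subspace \<open>F\<close> of the model space. No complement of \<open>F\<close> is required. Open subsets are the case in
  which \<open>F\<close> is the whole model space.
\<close>
definition sub_mfd :: "('a, 'e::lctvs) mfd \<Rightarrow> 'a set \<Rightarrow> ('a, 'e) mfd" where
  "sub_mfd M N = \<lparr>points = N,
     charts = {\<lparr>cdom = cdom c \<inter> N, cmap = cmap c, cmodel = F\<rparr> | c F.
        c \<in> max_charts M \<and> subspace F \<and> closed F \<and> F \<subseteq> cmodel c \<and>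
        cmap c ` (cdom c \<inter> N) = cmap c ` cdom c \<inter> F}\<rparr>"

definition submanifold :: "('a, 'e::lctvs) mfd \<Rightarrow> 'a set \<Rightarrow> bool" where
  "submanifold M N \<longleftrightarrow> N \<subseteq> points M \<and> N \<subseteq> (\<Union>c \<in> charts (sub_mfd M N). cdom c)"

text \<open>
  Without an inverse function theorem, submersions are defined by smooth local sections through
  every point. This is weaker than requiring the local normal form of a linear projection, and
  equivalent to it for Banach manifolds.
\<close>
definition submersion :: "('a, 'e::lctvs) mfd \<Rightarrow> ('b, 'f::lctvs) mfd \<Rightarrow> ('a \<Rightarrow> 'b) \<Rightarrow> bool" where
  "submersion M N f \<longleftrightarrow> smooth_map M N f \<and>
     (\<forall>x \<in> points M. \<exists>W s. openin (mtop N) W \<and> f x \<in> W \<and>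
        smooth_map (sub_mfd N W) M s \<and> s (f x) = x \<and> (\<forall>y \<in> W. f (s y) = y))"


section \<open>Tangent spaces and differential forms\<close>

text \<open>
  A tangent vector at \<open>x\<close> is represented by its coordinates in one fixed chart around \<open>x\<close>.
\<close>
definition chart_at :: "('a, 'e) mfd \<Rightarrow> 'a \<Rightarrow> ('a, 'e) chart" where
  "chart_at M x = (SOME c. c \<in> charts M \<and> x \<in> cdom c)"

definition tangent_space :: "('a, 'e) mfd \<Rightarrow> 'a \<Rightarrow> 'e set" where
  "tangent_space M x = cmodel (chart_at M x)"

definition tangent_map ::
    "('a, 'e::lctvs) mfd \<Rightarrow> ('b, 'f::lctvs) mfd \<Rightarrow> ('a \<Rightarrow> 'b) \<Rightarrow> 'a \<Rightarrow> 'e \<Rightarrow> 'f" where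
  "tangent_map M N f x v =
     dir_deriv (cmap (chart_at N (f x)) \<circ> f \<circ> cinv (chart_at M x)) (cmap (chart_at M x) x) v"

text \<open>The tangent vector at \<open>x\<close> that has coordinates \<open>u\<close> in the chart \<open>c\<close>.\<close>
definition from_chart :: "('a, 'e::lctvs) mfd \<Rightarrow> ('a, 'e) chart \<Rightarrow> 'a \<Rightarrow> 'e \<Rightarrow> 'e" where
  "from_chart M c x u = dir_deriv (cmap (chart_at M x) \<circ> cinv c) (cmap c x) u"

type_synonym ('a, 'e) form2 = "'a \<Rightarrow> 'e \<Rightarrow> 'e \<Rightarrow> real"

definition form_in_chart ::
    "('a, 'e::lctvs) mfd \<Rightarrow> ('a, 'e) form2 \<Rightarrow> ('a, 'e) chart \<Rightarrow> 'e \<Rightarrow> 'e \<Rightarrow> 'e \<Rightarrow> real" where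
  "form_in_chart M \<omega> c y u v =
     \<omega> (cinv c y) (from_chart M c (cinv c y) u) (from_chart M c (cinv c y) v)"

definition linear_form_on :: "'e::real_vector set \<Rightarrow> ('e \<Rightarrow> real) \<Rightarrow> bool" where
  "linear_form_on V l \<longleftrightarrow> (\<forall>u \<in> V. \<forall>v \<in> V. l (u + v) = l u + l v) \<and>
     (\<forall>r. \<forall>u \<in> V. l (r *\<^sub>R u) = r * l u)"

definition smooth_form2 :: "('a, 'e::lctvs) mfd \<Rightarrow> ('a, 'e) form2 \<Rightarrow> bool" where
  "smooth_form2 M \<omega> \<longleftrightarrow>
     (\<forall>x \<in> points M. \<forall>u \<in> tangent_space M x. linear_form_on (tangent_space M x) (\<omega> x u)) \<and>
     (\<forall>x \<in> points M. \<forall>u \<in> tangent_space M x. \<forall>v \<in> tangent_space M x. \<omega> x u v = - \<omega> x v u) \<and>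
     (\<forall>c \<in> charts M. bastiani_smooth (cmodel c \<times> cmodel c \<times> cmodel c)
        (cmap c ` cdom c \<times> cmodel c \<times> cmodel c) (\<lambda>(y, u, v). form_in_chart M \<omega> c y u v))"

definition closed_form2 :: "('a, 'e::lctvs) mfd \<Rightarrow> ('a, 'e) form2 \<Rightarrow> bool" where
  "closed_form2 M \<omega> \<longleftrightarrow>
     (\<forall>c \<in> charts M. \<forall>y \<in> cmap c ` cdom c. \<forall>u \<in> cmodel c. \<forall>v \<in> cmodel c. \<forall>w \<in> cmodel c.
        dir_deriv (\<lambda>z. form_in_chart M \<omega> c z v w) y u +
        dir_deriv (\<lambda>z. form_in_chart M \<omega> c z w u) y v +
        dir_deriv (\<lambda>z. form_in_chart M \<omega> c z u v) y w = 0)"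

definition weakly_nondegenerate :: "('a, 'e::lctvs) mfd \<Rightarrow> ('a, 'e) form2 \<Rightarrow> bool" where
  "weakly_nondegenerate M \<omega> \<longleftrightarrow> (\<forall>x \<in> points M. \<forall>u \<in> tangent_space M x.
     (\<forall>v \<in> tangent_space M x. \<omega> x u v = 0) \<longrightarrow> u = 0)"

definition symplectic_manifold :: "('a, 'e::lctvs) mfd \<Rightarrow> ('a, 'e) form2 \<Rightarrow> bool" where
  "symplectic_manifold M \<omega> \<longleftrightarrow>
     manifold M \<and> smooth_form2 M \<omega> \<and> closed_form2 M \<omega> \<and> weakly_nondegenerate M \<omega>"

definition pullback ::
    "('a, 'e::lctvs) mfd \<Rightarrow> ('b, 'f::lctvs) mfd \<Rightarrow> ('a \<Rightarrow> 'b) \<Rightarrow> ('b, 'f) form2 \<Rightarrow> ('a, 'e) form2" where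
  "pullback M N f \<omega> x u v = \<omega> (f x) (tangent_map M N f x u) (tangent_map M N f x v)"

text \<open>Only the values on tangent vectors of \<open>M\<close> are meaningful.\<close>
definition form2_eq :: "('a, 'e) mfd \<Rightarrow> ('a, 'e) form2 \<Rightarrow> ('a, 'e) form2 \<Rightarrow> bool" where
  "form2_eq M \<omega> \<omega>' \<longleftrightarrow> (\<forall>x \<in> points M. \<forall>u \<in> tangent_space M x. \<forall>v \<in> tangent_space M x.
     \<omega> x u v = \<omega>' x u v)"

definition symplectic_map ::
    "('a, 'e::lctvs) mfd \<Rightarrow> ('a, 'e) form2 \<Rightarrow> ('b, 'f::lctvs) mfd \<Rightarrow> ('b, 'f) form2 \<Rightarrow> ('a \<Rightarrow> 'b) \<Rightarrow> bool"
  where "symplectic_map M \<omega> N \<omega>' f \<longleftrightarrow> smooth_map M N f \<and> form2_eq M (pullback M N f \<omega>') \<omega>"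

definition symplectic_diffeo ::
    "('a, 'e::lctvs) mfd \<Rightarrow> ('a, 'e) form2 \<Rightarrow> ('b, 'f::lctvs) mfd \<Rightarrow> ('b, 'f) form2 \<Rightarrow> ('a \<Rightarrow> 'b) \<Rightarrow> bool"
  where "symplectic_diffeo M \<omega> N \<omega>' f \<longleftrightarrow> diffeomorphism M N f \<and> symplectic_map M \<omega> N \<omega>' f"

definition symplectic_complement ::
    "('a, 'e::lctvs) mfd \<Rightarrow> ('a, 'e) form2 \<Rightarrow> 'a \<Rightarrow> 'e set \<Rightarrow> 'e set" where
  "symplectic_complement M \<omega> x V = {w \<in> tangent_space M x. \<forall>v \<in> V. \<omega> x w v = 0}"


section \<open>Lie groups and their actions\<close>

record ('a, 'e) lie_group = "'a monoid" +
  atlas :: "('a, 'e) chart set"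

definition gmfd :: "('a, 'e) lie_group \<Rightarrow> ('a, 'e) mfd" where
  "gmfd G = \<lparr>points = carrier G, charts = atlas G\<rparr>"

definition is_lie_group :: "('a, 'e::lctvs) lie_group \<Rightarrow> bool" where
  "is_lie_group G \<longleftrightarrow> Group.group G \<and> manifold (gmfd G) \<and>
     smooth_map (prod_mfd (gmfd G) (gmfd G)) (gmfd G) (\<lambda>(x, y). x \<otimes>\<^bsub>G\<^esub> y) \<and>
     smooth_map (gmfd G) (gmfd G) (\<lambda>x. inv\<^bsub>G\<^esub> x)"

definition lie_alg :: "('a, 'e::lctvs) lie_group \<Rightarrow> 'e set" where
  "lie_alg G = tangent_space (gmfd G) \<one>\<^bsub>G\<^esub>"

definition Ad :: "('a, 'e::lctvs) lie_group \<Rightarrow> 'a \<Rightarrow> 'e \<Rightarrow> 'e" where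
  "Ad G g = tangent_map (gmfd G) (gmfd G) (\<lambda>x. g \<otimes>\<^bsub>G\<^esub> x \<otimes>\<^bsub>G\<^esub> inv\<^bsub>G\<^esub> g) \<one>\<^bsub>G\<^esub>"

text \<open>\<open>[\<xi>, \<eta>]\<close> is the derivative of \<open>g \<mapsto> Ad\<^sub>g \<eta>\<close> at the identity in the direction \<open>\<xi>\<close>.\<close>
definition lie_bracket :: "('a, 'e::lctvs) lie_group \<Rightarrow> 'e \<Rightarrow> 'e \<Rightarrow> 'e" where
  "lie_bracket G \<xi> \<eta> = tangent_map (gmfd G) (vs_mfd (lie_alg G)) (\<lambda>g. Ad G g \<eta>) \<one>\<^bsub>G\<^esub> \<xi>"

text \<open>
  The topological dual. Functionals on a subspace \<open>V\<close> are extensional, so that they are equal as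
  soon as they agree on \<open>V\<close>.
\<close>
definition dual :: "'e::lctvs set \<Rightarrow> ('e \<Rightarrow> real) set" where
  "dual V = {l \<in> extensional V. linear_form_on V l \<and> continuous_on V l}"

definition coAd :: "('a, 'e::lctvs) lie_group \<Rightarrow> 'a \<Rightarrow> ('e \<Rightarrow> real) \<Rightarrow> ('e \<Rightarrow> real)" where
  "coAd G g \<mu> = (\<lambda>\<xi> \<in> lie_alg G. \<mu> (Ad G (inv\<^bsub>G\<^esub> g) \<xi>))"

definition coadjoint_orbit :: "('a, 'e::lctvs) lie_group \<Rightarrow> ('e \<Rightarrow> real) \<Rightarrow> ('e \<Rightarrow> real) set" where
  "coadjoint_orbit G \<mu> = (\<lambda>g. coAd G g \<mu>) ` carrier G"

definition left_action ::
    "('g, 'd::lctvs) lie_group \<Rightarrow> ('a, 'e::lctvs) mfd \<Rightarrow> ('g \<Rightarrow> 'a \<Rightarrow> 'a) \<Rightarrow> bool" where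
  "left_action G M act \<longleftrightarrow>
     smooth_map (prod_mfd (gmfd G) M) M (\<lambda>(g, x). act g x) \<and>
     (\<forall>x \<in> points M. act \<one>\<^bsub>G\<^esub> x = x \<and>
        (\<forall>g \<in> carrier G. \<forall>h \<in> carrier G. act (g \<otimes>\<^bsub>G\<^esub> h) x = act g (act h x)))"

definition right_action ::
    "('g, 'd::lctvs) lie_group \<Rightarrow> ('a, 'e::lctvs) mfd \<Rightarrow> ('a \<Rightarrow> 'g \<Rightarrow> 'a) \<Rightarrow> bool" where
  "right_action G M act \<longleftrightarrow>
     smooth_map (prod_mfd M (gmfd G)) M (\<lambda>(x, g). act x g) \<and>
     (\<forall>x \<in> points M. act x \<one>\<^bsub>G\<^esub> = x \<and>
        (\<forall>g \<in> carrier G. \<forall>h \<in> carrier G. act x (g \<otimes>\<^bsub>G\<^esub> h) = act (act x g) h))"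

definition inf_gen ::
    "('g, 'd::lctvs) lie_group \<Rightarrow> ('a, 'e::lctvs) mfd \<Rightarrow> ('g \<Rightarrow> 'a \<Rightarrow> 'a) \<Rightarrow> 'd \<Rightarrow> 'a \<Rightarrow> 'e" where
  "inf_gen G M act \<xi> x = tangent_map (gmfd G) M (\<lambda>g. act g x) \<one>\<^bsub>G\<^esub> \<xi>"

definition gen_space ::
    "('g, 'd::lctvs) lie_group \<Rightarrow> ('a, 'e::lctvs) mfd \<Rightarrow> ('g \<Rightarrow> 'a \<Rightarrow> 'a) \<Rightarrow> 'a \<Rightarrow> 'e set" where
  "gen_space G M act x = {inf_gen G M act \<xi> x | \<xi>. \<xi> \<in> lie_alg G}"

text \<open>Transitivity on \<open>X\<close> includes the invariance of \<open>X\<close>.\<close>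
definition transitive_on :: "'g set \<Rightarrow> ('g \<Rightarrow> 'a \<Rightarrow> 'a) \<Rightarrow> 'a set \<Rightarrow> bool" where
  "transitive_on K act X \<longleftrightarrow> (\<forall>g \<in> K. \<forall>x \<in> X. act g x \<in> X) \<and>
     (\<forall>x \<in> X. \<forall>y \<in> X. \<exists>g \<in> K. act g x = y)"

definition level_set :: "('a, 'e) mfd \<Rightarrow> ('a \<Rightarrow> 'b) \<Rightarrow> 'b \<Rightarrow> 'a set" where
  "level_set M J \<kappa> = {x \<in> points M. J x = \<kappa>}"

definition component_sets :: "('a, 'e::lctvs) mfd \<Rightarrow> 'a set \<Rightarrow> 'a set set" where
  "component_sets M X = connected_components_of (subtopology (mtop M) X)"


section \<open>Momentum maps\<close>

text \<open>
  \<open>V\<close> is the acting Lie algebra and \<open>gen \<xi>\<close> the infinitesimal generator of \<open>\<xi>\<close>. The sign convention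
  is \<open>d\<langle>J, \<xi>\<rangle> = \<omega>(gen \<xi>, _)\<close>.
\<close>
definition momentum_map ::
    "('a, 'e::lctvs) mfd \<Rightarrow> ('a, 'e) form2 \<Rightarrow> 'k::lctvs set \<Rightarrow> ('k \<Rightarrow> 'a \<Rightarrow> 'e) \<Rightarrow> ('a \<Rightarrow> 'k \<Rightarrow> real) \<Rightarrow> bool"
  where "momentum_map M \<omega> V gen J \<longleftrightarrow>
     (\<forall>x \<in> points M. J x \<in> dual V) \<and>
     (\<forall>\<xi> \<in> V. smooth_map M real_mfd (\<lambda>x. J x \<xi>) \<and>
        (\<forall>x \<in> points M. \<forall>v \<in> tangent_space M x.
           tangent_map M real_mfd (\<lambda>x. J x \<xi>) x v = \<omega> x (gen \<xi> x) v))"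

definition lc_lie_algebra :: "('k::lctvs \<Rightarrow> 'k \<Rightarrow> 'k) \<Rightarrow> bool" where
  "lc_lie_algebra br \<longleftrightarrow>
     (\<forall>x. linear (br x)) \<and> (\<forall>y. linear (\<lambda>x. br x y)) \<and> (\<forall>x. br x x = 0) \<and>
     (\<forall>x y z. br x (br y z) + br y (br z x) + br z (br x y) = 0) \<and>
     continuous_on UNIV (\<lambda>(x, y). br x y)"

text \<open>
  \<open>p\<close> exhibits the locally convex Lie algebra \<open>'k\<close> with bracket \<open>br\<close> as a central extension of the
  Lie algebra of \<open>G\<close>; the kernel of \<open>p\<close> is an arbitrary central ideal.
\<close>
definition central_extension ::
    "('g, 'd::lctvs) lie_group \<Rightarrow> ('k::lctvs \<Rightarrow> 'k \<Rightarrow> 'k) \<Rightarrow> ('k \<Rightarrow> 'd) \<Rightarrow> bool" where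
  "central_extension G br p \<longleftrightarrow>
     lc_lie_algebra br \<and> linear p \<and> continuous_on UNIV p \<and> range p = lie_alg G \<and>
     (\<forall>U. open U \<longrightarrow> openin (top_of_set (lie_alg G)) (p ` U)) \<and>
     (\<forall>x y. p (br x y) = lie_bracket G (p x) (p y)) \<and>
     (\<forall>z. p z = 0 \<longrightarrow> (\<forall>x. br z x = 0))"

text \<open>
  \<open>\<rho>\<close> is a right action of \<open>G\<close> on the dual of the extension that integrates the coadjoint action
  of the Lie algebra of \<open>G\<close>. For right actions, the latter sends \<open>p x\<close> to the transpose of \<open>br x\<close>,
  without a minus sign. Smoothness and derivative are taken pointwise on the extension, and \<open>\<rho>\<close> is
  not required to be linear.
\<close>
definition integrates_coadjoint ::
    "('g, 'd::lctvs) lie_group \<Rightarrow> ('k::lctvs \<Rightarrow> 'k \<Rightarrow> 'k) \<Rightarrow> ('k \<Rightarrow> 'd) \<Rightarrow>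
     (('k \<Rightarrow> real) \<Rightarrow> 'g \<Rightarrow> ('k \<Rightarrow> real)) \<Rightarrow> bool" where
  "integrates_coadjoint G br p \<rho> \<longleftrightarrow> (\<forall>\<kappa> \<in> dual UNIV.
     (\<forall>g \<in> carrier G. \<rho> \<kappa> g \<in> dual UNIV) \<and> \<rho> \<kappa> \<one>\<^bsub>G\<^esub> = \<kappa> \<and>
     (\<forall>g \<in> carrier G. \<forall>h \<in> carrier G. \<rho> \<kappa> (g \<otimes>\<^bsub>G\<^esub> h) = \<rho> (\<rho> \<kappa> g) h) \<and>
     (\<forall>y. smooth_map (gmfd G) real_mfd (\<lambda>g. \<rho> \<kappa> g y) \<and>
        (\<forall>x. tangent_map (gmfd G) real_mfd (\<lambda>g. \<rho> \<kappa> g y) \<one>\<^bsub>G\<^esub> (p x) = \<kappa> (br x y))))"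


section \<open>Coadjoint orbits as symplectic manifolds\<close>

text \<open>
  For infinite-dimensional groups a coadjoint orbit need not have a manifold structure for which
  the orbit map is a submersion. The structures considered here are those that make the orbit
  \<open>\<O>\<close> a homogeneous space immersed in the dual: the action of \<open>G\<close> on \<open>\<O>\<close> is smooth, the
  infinitesimal generators span the tangent spaces, and the evaluations at elements of the Lie
  algebra are smooth and separate tangent vectors. For finite-dimensional \<open>G\<close> the usual structure
  of \<open>G / G\<^sub>\<mu>\<close> is the only one with these properties.
\<close>
definition coadjoint_orbit_mfd ::
    "('g, 'd::lctvs) lie_group \<Rightarrow> ('d \<Rightarrow> real) \<Rightarrow> ('d \<Rightarrow> real, 'e::lctvs) mfd \<Rightarrow> bool" where
  "coadjoint_orbit_mfd G \<mu> \<O> \<longleftrightarrow>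
     points \<O> = coadjoint_orbit G \<mu> \<and> manifold \<O> \<and> left_action G \<O> (coAd G) \<and>
     (\<forall>\<nu> \<in> points \<O>. tangent_space \<O> \<nu> = gen_space G \<O> (coAd G) \<nu>) \<and>
     (\<forall>\<eta> \<in> lie_alg G. smooth_map \<O> real_mfd (\<lambda>\<nu>. \<nu> \<eta>)) \<and>
     (\<forall>\<nu> \<in> points \<O>. \<forall>u \<in> tangent_space \<O> \<nu>.
        (\<forall>\<eta> \<in> lie_alg G. tangent_map \<O> real_mfd (\<lambda>\<nu>. \<nu> \<eta>) \<nu> u = 0) \<longrightarrow> u = 0)"

text \<open>
  The sign of the orbit form is the one for which the inclusion into the dual is a momentum map in
  the above convention.
\<close>
definition kks_form ::
    "('g, 'd::lctvs) lie_group \<Rightarrow> ('d \<Rightarrow> real, 'e::lctvs) mfd \<Rightarrow> ('d \<Rightarrow> real, 'e) form2 \<Rightarrow> bool" where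
  "kks_form G \<O> \<omega> \<longleftrightarrow> symplectic_manifold \<O> \<omega> \<and>
     (\<forall>\<nu> \<in> points \<O>. \<forall>\<xi> \<in> lie_alg G. \<forall>\<eta> \<in> lie_alg G.
        \<omega> \<nu> (inf_gen G \<O> (coAd G) \<xi> \<nu>) (inf_gen G \<O> (coAd G) \<eta> \<nu>) = \<nu> (lie_bracket G \<xi> \<eta>))"

end

theory Submission
  imports Defs
begin

text \<open>
  \<open>J\<^sub>L\<close> is constant on the orbits of \<open>G\<close>, and two points of \<open>N\<close> have the same value under
  \<open>J\<^sub>L\<close> exactly if they lie in the same orbit of \<open>G\<^sub>\<sigma>\<close>; so \<open>J\<^sub>L\<close> descends to an injective map on
  \<open>N / G\<^sub>\<sigma>\<close>. The components of \<open>N\<close> are open orbits of \<open>H\<close> and \<open>\<pi>\<close> is open, hence each component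
  \<open>C\<close> of the quotient is the image of a single one, and \<open>J\<^sub>L\<close> maps \<open>C\<close> bijectively onto a coadjoint
  orbit. The orbit receives the charts and the form of \<open>C\<close>.

  It remains to see that these make it a homogeneous space with the Kirillov form. A vector tangent
  to \<open>N\<close> is annihilated by all \<open>dJ\<^sub>R\<close>, so it lies in \<open>\<g>\<^sub>S\<^sup>\<omega> = \<h>\<^sub>S\<close>; thus the generators of \<open>H\<close>
  span the tangent spaces of the quotient. A vector \<open>v\<close> tangent to \<open>N\<close> with \<open>dJ\<^sub>L v = 0\<close> is
  orthogonal to \<open>\<h>\<^sub>S\<close>, which contains the tangent space of \<open>N\<close>, so \<open>d\<pi> v\<close> is in the kernel of
  \<open>\<omega>\<^sub>\<sigma>\<close> and vanishes. Finally \<open>\<omega>(\<xi>\<^sub>S, \<eta>\<^sub>S) = - d\<langle>J\<^sub>L, \<eta>\<rangle>(\<xi>\<^sub>S) = \<langle>J\<^sub>L, [\<xi>, \<eta>]\<rangle>\<close> by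
  equivariance.
\<close>

section \<open>The chain rule for Bastiani smooth maps\<close>

text \<open>The model spaces are merely locally convex, so every construction that would call for an
  inverse or implicit function theorem is avoided. The orbit is not carved out of the dual of the
  Lie algebra; transporting the charts makes the descended momentum map a diffeomorphism by
  construction, and the work lies in checking that the coadjoint action and the evaluations are
  smooth for the transported charts. For this, points of the orbit are lifted to \<open>N\<close> by
  the local sections that define a submersion, moved inside \<open>S\<close>, and projected again.
  The momentum map is differentiated only after pairing with one element of the Lie algebra, so all
  its derivatives are real valued.

  Such composites need the chain rule to all orders. There a mean value estimate in convex open sets
  and the joint continuity of the derivatives do the work of norm estimates. The Kirillov formula
  needs a second order fact in addition: a functional may be taken out of the limit that defines the
  bracket, because this limit is a mixed second derivative of conjugation and thus exists.\<close>

lemma tendsto_scaleR_lc [tendsto_intros]: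
  fixes a :: "'i \<Rightarrow> 'a::lctvs"
  assumes "(r \<longlongrightarrow> r0) Fil" "(a \<longlongrightarrow> a0) Fil"
  shows "((\<lambda>i. r i *\<^sub>R a i) \<longlongrightarrow> r0 *\<^sub>R a0) Fil"
  using filterlim_compose[OF tendsto_scaleR_lctvs filterlim_Pair[OF assms]] by simp

lemma line_tendsto:
  fixes x v :: "'a::lctvs"
  shows "((\<lambda>t. x + t *\<^sub>R v) \<longlongrightarrow> x) (at (0::real))"
proof -
  have "((\<lambda>t. x + t *\<^sub>R v) \<longlongrightarrow> x + 0 *\<^sub>R v) (at (0::real))"
    by (intro tendsto_add tendsto_const tendsto_scaleR_lc tendsto_ident_at)
  then show ?thesis by simp
qed

lemma tendsto_fun_iff:
  fixes h :: "'i \<Rightarrow> 'j \<Rightarrow> 'a::topological_space"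
  shows "(h \<longlongrightarrow> l) Fil \<longleftrightarrow> (\<forall>j. ((\<lambda>i. h i j) \<longlongrightarrow> l j) Fil)"
  by (simp flip: limitin_canonical_iff euclidean_product_topology add: limitin_componentwise)

lemma dir_derivI:
  assumes "((\<lambda>t::real. (f (x + t *\<^sub>R v) - f x) /\<^sub>R t) \<longlongrightarrow> l) (at 0)"
  shows "dir_deriv f x v = l"
  unfolding dir_deriv_def by (rule tendsto_Lim[OF trivial_limit_at assms])

section \<open>Mean value estimates and strict derivatives\<close>

text \<open>The difference quotient over an interval is the convex combination, weighted by length,
  of the quotients over its two parts. Membership in a convex set thus passes from short intervals
  to long ones, and bisection leaves only short intervals around one point \<open>r\<close>, where
  openness of \<open>B\<close> and the derivative at \<open>r\<close> decide.\<close>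

lemma mean_value_convex:
  fixes \<phi> :: "real \<Rightarrow> 'a::lctvs"
  assumes ab: "a < b" and B: "open B" "convex B"
    and der: "\<And>r. a \<le> r \<Longrightarrow> r \<le> b \<Longrightarrow>
      ((\<lambda>t. (\<phi> (r + t) - \<phi> r) /\<^sub>R t) \<longlongrightarrow> D r) (at 0)"
    and mem: "\<And>r. a \<le> r \<Longrightarrow> r \<le> b \<Longrightarrow> D r \<in> B"
  shows "(\<phi> b - \<phi> a) /\<^sub>R (b - a) \<in> B"
proof -
  \<comment> \<open>The premise \<open>c < d\<close> makes degenerate intervals vacuous, so that the
    bisection principle, which allows equal end points, applies to \<open>P\<close>.\<close>
  define P where "P = (\<lambda>c d. c < d \<longrightarrow> (\<phi> d - \<phi> c) /\<^sub>R (d - c) \<in> B)"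
  have comb: "P c e" if cd: "P c d" and de: "P d e" and "c \<le> d" "d \<le> e" for c d e
  proof (cases "c = d \<or> d = e")
    case True
    with cd de show ?thesis by auto
  next
    case False
    with that have lt: "c < d" "d < e" by auto
    then have m: "(\<phi> d - \<phi> c) /\<^sub>R (d - c) \<in> B" "(\<phi> e - \<phi> d) /\<^sub>R (e - d) \<in> B"
      using cd de by (auto simp: P_def)
    define s where "s = (d - c) / (e - c)"
    define u where "u = (e - d) / (e - c)"
    have su: "0 \<le> s" "0 \<le> u" "s + u = 1"
      using lt by (auto simp: s_def u_def simp flip: add_divide_distrib)
    have "s *\<^sub>R ((\<phi> d - \<phi> c) /\<^sub>R (d - c)) + u *\<^sub>R ((\<phi> e - \<phi> d) /\<^sub>R (e - d)) \<in> B"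
      using convexD[OF B(2) m su] .
    moreover have "s *\<^sub>R ((\<phi> d - \<phi> c) /\<^sub>R (d - c)) = (\<phi> d - \<phi> c) /\<^sub>R (e - c)"
      "u *\<^sub>R ((\<phi> e - \<phi> d) /\<^sub>R (e - d)) = (\<phi> e - \<phi> d) /\<^sub>R (e - c)"
      using lt by (auto simp: s_def u_def field_simps)
    ultimately have "(\<phi> d - \<phi> c) /\<^sub>R (e - c) + (\<phi> e - \<phi> d) /\<^sub>R (e - c) \<in> B" by (simp only:)
    then have "(\<phi> e - \<phi> c) /\<^sub>R (e - c) \<in> B"
      by (simp flip: scaleR_add_right)
    then show ?thesis by (simp add: P_def)
  qed
  have "P a b"
  proof (rule Bolzano)
    show "a \<le> b" using ab by simp
    show "P c e" if "P c d" "P d e" "c \<le> d" "d \<le> e" for c d e using comb that by blast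
    fix r assume r: "a \<le> r" "r \<le> b"
    have "\<forall>\<^sub>F t in at 0. (\<phi> (r + t) - \<phi> r) /\<^sub>R t \<in> B"
      using topological_tendstoD[OF der[OF r] B(1) mem[OF r]] .
    then obtain d where d: "d > 0" "\<And>t. t \<noteq> 0 \<Longrightarrow> \<bar>t\<bar> < d \<Longrightarrow> (\<phi> (r + t) - \<phi> r) /\<^sub>R t \<in> B"
      by (auto simp: eventually_at dist_real_def)
    have "P c e" if "c \<le> r" "r \<le> e" "e - c < d" for c e
    proof (rule comb)
      show "P r e" using that d(2)[of "e - r"] by (auto simp: P_def)
      show "P c r"
      proof -
        have "(\<phi> c - \<phi> r) /\<^sub>R (c - r) = (\<phi> r - \<phi> c) /\<^sub>R (r - c)"
          by (metis inverse_minus_eq minus_diff_eq scaleR_minus_left scaleR_minus_right)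
        then show ?thesis using that d(2)[of "c - r"] by (auto simp: P_def)
      qed
    qed (use that in auto)
    then show "\<exists>d>0. \<forall>c e. c \<le> r \<and> r \<le> e \<and> e - c < d \<longrightarrow> P c e" using d(1) by blast
  qed
  then show ?thesis using ab by (simp add: P_def)
qed

text \<open>One order of the Bastiani condition, isolated so that it can be applied to every
  iterated derivative. Linearity in the direction is not part of it but follows in
  \<open>cont_diff_linear\<close>.\<close>

definition cont_diff :: "'e::lctvs set \<Rightarrow> 'e set \<Rightarrow> ('e \<Rightarrow> 'f::lctvs) \<Rightarrow> bool" where
  "cont_diff F U f \<longleftrightarrow>
     (\<forall>x \<in> U. \<forall>v \<in> F. ((\<lambda>t::real. (f (x + t *\<^sub>R v) - f x) /\<^sub>R t) \<longlongrightarrow> dir_deriv f x v) (at 0)) \<and>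
     continuous_on (U \<times> F) (\<lambda>(x, v). dir_deriv f x v)"

text \<open>Base point, direction and step length may move at the same time; the chain rule needs
  this because the inner difference quotient is a moving direction. Near the limit the whole segment
  lies in a convex set on which the derivatives stay in a given convex open set, so the mean value
  estimate applies.\<close>

lemma strict_derivative:
  fixes f :: "'e::lctvs \<Rightarrow> 'f::lctvs"
  assumes f: "cont_diff F U f" and F: "subspace F" and U: "openin (top_of_set F) U"
    and x: "x \<in> U" and v: "v \<in> F"
    and lims: "(xs \<longlongrightarrow> x) Fil" "(vs \<longlongrightarrow> v) Fil" "(ts \<longlongrightarrow> (0::real)) Fil"
    and ev: "\<forall>\<^sub>F i in Fil. xs i \<in> F" "\<forall>\<^sub>F i in Fil. vs i \<in> F" "\<forall>\<^sub>F i in Fil. ts i \<noteq> 0"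
  shows "((\<lambda>i. (f (xs i + ts i *\<^sub>R vs i) - f (xs i)) /\<^sub>R ts i) \<longlongrightarrow> dir_deriv f x v) Fil"
proof (rule topological_tendstoI)
  fix B0 assume "open B0" "dir_deriv f x v \<in> B0"
  then obtain B where B: "open B" "convex B" "dir_deriv f x v \<in> B" "B \<subseteq> B0"
    using locally_convex by blast
  obtain A where A: "open A" "(x, v) \<in> A" "\<forall>y \<in> U \<times> F. y \<in> A \<longrightarrow> (\<lambda>(x, v). dir_deriv f x v) y \<in> B"
    using f B(1,3) x v unfolding cont_diff_def continuous_on_topological
      by (smt (verit) SigmaI case_prod_conv)
  obtain X0 Y where XY: "open X0" "open Y" "(x, v) \<in> X0 \<times> Y" "X0 \<times> Y \<subseteq> A"
    using open_prod_elim[OF A(1,2)] by blast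
  obtain X1 where X1: "open X1" "U = F \<inter> X1" using U by (auto simp: openin_open)
  obtain X where X: "open X" "convex X" "x \<in> X" "X \<subseteq> X0 \<inter> X1"
    using locally_convex[of "X0 \<inter> X1" x] XY X1 x by blast
  have "((\<lambda>i. xs i + ts i *\<^sub>R vs i) \<longlongrightarrow> x + 0 *\<^sub>R v) Fil"
    by (intro tendsto_intros lims)
  then have e2: "\<forall>\<^sub>F i in Fil. xs i + ts i *\<^sub>R vs i \<in> X"
    using topological_tendstoD X by fastforce
  have e1: "\<forall>\<^sub>F i in Fil. xs i \<in> X" "\<forall>\<^sub>F i in Fil. vs i \<in> Y"
    using topological_tendstoD lims X XY by fastforce+
  from e1 e2 ev show "\<forall>\<^sub>F i in Fil. (f (xs i + ts i *\<^sub>R vs i) - f (xs i)) /\<^sub>R ts i \<in> B0"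
  proof eventually_elim
    case (elim i)
    define y w t where "y = xs i" and "w = vs i" and "t = ts i"
    have yw: "y \<in> X" "w \<in> Y" "y + t *\<^sub>R w \<in> X" "y \<in> F" "w \<in> F" "t \<noteq> 0"
      using elim by (auto simp: y_def w_def t_def)
    define \<phi> where "\<phi> = (\<lambda>r. f (y + r *\<^sub>R w))"
    \<comment> \<open>The step \<open>t\<close> may be negative, while the mean value estimate needs
      \<open>a < b\<close>; exchanging the end points does not change the quotient.\<close>
    define a b where "a = min 0 t" and "b = max 0 t"
    have inU: "y + r *\<^sub>R w \<in> U \<and> y + r *\<^sub>R w \<in> X0" if "a \<le> r" "r \<le> b" for r
    proof -
      define s where "s = r / t"
      have s: "0 \<le> s" "s \<le> 1" "r = s * t"
        using that yw(6) by (auto simp: s_def a_def b_def field_simps min_def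
            max_def split: if_splits)
      have "(1 - s) *\<^sub>R y + s *\<^sub>R (y + t *\<^sub>R w) \<in> X"
        by (rule convexD[OF X(2)]) (use yw s in auto)
      moreover have "(1 - s) *\<^sub>R y + s *\<^sub>R (y + t *\<^sub>R w) = y + r *\<^sub>R w"
        by (simp add: s(3) algebra_simps)
      moreover have "y + r *\<^sub>R w \<in> F" using F yw by (simp add: subspace_add subspace_scale)
      ultimately show ?thesis using X(4) X1(2) by auto
    qed
    have "(\<phi> b - \<phi> a) /\<^sub>R (b - a) \<in> B"
    proof (rule mean_value_convex[where D = "\<lambda>r. dir_deriv f (y + r *\<^sub>R w) w"])
      show "a < b" using yw by (auto simp: a_def b_def)
      fix r assume r: "a \<le> r" "r \<le> b"
      have "((\<lambda>t. (f (y + r *\<^sub>R w + t *\<^sub>R w) - f (y + r *\<^sub>R w)) /\<^sub>R t) \<longlongrightarrow> dir_deriv f (y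
          + r *\<^sub>R w) w) (at 0)"
        using f inU[OF r] yw by (auto simp: cont_diff_def)
      then show "((\<lambda>t. (\<phi> (r + t) - \<phi> r) /\<^sub>R t) \<longlongrightarrow> dir_deriv f (y + r *\<^sub>R w) w) (at 0)"
        by (simp add: \<phi>_def algebra_simps)
      show "dir_deriv f (y + r *\<^sub>R w) w \<in> B"
        using A(3) XY(4) inU[OF r] yw by auto
    qed (use B in auto)
    moreover have "(\<phi> b - \<phi> a) /\<^sub>R (b - a) = (\<phi> t - \<phi> 0) /\<^sub>R t"
    proof (cases "t > 0")
      case True then show ?thesis by (simp add: a_def b_def)
    next
      case False
      then show ?thesis
        by (simp add: a_def b_def min_def max_def)
           (metis minus_diff_eq scaleR_minus_right)
    qed
    ultimately show ?case using B(4) by (auto simp: \<phi>_def y_def w_def t_def)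
  qed
qed

text \<open>For additivity, go first along \<open>t *\<^sub>R u\<close> and then along
  \<open>t *\<^sub>R v\<close>: the second quotient has the moving base point
  \<open>x + t *\<^sub>R u\<close>, which is harmless by strict differentiability. Homogeneity is
  the substitution of \<open>t * a\<close> for \<open>t\<close>.\<close>

lemma cont_diff_linear:
  fixes f :: "'e::lctvs \<Rightarrow> 'f::lctvs"
  assumes f: "cont_diff F U f" and F: "subspace F" and U: "openin (top_of_set F) U" and x: "x \<in> U"
  shows dir_deriv_add: "u \<in> F \<Longrightarrow> v \<in> F \<Longrightarrow> dir_deriv f x (u + v) = dir_deriv f x u + dir_deriv f x v"
    and dir_deriv_scale: "v \<in> F \<Longrightarrow> dir_deriv f x (a *\<^sub>R v) = a *\<^sub>R dir_deriv f x v"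
proof -
  have xF: "x \<in> F" using U x by (auto simp: openin_open)
  note sd = strict_derivative[OF f F U x, where ts = "\<lambda>t. t" and Fil = "at (0::real)"]
  assume v: "v \<in> F"
  show "dir_deriv f x (u + v) = dir_deriv f x u + dir_deriv f x v" if u: "u \<in> F"
  proof (rule dir_derivI)
    have 1: "((\<lambda>t. (f ((x + t *\<^sub>R u) + t *\<^sub>R v) - f (x + t *\<^sub>R u)) /\<^sub>R t) \<longlongrightarrow> dir_deriv f x v) (at 0)"
      by (rule sd) (use F v u xF in \<open>auto simp: line_tendsto eventually_at_filter subspace_add
          subspace_scale tendsto_ident_at\<close>)
    have 2: "((\<lambda>t. (f (x + t *\<^sub>R u) - f x) /\<^sub>R t) \<longlongrightarrow> dir_deriv f x u) (at 0)"
      using f x u by (auto simp: cont_diff_def)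
    show "((\<lambda>t. (f (x + t *\<^sub>R (u + v)) - f x) /\<^sub>R t) \<longlongrightarrow> dir_deriv f x u + dir_deriv f x v) (at 0)"
      using tendsto_add[OF 2 1]
      by (simp add: scaleR_add_right[of _ u v] add.assoc[symmetric] scaleR_diff_right)
  qed
  show "dir_deriv f x (a *\<^sub>R v) = a *\<^sub>R dir_deriv f x v"
  proof (cases "a = 0")
    case True
    then show ?thesis by (auto intro!: dir_derivI)
  next
    case False
    have "((\<lambda>t. (f (x + t *\<^sub>R v) - f x) /\<^sub>R t) \<longlongrightarrow> dir_deriv f x v) (at 0)"
      using f x v by (auto simp: cont_diff_def)
    moreover have "filterlim (\<lambda>t. t * a) (at 0) (at (0::real))"
      by (rule filterlim_atI) (use False in \<open>auto intro!: tendsto_eq_intros simp: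
          eventually_at_filter\<close>)
    ultimately have "((\<lambda>t. (f (x + (t * a) *\<^sub>R v) - f x) /\<^sub>R (t * a)) \<longlongrightarrow> dir_deriv f x v) (at 0)"
      by (rule filterlim_compose)
    from tendsto_scaleR_lc[OF tendsto_const[of a] this] show ?thesis
      using False by (intro dir_derivI) (simp add: mult.left_commute[of a])
  qed
qed


section \<open>Iterated directional derivatives\<close>

lemma bastiani_smooth_deriv:
  assumes "bastiani_smooth F U f" "set vs \<subseteq> F" "v \<in> F" "x \<in> U"
  shows "((\<lambda>t::real. (iter_deriv f vs (x + t *\<^sub>R v) - iter_deriv f vs x) /\<^sub>R t)
      \<longlongrightarrow> iter_deriv f (v # vs) x) (at 0)"
proof -
  obtain l where l: "((\<lambda>t::real. (iter_deriv f vs (x + t *\<^sub>R v)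
      - iter_deriv f vs x) /\<^sub>R t) \<longlongrightarrow> l) (at 0)"
    using assms unfolding bastiani_smooth_def by blast
  with dir_derivI[OF l] show ?thesis by simp
qed

text \<open>The arguments of an iterated derivative are functions \<open>v\<close> paired with their limits \<open>a\<close>.\<close>
lemma bastiani_smooth_tendsto:
  fixes f :: "'e::lctvs \<Rightarrow> 'f::lctvs"
  assumes f: "bastiani_smooth F U f" and x: "x \<in> U" "(xs \<longlongrightarrow> x) Fil" "\<forall>\<^sub>F i in Fil. xs i \<in> U"
    and F: "subspace F"
    and vl: "\<And>v a. (v, a) \<in> set vl \<Longrightarrow> (v \<longlongrightarrow> a) Fil \<and> a \<in> F \<and> (\<forall>\<^sub>F i in Fil. v i \<in> F)"
  shows "((\<lambda>i. iter_deriv f (map (\<lambda>p. fst p i) vl) (xs i)) \<longlongrightarrow> iter_deriv f (map snd vl) x) Fil"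
proof -
  define k where "k = length vl"
  \<comment> \<open>Continuity of the \<open>k\<close>-th derivative is formulated for infinite
    sequences, so the lists are padded with 0, which belongs to \<open>F\<close>.\<close>
  define w where "w = (\<lambda>i j. if j < k then fst (vl ! j) i else 0)"
  define a where "a = (\<lambda>j. if j < k then snd (vl ! j) else 0)"
  have wl: "map (w i) [0..<k] = map (\<lambda>p. fst p i) vl" for i
    by (rule nth_equalityI) (auto simp: w_def k_def)
  have al: "map a [0..<k] = map snd vl"
    by (rule nth_equalityI) (auto simp: a_def k_def)
  have props: "(fst (vl ! j) \<longlongrightarrow> snd (vl ! j)) Fil \<and> snd (vl ! j) \<in> F
      \<and> (\<forall>\<^sub>F i in Fil. fst (vl ! j) i \<in> F)"
    if "j < k" for j
    using that vl[of "fst (vl ! j)" "snd (vl ! j)"] by (simp add: k_def)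
  have 0: "0 \<in> F" using F by (rule subspace_0)
  have "(w \<longlongrightarrow> a) Fil"
    unfolding tendsto_fun_iff using props by (auto simp: w_def a_def)
  with x(2) have lim: "((\<lambda>i. (xs i, w i)) \<longlongrightarrow> (x, a)) Fil" by (rule tendsto_Pair)
  have aF: "range a \<subseteq> F" using props 0 by (auto simp: a_def)
  have "\<forall>\<^sub>F i in Fil. \<forall>j\<in>{..<k}. fst (vl ! j) i \<in> F"
    by (subst eventually_ball_finite_distrib) (use props in auto)
  then have wF: "\<forall>\<^sub>F i in Fil. range (w i) \<subseteq> F"
    by eventually_elim (use 0 in \<open>auto simp: w_def\<close>)
  have "continuous_on (U \<times> {w. range w \<subseteq> F}) (\<lambda>(x, w). iter_deriv f (map w [0..<k]) x)"
    using f by (auto simp: bastiani_smooth_def)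
  moreover have "\<forall>\<^sub>F i in Fil. (xs i, w i) \<in> U \<times> {w. range w \<subseteq> F}"
    using x(3) wF by eventually_elim auto
  moreover have "(x, a) \<in> U \<times> {w. range w \<subseteq> F}" using x aF by auto
  ultimately have "((\<lambda>i. case (xs i, w i) of (x, w) \<Rightarrow> iter_deriv f (map w [0..<k]) x) \<longlongrightarrow>
      (case (x, a) of (x, w) \<Rightarrow> iter_deriv f (map w [0..<k]) x)) Fil"
    by (intro continuous_on_tendsto_compose[OF _ lim])
  then show ?thesis by (simp add: wl al)
qed

lemma bastiani_smooth_continuous:
  assumes "bastiani_smooth F U f" "subspace F"
  shows "continuous_on U f"
proof -
  have "(f \<longlongrightarrow> f x) (at x within U)" if "x \<in> U" for x
    using bastiani_smooth_tendsto[OF assms(1) that tendsto_ident_at _ assms(2), of U "[]"]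
    by (simp add: eventually_at_filter)
  then show ?thesis by (simp add: continuous_on_def)
qed

lemma bastiani_smooth_cont_diff:
  assumes f: "bastiani_smooth F U f" and F: "subspace F" and vs: "set vs \<subseteq> F"
  shows "cont_diff F U (iter_deriv f vs)"
  unfolding cont_diff_def
proof (intro conjI ballI)
  fix x v assume "x \<in> U" "v \<in> F"
  then show "((\<lambda>t. (iter_deriv f vs (x + t *\<^sub>R v) - iter_deriv f vs x) /\<^sub>R t)
      \<longlongrightarrow> dir_deriv (iter_deriv f vs) x v) (at 0)"
    using bastiani_smooth_deriv[OF f vs] by simp
next
  have "((\<lambda>q. iter_deriv f (snd q # vs) (fst q))
      \<longlongrightarrow> iter_deriv f (v # vs) x) (at (x, v) within U \<times> F)"
    if "x \<in> U" "v \<in> F" for x v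
  proof -
    have lim: "((\<lambda>q. q) \<longlongrightarrow> (x, v)) (at (x, v) within U \<times> F)" by (rule tendsto_ident_at)
    define vl where "vl = (snd, v) # map (\<lambda>a. (\<lambda>_ :: 'a \<times> 'a. a, a)) vs"
    have "((\<lambda>q. iter_deriv f (map (\<lambda>p. fst p q) vl) (fst q)) \<longlongrightarrow>
      iter_deriv f (map snd vl) x) (at (x, v) within U \<times> F)"
      unfolding vl_def
      by (rule bastiani_smooth_tendsto[OF f])
         (use that F vs tendsto_fst[OF lim] tendsto_snd[OF lim] in \<open>auto simp:
             eventually_at_filter intro!: always_eventually\<close>)
    then show ?thesis by (simp add: vl_def comp_def)
  qed
  then show "continuous_on (U \<times> F) (\<lambda>(x, v). dir_deriv (iter_deriv f vs) x v)"
    by (auto simp: continuous_on_def case_prod_unfold)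
qed

lemma line_in:
  fixes x :: "'a::lctvs"
  assumes U: "openin (top_of_set F) U" and F: "subspace F" and "x \<in> U" "v \<in> F"
  shows "\<forall>\<^sub>F t in at (0::real). x + t *\<^sub>R v \<in> U"
proof -
  obtain X where X: "open X" "U = F \<inter> X" using U by (auto simp: openin_open)
  then have "\<forall>\<^sub>F t in at (0::real). x + t *\<^sub>R v \<in> X"
    using topological_tendstoD[OF line_tendsto, of X x v] assms by auto
  then show ?thesis
    by eventually_elim (use assms X in \<open>auto simp: subspace_add subspace_scale\<close>)
qed

lemma dir_deriv_cong:
  assumes U: "openin (top_of_set F) U" and F: "subspace F" and "x \<in> U" "v \<in> F"
    and eq: "\<And>y. y \<in> U \<Longrightarrow> f y = g y"
  shows "dir_deriv f x v = dir_deriv g x v"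
proof -
  have "\<forall>\<^sub>F t in at (0::real). (f (x + t *\<^sub>R v) - f x) /\<^sub>R t = (g (x + t *\<^sub>R v) - g x) /\<^sub>R t"
    using line_in[OF assms(1-4)] by eventually_elim (use eq assms in auto)
  then have "((\<lambda>t. (f (x + t *\<^sub>R v) - f x) /\<^sub>R t) \<longlongrightarrow> l) (at 0) \<longleftrightarrow>
     ((\<lambda>t. (g (x + t *\<^sub>R v) - g x) /\<^sub>R t) \<longlongrightarrow> l) (at (0::real))" for l
    by (rule tendsto_cong)
  \<comment> \<open>\<open>Lim\<close> is a definite description, so equivalent limit statements
    give equal values whether or not the limit exists.\<close>
  then show ?thesis by (simp add: dir_deriv_def t2_space_class.Lim_def)
qed

lemma iter_deriv_cong:
  assumes U: "openin (top_of_set F) U" and F: "subspace F"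
    and eq: "\<And>y. y \<in> U \<Longrightarrow> f y = g y"
  shows "set vs \<subseteq> F \<Longrightarrow> x \<in> U \<Longrightarrow> iter_deriv f vs x = iter_deriv g vs x"
proof (induction vs arbitrary: x)
  case (Cons v vs)
  then show ?case by (auto intro!: dir_deriv_cong[OF U F])
qed (use eq in auto)

lemma bastiani_smooth_cong:
  assumes U: "openin (top_of_set F) U" and F: "subspace F"
    and eq: "\<And>y. y \<in> U \<Longrightarrow> f y = g y" and f: "bastiani_smooth F U f"
  shows "bastiani_smooth F U g"
  unfolding bastiani_smooth_def
proof (intro conjI allI impI)
  have cong: "iter_deriv f vs x = iter_deriv g vs x" if "set vs \<subseteq> F" "x \<in> U" for vs x
    using iter_deriv_cong[OF U F _ that, of f g] eq by blast
  fix vs v x assume A: "set vs \<subseteq> F \<and> v \<in> F \<and> x \<in> U"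
  then have "\<forall>\<^sub>F t in at (0::real). x + t *\<^sub>R v \<in> U" using line_in[OF U F] by blast
  then have *: "\<forall>\<^sub>F t in at (0::real). (iter_deriv f vs (x + t *\<^sub>R v) - iter_deriv f vs x) /\<^sub>R t
      = (iter_deriv g vs (x + t *\<^sub>R v) - iter_deriv g vs x) /\<^sub>R t"
    by eventually_elim (use cong A in auto)
  show "\<exists>l. ((\<lambda>t::real. (iter_deriv g vs (x + t *\<^sub>R v) - iter_deriv g vs x) /\<^sub>R t) \<longlongrightarrow> l) (at 0)"
    using bastiani_smooth_deriv[OF f, of vs v x] A tendsto_cong[OF *] by blast
next
  fix k
  have cong: "iter_deriv f vs x = iter_deriv g vs x" if "set vs \<subseteq> F" "x \<in> U" for vs x
    using iter_deriv_cong[OF U F _ that, of f g] eq by blast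
  have "continuous_on (U \<times> {w. range w \<subseteq> F}) (\<lambda>(x, w :: nat \<Rightarrow> 'a). iter_deriv f (map w [0..<k]) x)"
    using f by (auto simp: bastiani_smooth_def)
  then show "continuous_on (U \<times> {w. range w \<subseteq> F}) (\<lambda>(x, w :: nat \<Rightarrow> 'a). iter_deriv
      g (map w [0..<k]) x)"
    by (rule continuous_on_eq) (auto intro!: cong simp: image_subset_iff)
qed

lemma bastiani_smooth_local:
  assumes F: "subspace F"
    and loc: "\<And>x. x \<in> U \<Longrightarrow> \<exists>W. openin (top_of_set F) W \<and> x \<in> W \<and> W \<subseteq> U \<and> bastiani_smooth F W f"
  shows "bastiani_smooth F U f"
  unfolding bastiani_smooth_def
proof (intro conjI allI impI)
  fix vs v x assume "set vs \<subseteq> F \<and> v \<in> F \<and> x \<in> U"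
  then show "\<exists>l. ((\<lambda>t::real. (iter_deriv f vs (x + t *\<^sub>R v) - iter_deriv f vs x) /\<^sub>R t) \<longlongrightarrow> l) (at 0)"
    using loc[of x] unfolding bastiani_smooth_def by blast
next
  fix k
  let ?h = "\<lambda>(x, w :: nat \<Rightarrow> 'a). iter_deriv f (map w [0..<k]) x"
  let ?A = "{w :: nat \<Rightarrow> 'a. range w \<subseteq> F}"
  show "continuous_on (U \<times> ?A) ?h"
    unfolding continuous_on_def
  proof
    fix q assume q: "q \<in> U \<times> ?A"
    then obtain W where W: "openin (top_of_set F) W" "fst q \<in> W" "W \<subseteq> U" "bastiani_smooth F W f"
      using loc[of "fst q"] by auto
    then obtain X where X: "open X" "W = F \<inter> X" by (auto simp: openin_open)
    have c: "continuous_on (W \<times> ?A) ?h" using W(4) by (auto simp: bastiani_smooth_def)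
    have UF: "U \<subseteq> F" using loc by (meson in_mono openin_imp_subset subsetI)
    have "at q within U \<times> ?A = at q within W \<times> ?A"
      by (rule at_within_nhd[where S = "X \<times> UNIV"]) (use X W UF q in \<open>auto intro!: open_Times\<close>)
    then show "(?h \<longlongrightarrow> ?h q) (at q within U \<times> ?A)"
      using c W q by (auto simp: continuous_on_def)
  qed
qed

lemma bastiani_smooth_subset:
  assumes "bastiani_smooth F U f" "F' \<subseteq> F" "U' \<subseteq> U"
  shows "bastiani_smooth F' U' f"
proof -
  have "U' \<times> {w. range w \<subseteq> F'} \<subseteq> U \<times> {w. range w \<subseteq> F}" using assms by auto
  then have "continuous_on (U' \<times> {w. range w \<subseteq> F'}) (\<lambda>(x, w :: nat \<Rightarrow> 'a). iter_deriv f
      (map w [0..<k]) x)" for k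
    using assms(1) unfolding bastiani_smooth_def by (blast intro: continuous_on_subset)
  moreover have "\<exists>l. ((\<lambda>t::real. (iter_deriv f vs (x + t *\<^sub>R v)
      - iter_deriv f vs x) /\<^sub>R t) \<longlongrightarrow> l) (at 0)"
    if "set vs \<subseteq> F' \<and> v \<in> F' \<and> x \<in> U'" for vs v x
    using bastiani_smooth_deriv[OF assms(1), of vs v x] that assms(2,3) by blast
  ultimately show ?thesis unfolding bastiani_smooth_def by blast
qed

text \<open>Difference quotients of values in a subspace stay in it, and closedness carries this to
  the limit. Thus derivatives of coordinate expressions take values in the model space of the target
  chart.\<close>

lemma iter_deriv_mem:
  assumes f: "bastiani_smooth F U f" and F: "subspace F" and U: "openin (top_of_set F) U"
    and G: "subspace G" "closed G" and fG: "f ` U \<subseteq> G"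
  shows "set vs \<subseteq> F \<Longrightarrow> x \<in> U \<Longrightarrow> iter_deriv f vs x \<in> G"
proof (induction vs arbitrary: x)
  case (Cons v vs)
  have "((\<lambda>t::real. (iter_deriv f vs (x + t *\<^sub>R v) - iter_deriv f vs x) /\<^sub>R t)
      \<longlongrightarrow> iter_deriv f (v # vs) x) (at 0)"
    using Cons by (intro bastiani_smooth_deriv[OF f]) auto
  moreover have "\<forall>\<^sub>F t in at (0::real). x + t *\<^sub>R v \<in> U"
    using Cons by (intro line_in[OF U F]) auto
  then have "\<forall>\<^sub>F t in at (0::real). (iter_deriv f vs (x + t *\<^sub>R v) - iter_deriv f vs x) /\<^sub>R t \<in> G"
    by eventually_elim (use Cons G in \<open>auto simp: subspace_diff subspace_scale\<close>)
  ultimately show ?case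
    using Lim_in_closed_set[OF G(2)] by (metis trivial_limit_at)
qed (use fG in auto)

text \<open>The slot after \<open>us\<close> is linear at the moment it is taken, by
  \<open>cont_diff_linear\<close>; the directions in \<open>us\<close> are applied later, and
  differentiating the linear identity preserves it.\<close>

lemma iter_deriv_linear:
  assumes f: "bastiani_smooth F U f" and F: "subspace F" and U: "openin (top_of_set F) U"
    and "u \<in> F" "v \<in> F" "set ws \<subseteq> F"
  shows "set us \<subseteq> F \<Longrightarrow> x \<in> U \<Longrightarrow>
    iter_deriv f (us @ (a *\<^sub>R u + b *\<^sub>R v) # ws) x =
      a *\<^sub>R iter_deriv f (us @ u # ws) x + b *\<^sub>R iter_deriv f (us @ v # ws) x"
proof (induction us arbitrary: x)
  case Nil
  have "cont_diff F U (iter_deriv f ws)"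
    using assms by (intro bastiani_smooth_cont_diff[OF f F])
  note L = cont_diff_linear[OF this F U Nil(2)]
  show ?case using assms L by (simp add: subspace_scale)
next
  case (Cons w us)
  let ?d = "\<lambda>u x t. (iter_deriv f (us @ u # ws) (x + t *\<^sub>R w) - iter_deriv f (us @ u # ws) x) /\<^sub>R t"
  have lim: "((\<lambda>t::real. ?d u x t) \<longlongrightarrow> iter_deriv f ((w # us) @ u # ws) x) (at 0)" if "u \<in> F" for u
    using bastiani_smooth_deriv[OF f, of "us @ u # ws" w x] Cons assms that by auto
  have ev: "\<forall>\<^sub>F t in at (0::real). x + t *\<^sub>R w \<in> U"
    using Cons by (intro line_in[OF U F]) auto
  have cF: "a *\<^sub>R u + b *\<^sub>R v \<in> F" using assms by (auto simp: subspace_add subspace_scale)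
  have "((\<lambda>t::real. a *\<^sub>R ?d u x t + b *\<^sub>R ?d v x t) \<longlongrightarrow>
     a *\<^sub>R iter_deriv f ((w # us) @ u # ws) x + b *\<^sub>R iter_deriv f ((w # us) @ v # ws) x) (at 0)"
    using assms by (intro tendsto_intros lim)
  moreover have "\<forall>\<^sub>F t in at (0::real). a *\<^sub>R ?d u x t + b *\<^sub>R ?d v x t
      = ?d (a *\<^sub>R u + b *\<^sub>R v) x t"
    using ev by eventually_elim (use Cons in \<open>simp add: algebra_simps\<close>)
  ultimately have "((\<lambda>t::real. ?d (a *\<^sub>R u + b *\<^sub>R v) x t) \<longlongrightarrow>
     a *\<^sub>R iter_deriv f ((w # us) @ u # ws) x + b *\<^sub>R iter_deriv f ((w # us) @ v # ws) x) (at 0)"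
    by (rule Lim_transform_eventually)
  with lim[OF cF] show ?case
    by (rule tendsto_unique[OF trivial_limit_at])
qed


section \<open>The formula of Faa di Bruno\<close>

text \<open>
  The higher chain rule needs no symmetry of the derivatives: differentiating a term of the formula
  of Faa di Bruno once more in a direction \<open>v\<close> either adds \<open>v\<close> to one of the blocks or opens the
  new block \<open>[v]\<close>, which is the outermost one.
\<close>
fun extend_blocks :: "'a \<Rightarrow> 'a list list \<Rightarrow> 'a list list \<Rightarrow> 'a list list list" where
  "extend_blocks v pre [] = [[v] # pre]"
| "extend_blocks v pre (b # bs) = (pre @ (v # b) # bs) # extend_blocks v (pre @ [b]) bs"

text \<open>The set partitions of the positions of the list. Each occurs exactly once, according to
  the block that receives the head.\<close>

fun blocks :: "'a list \<Rightarrow> 'a list list list" where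
  "blocks [] = [[]]"
| "blocks (v # vs) = concat (map (extend_blocks v []) (blocks vs))"

lemma extend_blocks_map:
  "extend_blocks (h v) (map (map h) pre) (map (map h) bs)
      = map (map (map h)) (extend_blocks v pre bs)"
proof (induction bs arbitrary: pre)
  case (Cons b bs)
  from Cons[of "pre @ [b]"] show ?case by simp
qed simp

text \<open>Partitions depend on positions only. Hence for moving directions \<open>w\<close> the
  sum can be indexed by the fixed partitions of \<open>[0..<k]\<close>, and its continuity can be
  checked summand by summand.\<close>

lemma blocks_map: "blocks (map h vs) = map (map (map h)) (blocks vs)"
  by (induction vs) (auto simp: map_concat comp_def extend_blocks_map[where pre = "[]", simplified])

lemma extend_blocks_subset:
  "\<beta> \<in> set (extend_blocks a pre bs) \<Longrightarrow> b \<in> set \<beta> \<Longrightarrow>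
   set b \<subseteq> insert a (\<Union>c \<in> set pre \<union> set bs. set c)"
proof (induction bs arbitrary: pre)
  case Nil
  then show ?case by auto
next
  case (Cons c bs)
  then consider "\<beta> = pre @ (a # c) # bs" | "\<beta> \<in> set (extend_blocks a (pre @ [c]) bs)"
    by auto
  then show ?case
  proof cases
    case 1
    then show ?thesis using Cons.prems by auto
  next
    case 2
    then show ?thesis using Cons.IH[OF 2 Cons.prems(2)] by simp
  qed
qed

lemma blocks_subset: "\<beta> \<in> set (blocks vs) \<Longrightarrow> b \<in> set \<beta> \<Longrightarrow> set b \<subseteq> set vs"
proof (induction vs arbitrary: \<beta> b)
  case (Cons v vs)
  then obtain \<gamma> where \<gamma>: "\<gamma> \<in> set (blocks vs)" "\<beta> \<in> set (extend_blocks v [] \<gamma>)" by auto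
  have "set b \<subseteq> insert v (\<Union>c \<in> set \<gamma>. set c)"
    using extend_blocks_subset[OF \<gamma>(2) Cons.prems(2)] by simp
  moreover have "(\<Union>c \<in> set \<gamma>. set c) \<subseteq> set vs" using Cons.IH[OF \<gamma>(1)] by blast
  ultimately show ?case by auto
qed simp

lemma tendsto_sum_list:
  fixes h :: "'a \<Rightarrow> 'i \<Rightarrow> 'b::topological_ab_group_add"
  shows "(\<And>a. a \<in> set as \<Longrightarrow> (h a \<longlongrightarrow> l a) Fil) \<Longrightarrow>
    ((\<lambda>i. \<Sum>a\<leftarrow>as. h a i) \<longlongrightarrow> (\<Sum>a\<leftarrow>as. l a)) Fil"
  by (induction as) (auto intro!: tendsto_add)

context
  fixes f :: "'e::lctvs \<Rightarrow> 'f::lctvs" and g :: "'f \<Rightarrow> 'h::lctvs" and F U F' V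
  assumes f: "bastiani_smooth F U f" and g: "bastiani_smooth F' V g"
    and F: "subspace F" and U: "openin (top_of_set F) U"
    and F': "subspace F'" "closed F'" and V: "openin (top_of_set F') V"
    and fU: "f ` U \<subseteq> V"
begin

lemma block_deriv_mem: "set b \<subseteq> F \<Longrightarrow> x \<in> U \<Longrightarrow> iter_deriv f b x \<in> F'"
  using iter_deriv_mem[OF f F U F'] fU V by (auto simp: openin_open)

lemma block_deriv_tendsto:
  assumes "set b \<subseteq> F" "x \<in> U" "v \<in> F"
  shows "((\<lambda>t::real. iter_deriv f b (x + t *\<^sub>R v)) \<longlongrightarrow> iter_deriv f b x) (at 0)"
proof -
  have "((\<lambda>t. iter_deriv f (map (\<lambda>p. fst p t) (map (\<lambda>a. (\<lambda>_. a, a)) b)) (x + t *\<^sub>R v)) \<longlongrightarrow>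
      iter_deriv f (map snd (map (\<lambda>a. (\<lambda>_ :: real. a, a)) b)) x) (at 0)"
    by (rule bastiani_smooth_tendsto[OF f assms(2) line_tendsto line_in[OF U F assms(2,3)] F])
       (use assms in auto)
  then show ?thesis by (simp add: comp_def)
qed

text \<open>The arguments of the multilinear outer derivative are frozen at \<open>x\<close> one
  after the other: the blocks in \<open>pre\<close> are already evaluated at \<open>x\<close>, those
  in \<open>bs\<close> still at \<open>x + t *\<^sub>R v\<close>. Freezing a block contributes the
  summand in which \<open>v\<close> joins this block. Once all are frozen, only the base point
  \<open>f (x + t *\<^sub>R v)\<close> moves, and it contributes the new block
  \<open>[v]\<close>.\<close>

lemma chain_rule_block:
  assumes x: "x \<in> U" and v: "v \<in> F"
  shows "\<forall>b \<in> set pre. set b \<subseteq> F \<Longrightarrow> \<forall>b \<in> set bs. set b \<subseteq> F \<Longrightarrow>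
    ((\<lambda>t::real. (iter_deriv g (map (\<lambda>b. iter_deriv f b x) pre @ map (\<lambda>b. iter_deriv f b (x
        + t *\<^sub>R v)) bs) (f (x + t *\<^sub>R v))
        - iter_deriv g (map (\<lambda>b. iter_deriv f b x) (pre @ bs)) (f x)) /\<^sub>R t)
      \<longlongrightarrow> (\<Sum>\<beta>\<leftarrow>extend_blocks v pre bs. iter_deriv g (map (\<lambda>b. iter_deriv f b x) \<beta>) (f x))) (at 0)"
proof (induction bs arbitrary: pre)
  case Nil
  define ws where "ws = map (\<lambda>b. iter_deriv f b x) pre"
  have ws: "set ws \<subseteq> F'" using Nil x block_deriv_mem by (auto simp: ws_def)
  have fx: "f x \<in> V" "f x \<in> F'" using fU x V by (auto simp: openin_open)
  \<comment> \<open>Writing \<open>f (x + t *\<^sub>R v)\<close> as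
    \<open>f x + t *\<^sub>R q t\<close> turns the quotient into one with the convergent direction
    \<open>q t\<close>, to which \<open>strict_derivative\<close> applies.\<close>
  define q where "q = (\<lambda>t::real. (f (x + t *\<^sub>R v) - f x) /\<^sub>R t)"
  have ev: "\<forall>\<^sub>F t in at (0::real). x + t *\<^sub>R v \<in> U" by (rule line_in[OF U F x v])
  have q: "(q \<longlongrightarrow> iter_deriv f [v] x) (at 0)"
    unfolding q_def using bastiani_smooth_deriv[OF f _ v x, of "[]"] by simp
  have qF: "\<forall>\<^sub>F t in at 0. q t \<in> F'"
    using ev
  proof eventually_elim
    case (elim t)
    then have "f (x + t *\<^sub>R v) \<in> F'" using fU V by (auto simp: openin_open)
    then show ?case using F' fx by (simp add: q_def subspace_diff subspace_scale)
  qed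
  have "((\<lambda>t. (iter_deriv g ws (f x + t *\<^sub>R q t) - iter_deriv g ws (f x)) /\<^sub>R t) \<longlongrightarrow>
      dir_deriv (iter_deriv g ws) (f x) (iter_deriv f [v] x)) (at 0)"
    by (rule strict_derivative[OF bastiani_smooth_cont_diff[OF g F'(1) ws] F'(1) V fx(1) _
        tendsto_const q tendsto_ident_at])
       (use fx v x qF block_deriv_mem[of "[v]" x] in \<open>auto simp: eventually_at_filter\<close>)
  moreover have "\<forall>\<^sub>F t in at (0::real). (iter_deriv g ws (f x + t *\<^sub>R q t)
      - iter_deriv g ws (f x)) /\<^sub>R t =
      (iter_deriv g ws (f (x + t *\<^sub>R v)) - iter_deriv g ws (f x)) /\<^sub>R t"
    by (auto simp: q_def eventually_at_filter)
  ultimately show ?case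
    by (auto simp: ws_def intro: Lim_transform_eventually)
next
  case (Cons b bs)
  define ws where "ws = map (\<lambda>b. iter_deriv f b x) pre"
  define L where "L = (\<lambda>t::real. map (\<lambda>b. iter_deriv f b (x + t *\<^sub>R v)) bs)"
  define y where "y = (\<lambda>t::real. f (x + t *\<^sub>R v))"
  define d where "d = (\<lambda>t::real. (iter_deriv f b (x + t *\<^sub>R v) - iter_deriv f b x) /\<^sub>R t)"
  have ev: "\<forall>\<^sub>F t in at (0::real). x + t *\<^sub>R v \<in> U" by (rule line_in[OF U F x v])
  have ws: "set ws \<subseteq> F'" using Cons x block_deriv_mem by (auto simp: ws_def)
  have b: "set b \<subseteq> F" and bs: "\<forall>b\<in>set bs. set b \<subseteq> F" using Cons by auto
  have fx: "f x \<in> V" using fU x by auto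
  have "((\<lambda>t. (iter_deriv g (map (\<lambda>b. iter_deriv f b x) (pre @ [b]) @ L t) (y t)
        - iter_deriv g (map (\<lambda>b. iter_deriv f b x) ((pre @ [b]) @ bs)) (f x)) /\<^sub>R t)
      \<longlongrightarrow> (\<Sum>\<beta>\<leftarrow>extend_blocks v (pre @ [b]) bs. iter_deriv g (map (\<lambda>b. iter_deriv f b
          x) \<beta>) (f x))) (at 0)"
    unfolding L_def y_def by (rule Cons.IH) (use Cons in auto)
  then have lim1: "((\<lambda>t. (iter_deriv g (ws @ iter_deriv f b x # L t) (y t)
        - iter_deriv g (map (\<lambda>b. iter_deriv f b x) (pre @ b # bs)) (f x)) /\<^sub>R t)
      \<longlongrightarrow> (\<Sum>\<beta>\<leftarrow>extend_blocks v (pre @ [b]) bs. iter_deriv g (map (\<lambda>b. iter_deriv f b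
          x) \<beta>) (f x))) (at 0)"
    by (simp add: ws_def)
  \<comment> \<open>Frozen blocks are constant functions, the current block is replaced by its
    difference quotient \<open>d\<close>, and the remaining ones still move. Joint continuity of the
    derivative of \<open>g\<close> gives the limit.\<close>
  define vl where "vl = map (\<lambda>a. (\<lambda>_ :: real. a, a)) ws @ (d, iter_deriv f (v # b) x) #
      map (\<lambda>b. (\<lambda>t. iter_deriv f b (x + t *\<^sub>R v), iter_deriv f b x)) bs"
  have "((\<lambda>t. iter_deriv g (map (\<lambda>p. fst p t) vl) (y t)) \<longlongrightarrow> iter_deriv g (map snd vl) (f x)) (at 0)"
  proof (rule bastiani_smooth_tendsto[OF g fx _ _ F'(1)])
    show "(y \<longlongrightarrow> f x) (at 0)" using block_deriv_tendsto[of "[]" x v] x v by (simp add: y_def)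
    show "\<forall>\<^sub>F t in at 0. y t \<in> V" using ev by eventually_elim (use fU in \<open>auto simp: y_def\<close>)
    fix u a assume "(u, a) \<in> set vl"
    then consider "a \<in> set ws" "u = (\<lambda>_. a)" | "u = d" "a = iter_deriv f (v # b) x"
      | c where "c \<in> set bs" "u = (\<lambda>t. iter_deriv f c (x + t *\<^sub>R v))" "a = iter_deriv f c x"
      by (auto simp: vl_def)
    then show "(u \<longlongrightarrow> a) (at 0) \<and> a \<in> F' \<and> (\<forall>\<^sub>F i in at 0. u i \<in> F')"
    proof cases
      case 1
      then show ?thesis using ws by auto
    next
      case 2
      have "\<forall>\<^sub>F t in at 0. d t \<in> F'"
        using ev
      proof eventually_elim
        case (elim t)
        then show ?case
          using block_deriv_mem[OF b] x F' by (simp add: d_def subspace_diff subspace_scale)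
      qed
      moreover have "iter_deriv f (v # b) x \<in> F'"
        using block_deriv_mem[of "v # b" x] v b x by simp
      moreover have "(d \<longlongrightarrow> iter_deriv f (v # b) x) (at 0)"
        unfolding d_def by (rule bastiani_smooth_deriv[OF f b v x])
      ultimately show ?thesis using 2 by simp
    next
      case 3
      then have c: "set c \<subseteq> F" using bs by auto
      have "\<forall>\<^sub>F t in at 0. iter_deriv f c (x + t *\<^sub>R v) \<in> F'"
        using ev by eventually_elim (rule block_deriv_mem[OF c])
      then show ?thesis using 3 block_deriv_tendsto[OF c x v] block_deriv_mem[OF c x] by simp
    qed
  qed
  then have "((\<lambda>t. iter_deriv g (ws @ d t # L t) (y t)) \<longlongrightarrow>
      iter_deriv g (ws @ iter_deriv f (v # b) x # map (\<lambda>b. iter_deriv f b x) bs) (f x)) (at 0)"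
    by (simp add: vl_def L_def comp_def)
  \<comment> \<open>Linearity in the slot after \<open>ws\<close> pulls the difference quotient in
    one argument inside, where it becomes \<open>d t\<close>.\<close>
  moreover have "\<forall>\<^sub>F t in at (0::real). iter_deriv g (ws @ d t # L t) (y t) =
      (iter_deriv g (ws @ iter_deriv f b (x + t *\<^sub>R v) # L t) (y t)
          - iter_deriv g (ws @ iter_deriv f b x # L t) (y t)) /\<^sub>R t"
    using ev
  proof eventually_elim
    case (elim t)
    have "d t = inverse t *\<^sub>R iter_deriv f b (x + t *\<^sub>R v) + (- inverse t) *\<^sub>R iter_deriv f b x"
      by (simp add: d_def algebra_simps)
    moreover have "set (L t) \<subseteq> F'" using elim bs block_deriv_mem by (auto simp: L_def)
    moreover have "y t \<in> V" using fU elim by (auto simp: y_def)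
    ultimately show ?case
      using iter_deriv_linear[OF g F'(1) V, where a = "inverse t" and b = "- inverse t"
          and us = ws and ws = "L t"]
        block_deriv_mem[OF b elim] block_deriv_mem[OF b x] ws
      by (simp add: scaleR_diff_right)
  qed
  ultimately have lim2: "((\<lambda>t. (iter_deriv g (ws @ iter_deriv f b (x + t *\<^sub>R v) # L t) (y t)
      - iter_deriv g (ws @ iter_deriv f b x # L t) (y t)) /\<^sub>R t) \<longlongrightarrow>
      iter_deriv g (ws @ iter_deriv f (v # b) x # map (\<lambda>b. iter_deriv f b x) bs) (f x)) (at 0)"
    by (rule Lim_transform_eventually)
  show ?case
    using tendsto_add[OF lim2 lim1]
    by (simp add: ws_def L_def y_def flip: scaleR_add_right)
qed

definition faa :: "'e list \<Rightarrow> 'e \<Rightarrow> 'h" where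
  "faa vs x = (\<Sum>\<beta>\<leftarrow>blocks vs. iter_deriv g (map (\<lambda>b. iter_deriv f b x) \<beta>) (f x))"

lemma faa_deriv:
  assumes x: "x \<in> U" and v: "v \<in> F" and vs: "set vs \<subseteq> F"
  shows "((\<lambda>t::real. (faa vs (x + t *\<^sub>R v) - faa vs x) /\<^sub>R t) \<longlongrightarrow> faa (v # vs) x) (at 0)"
proof -
  define T where "T = (\<lambda>\<beta> x. iter_deriv g (map (\<lambda>b. iter_deriv f b x) \<beta>) (f x))"
  have "((\<lambda>t. (T \<beta> (x + t *\<^sub>R v) - T \<beta> x) /\<^sub>R t) \<longlongrightarrow> (\<Sum>\<gamma>\<leftarrow>extend_blocks v [] \<beta>. T \<gamma> x)) (at (0::real))"
    if "\<beta> \<in> set (blocks vs)" for \<beta>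
    using chain_rule_block[OF x v, of "[]" \<beta>] blocks_subset[OF that] vs
    unfolding T_def by auto
  then have "((\<lambda>t. \<Sum>\<beta>\<leftarrow>blocks vs. (T \<beta> (x + t *\<^sub>R v) - T \<beta> x) /\<^sub>R t) \<longlongrightarrow>
      (\<Sum>\<beta>\<leftarrow>blocks vs. \<Sum>\<gamma>\<leftarrow>extend_blocks v [] \<beta>. T \<gamma> x)) (at (0::real))"
    by (rule tendsto_sum_list)
  moreover have "(\<Sum>\<beta>\<leftarrow>bl. \<Sum>\<gamma>\<leftarrow>extend_blocks v [] \<beta>. T \<gamma> x)
      = (\<Sum>\<gamma>\<leftarrow>concat (map (extend_blocks v []) bl). T \<gamma> x)" for bl
    by (induction bl) auto
  moreover have "(\<Sum>\<beta>\<leftarrow>bl. (T \<beta> (x + t *\<^sub>R v) - T \<beta> x) /\<^sub>R t) = ((\<Sum>\<beta>\<leftarrow>bl. T \<beta> (x + t *\<^sub>R v))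
      - (\<Sum>\<beta>\<leftarrow>bl. T \<beta> x)) /\<^sub>R t" for bl t
    by (induction bl) (auto simp: algebra_simps)
  ultimately show ?thesis by (simp add: faa_def T_def)
qed

lemma iter_deriv_compose: "set vs \<subseteq> F \<Longrightarrow> x \<in> U \<Longrightarrow> iter_deriv (g \<circ> f) vs x = faa vs x"
proof (induction vs arbitrary: x)
  case Nil
  then show ?case by (simp add: faa_def)
next
  case (Cons v vs)
  have "dir_deriv (iter_deriv (g \<circ> f) vs) x v = dir_deriv (faa vs) x v"
    using Cons.prems by (intro dir_deriv_cong[OF U F] Cons.IH) auto
  also have "\<dots> = faa (v # vs) x" using dir_derivI[OF faa_deriv] Cons.prems by auto
  finally show ?case unfolding iter_deriv.simps .
qed

lemma bastiani_smooth_compose: "bastiani_smooth F U (g \<circ> f)"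
  unfolding bastiani_smooth_def
proof (intro conjI allI impI)
  fix vs v x assume A: "set vs \<subseteq> F \<and> v \<in> F \<and> x \<in> U"
  have "\<forall>\<^sub>F t in at (0::real). x + t *\<^sub>R v \<in> U" by (rule line_in[OF U F]) (use A in auto)
  then have *: "\<forall>\<^sub>F t in at (0::real). (iter_deriv (g \<circ> f) vs (x + t *\<^sub>R v)
      - iter_deriv (g \<circ> f) vs x) /\<^sub>R t
      = (faa vs (x + t *\<^sub>R v) - faa vs x) /\<^sub>R t"
    by eventually_elim (use iter_deriv_compose A in auto)
  show "\<exists>l. ((\<lambda>t::real. (iter_deriv (g \<circ> f) vs (x + t *\<^sub>R v)
      - iter_deriv (g \<circ> f) vs x) /\<^sub>R t) \<longlongrightarrow> l) (at 0)"
    using faa_deriv[of x v vs] A tendsto_cong[OF *] by blast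
next
  fix k
  let ?A = "U \<times> {w :: nat \<Rightarrow> 'e. range w \<subseteq> F}"
  have sub: "b \<in> set \<beta> \<Longrightarrow> \<beta> \<in> set (blocks [0..<k]) \<Longrightarrow> set (map w b) \<subseteq> F" if "range w \<subseteq> F" for b \<beta> w
    using that by auto
  have "((\<lambda>q. faa (map (snd q) [0..<k]) (fst q)) \<longlongrightarrow> faa (map w [0..<k]) x) (at (x, w) within ?A)"
    if x: "x \<in> U" and w: "range w \<subseteq> F" for x w
  proof -
    let ?Fil = "at (x, w) within ?A"
    have id: "((\<lambda>q. q) \<longlongrightarrow> (x, w)) ?Fil" by (rule tendsto_ident_at)
    have lx: "(fst \<longlongrightarrow> x) ?Fil" using tendsto_fst[OF id] by simp
    have lw: "((\<lambda>q. snd q j) \<longlongrightarrow> w j) ?Fil" for j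
      using tendsto_snd[OF id] unfolding tendsto_fun_iff by simp
    have ev: "\<forall>\<^sub>F q in ?Fil. q \<in> ?A" by (simp add: eventually_at_filter)
    have evU: "\<forall>\<^sub>F q in ?Fil. fst q \<in> U" using ev by eventually_elim auto
    have D: "((\<lambda>q. iter_deriv f (map (snd q) b) (fst q)) \<longlongrightarrow> iter_deriv f (map w b) x) ?Fil" for b
    proof -
      have "((\<lambda>q. iter_deriv f (map (\<lambda>p. fst p q) (map (\<lambda>j. (\<lambda>q. snd q j, w j)) b)) (fst q)) \<longlongrightarrow>
          iter_deriv f (map snd (map (\<lambda>j. (\<lambda>q :: 'e \<times> (nat \<Rightarrow> 'e). snd q j, w j)) b)) x) ?Fil"
      proof (rule bastiani_smooth_tendsto[OF f x lx evU F])
        fix v a assume "(v, a) \<in> set (map (\<lambda>j. (\<lambda>q :: 'e \<times> (nat \<Rightarrow> 'e). snd q j, w j)) b)"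
        then obtain j where j: "v = (\<lambda>q. snd q j)" "a = w j" by auto
        have "\<forall>\<^sub>F q in ?Fil. v q \<in> F" using ev by eventually_elim (auto simp: j)
        then show "(v \<longlongrightarrow> a) ?Fil \<and> a \<in> F \<and> (\<forall>\<^sub>F i in ?Fil. v i \<in> F)"
          using lw w j by auto
      qed
      then show ?thesis by (simp add: comp_def)
    qed
    have "((\<lambda>q. iter_deriv g (map (\<lambda>b. iter_deriv f b (fst q)) (map (map (snd q)) \<beta>)) (f (fst q))) \<longlongrightarrow>
        iter_deriv g (map (\<lambda>b. iter_deriv f b x) (map (map w) \<beta>)) (f x)) ?Fil" for \<beta>
    proof -
      define vl where "vl = map (\<lambda>b. (\<lambda>q :: 'e \<times> (nat \<Rightarrow> 'e). iter_deriv f (map (snd q) b) (fst q),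
          iter_deriv f (map w b) x)) \<beta>"
      have "((\<lambda>q. iter_deriv g (map (\<lambda>p. fst p q) vl) (f (fst q)))
          \<longlongrightarrow> iter_deriv g (map snd vl) (f x)) ?Fil"
      proof (rule bastiani_smooth_tendsto[OF g _ _ _ F'(1)])
        show "f x \<in> V" using fU x by auto
        show "((\<lambda>q. f (fst q)) \<longlongrightarrow> f x) ?Fil" using D[of "[]"] by simp
        show "\<forall>\<^sub>F q in ?Fil. f (fst q) \<in> V" using evU by eventually_elim (use fU in auto)
        fix v a assume "(v, a) \<in> set vl"
        then obtain b where b: "v = (\<lambda>q. iter_deriv f (map (snd q) b) (fst q))" "a
            = iter_deriv f (map w b) x"
          by (auto simp: vl_def)
        have "\<forall>\<^sub>F q in ?Fil. v q \<in> F'"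
          using ev by eventually_elim (auto simp: b image_subset_iff intro!: block_deriv_mem)
        moreover have "a \<in> F'" unfolding b using x w
          by (auto simp: image_subset_iff intro!: block_deriv_mem)
        ultimately show "(v \<longlongrightarrow> a) ?Fil \<and> a \<in> F' \<and> (\<forall>\<^sub>F i in ?Fil. v i \<in> F')"
          using D b by simp
      qed
      then show ?thesis by (simp add: vl_def comp_def)
    qed
    then show ?thesis
      unfolding faa_def blocks_map map_map comp_def by (intro tendsto_sum_list) (simp add: comp_def)
  qed
  then have "continuous_on ?A (\<lambda>(x, w). faa (map w [0..<k]) x)"
    by (auto simp: continuous_on_def case_prod_unfold)
  then show "continuous_on ?A (\<lambda>(x, w). iter_deriv (g \<circ> f) (map w [0..<k]) x)"
    by (rule continuous_on_eq) (auto simp: image_subset_iff intro!: iter_deriv_compose[symmetric])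
qed

lemma dir_deriv_compose:
  assumes "x \<in> U" "v \<in> F"
  shows "dir_deriv (g \<circ> f) x v = dir_deriv g (f x) (dir_deriv f x v)"
  using iter_deriv_compose[of "[v]" x] assms by (simp add: faa_def)

end


section \<open>Constants, linear maps and pairs\<close>

lemma bastiani_smooth_const: "bastiani_smooth F U (\<lambda>_ :: 'e::lctvs. c :: 'f::lctvs)"
proof -
  have eq: "iter_deriv (\<lambda>_ :: 'e. c) vs = (\<lambda>_. if vs = [] then c else 0)" for vs
    by (induction vs) (auto intro!: dir_derivI)
  show ?thesis unfolding bastiani_smooth_def eq by (auto intro!: exI[of _ 0])
qed

lemma dir_deriv_linear:
  assumes "linear L"
  shows "dir_deriv L x v = (L v :: 'f::lctvs)"
    and "((\<lambda>t::real. (L (x + t *\<^sub>R v) - L x) /\<^sub>R t) \<longlongrightarrow> L v) (at 0)"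
proof -
  have "\<forall>\<^sub>F t in at (0::real). L v = (L (x + t *\<^sub>R v) - L x) /\<^sub>R t"
    using assms by (auto simp: eventually_at_filter linear_add linear_scale)
  then show "((\<lambda>t::real. (L (x + t *\<^sub>R v) - L x) /\<^sub>R t) \<longlongrightarrow> L v) (at 0)"
    by (rule Lim_transform_eventually[OF tendsto_const])
  then show "dir_deriv L x v = L v" by (rule dir_derivI)
qed

lemma bastiani_smooth_linear:
  assumes L: "linear L" and cont: "continuous_on UNIV L"
  shows "bastiani_smooth F U (L :: 'e::lctvs \<Rightarrow> 'f::lctvs)"
proof -
  have eq: "iter_deriv L vs = (\<lambda>x. if vs = [] then L x else
      if tl vs = [] then L (hd vs) else 0)" for vs
  proof (induction vs)
    case (Cons v vs)
    show ?case
      unfolding iter_deriv.simps Cons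
      by (auto simp: fun_eq_iff dir_deriv_linear(1)[OF L] intro!: dir_derivI)
  qed simp
  have "\<exists>l. ((\<lambda>t::real. (iter_deriv L vs (x + t *\<^sub>R v) - iter_deriv L vs x) /\<^sub>R t)
      \<longlongrightarrow> l) (at 0)" for vs x v
    using dir_deriv_linear(2)[OF L, of x v] unfolding eq by (cases "vs = []") auto
  moreover have "continuous_on X (\<lambda>(x, w :: nat \<Rightarrow> 'e). iter_deriv L (map w [0..<k]) x)" for X k
  proof -
    consider "k = 0" | "k = 1" | "k \<ge> 2" by linarith
    then show ?thesis
    proof cases
      case 1
      have "continuous_on X (\<lambda>q. L (fst q))"
        by (rule continuous_on_compose2[OF cont]) (auto intro: continuous_intros)
      with 1 show ?thesis by (simp add: case_prod_unfold)
    next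
      case 2
      have "continuous_on X (\<lambda>q. snd q 0)"
        by (rule continuous_on_compose2[OF continuous_on_product_coordinates])
           (auto intro: continuous_on_snd continuous_on_id)
      then have "continuous_on X (\<lambda>q. L (snd q 0))"
        by (rule continuous_on_compose2[OF cont]) auto
      with 2 show ?thesis by (simp add: case_prod_unfold dir_deriv_linear(1)[OF L])
    next
      case 3
      then have "map w [0..<k] \<noteq> [] \<and> tl (map w [0..<k]) \<noteq> []" for w :: "nat \<Rightarrow> 'e"
        by (auto simp: upt_conv_Cons)
      with 3 show ?thesis unfolding eq by (simp add: case_prod_unfold)
    qed
  qed
  ultimately show ?thesis unfolding bastiani_smooth_def by blast
qed

lemma bastiani_smooth_Pair:
  fixes f :: "'e::lctvs \<Rightarrow> 'f::lctvs" and g :: "'e \<Rightarrow> 'h::lctvs"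
  assumes f: "bastiani_smooth F U f" and g: "bastiani_smooth F U g"
    and F: "subspace F" and U: "openin (top_of_set F) U"
  shows "bastiani_smooth F U (\<lambda>x. (f x, g x))"
    and iter_deriv_Pair: "set vs \<subseteq> F \<Longrightarrow> x \<in> U \<Longrightarrow>
      iter_deriv (\<lambda>x. (f x, g x)) vs x = (iter_deriv f vs x, iter_deriv g vs x)"
proof -
  let ?P = "\<lambda>vs x. (iter_deriv f vs x, iter_deriv g vs x)"
  have lim: "((\<lambda>t::real. (?P vs (x + t *\<^sub>R v) - ?P vs x) /\<^sub>R t) \<longlongrightarrow> ?P (v # vs) x) (at 0)"
    if "set vs \<subseteq> F" "v \<in> F" "x \<in> U" for vs v x
    using tendsto_Pair[OF bastiani_smooth_deriv[OF f that] bastiani_smooth_deriv[OF g that]] by simp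
  have eq: "iter_deriv (\<lambda>x. (f x, g x)) vs x = ?P vs x" if "set vs \<subseteq> F" "x \<in> U" for vs x
    using that
  proof (induction vs arbitrary: x)
    case (Cons v vs)
    have "dir_deriv (iter_deriv (\<lambda>x. (f x, g x)) vs) x v = dir_deriv (?P vs) x v"
      using Cons.prems by (intro dir_deriv_cong[OF U F] Cons.IH) auto
    then show ?case using dir_derivI[OF lim] Cons.prems by auto
  qed simp
  then show "set vs \<subseteq> F \<Longrightarrow> x \<in> U \<Longrightarrow> iter_deriv (\<lambda>x. (f x, g x)) vs x = ?P vs x" .
  show "bastiani_smooth F U (\<lambda>x. (f x, g x))"
    unfolding bastiani_smooth_def
  proof (intro conjI allI impI)
    fix vs v x assume A: "set vs \<subseteq> F \<and> v \<in> F \<and> x \<in> U"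
    have "\<forall>\<^sub>F t in at (0::real). x + t *\<^sub>R v \<in> U" by (rule line_in[OF U F]) (use A in auto)
    then have *: "\<forall>\<^sub>F t in at (0::real). (iter_deriv (\<lambda>x. (f x, g x)) vs (x + t *\<^sub>R v)
        - iter_deriv (\<lambda>x. (f x, g x)) vs x) /\<^sub>R t
        = (?P vs (x + t *\<^sub>R v) - ?P vs x) /\<^sub>R t"
      by eventually_elim (use eq A in auto)
    show "\<exists>l. ((\<lambda>t::real. (iter_deriv (\<lambda>x. (f x, g x)) vs (x + t *\<^sub>R v)
        - iter_deriv (\<lambda>x. (f x, g x)) vs x) /\<^sub>R t) \<longlongrightarrow> l) (at 0)"
      using lim[of vs v x] A tendsto_cong[OF *] by blast
  next
    fix k
    let ?A = "U \<times> {w :: nat \<Rightarrow> 'e. range w \<subseteq> F}"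
    have "continuous_on ?A (\<lambda>(x, w). iter_deriv f (map w [0..<k]) x)"
      "continuous_on ?A (\<lambda>(x, w). iter_deriv g (map w [0..<k]) x)"
      using f g by (auto simp: bastiani_smooth_def)
    then have "continuous_on ?A (\<lambda>(x, w). ?P (map w [0..<k]) x)"
      unfolding case_prod_unfold by (rule continuous_on_Pair)
    then show "continuous_on ?A (\<lambda>(x, w). iter_deriv (\<lambda>x. (f x, g x)) (map w [0..<k]) x)"
      by (rule continuous_on_eq) (auto simp: image_subset_iff intro!: eq[symmetric])
  qed
qed


section \<open>Smooth maps in charts\<close>

lemma openin_preimage:
  assumes "openin (top_of_set F) A" "continuous_on A h" "h ` A \<subseteq> G" "openin (top_of_set G) B"
  shows "openin (top_of_set F) (A \<inter> h -` B)"
proof -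
  have "openin (top_of_set A) (A \<inter> h -` B)"
    by (rule continuous_openin_preimage[OF assms(2) _ assms(4)]) (use assms(3) in auto)
  then show ?thesis using assms(1) by (rule openin_trans)
qed

lemma cinv_cmap: "is_chart c \<Longrightarrow> x \<in> cdom c \<Longrightarrow> cinv c (cmap c x) = x"
  by (simp add: cinv_def is_chart_def)

lemma cmap_image_Int:
  "is_chart c \<Longrightarrow> A \<subseteq> cdom c \<Longrightarrow> B \<subseteq> cdom c \<Longrightarrow> cmap c ` (A \<inter> B) = cmap c ` A \<inter> cmap c ` B"
  by (rule inj_on_image_Int[where C = "cdom c"]) (auto simp: is_chart_def)

lemma cmap_image_vimage:
  assumes "is_chart a" "A \<subseteq> cdom a" "f ` A \<subseteq> cdom b" "B \<subseteq> cdom b" "is_chart b"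
  shows "cmap a ` (A \<inter> f -` B) = cmap a ` A \<inter> (cmap b \<circ> f \<circ> cinv a) -` (cmap b ` B)"
proof -
  have "inj_on (cmap b) (cdom b)" using assms by (simp add: is_chart_def)
  then have *: "(cmap b \<circ> f \<circ> cinv a) (cmap a x) \<in> cmap b ` B \<longleftrightarrow> f x \<in> B" if "x \<in> A" for x
  proof -
    have x: "x \<in> cdom a" "f x \<in> cdom b" using that assms by auto
    then have "cinv a (cmap a x) = x" using cinv_cmap assms by metis
    then show ?thesis
      using inj_on_image_mem_iff[OF \<open>inj_on (cmap b) (cdom b)\<close> x(2) assms(4)] by simp
  qed
  show ?thesis
  proof (intro equalityI subsetI)
    fix y assume "y \<in> cmap a ` (A \<inter> f -` B)"
    then obtain x where "x \<in> A" "f x \<in> B" "y = cmap a x" by auto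
    then show "y \<in> cmap a ` A \<inter> (cmap b \<circ> f \<circ> cinv a) -` (cmap b ` B)"
      using *[of x] by blast
  next
    fix y assume "y \<in> cmap a ` A \<inter> (cmap b \<circ> f \<circ> cinv a) -` (cmap b ` B)"
    then obtain x where "x \<in> A" "y = cmap a x" "(cmap b \<circ> f \<circ> cinv a) (cmap a x) \<in> cmap b ` B"
      by blast
    then show "y \<in> cmap a ` (A \<inter> f -` B)" using *[of x] by blast
  qed
qed

section \<open>Smoothness and derivatives in a pair of charts\<close>

text \<open>Openness of \<open>A\<close> in coordinates and the inclusion of the image in the target
  chart are built in, so that composing two such maps leaves a single side condition on the
  image.\<close>

definition chart_smooth ::
    "('a, 'e::lctvs) chart \<Rightarrow> ('b, 'f::lctvs) chart \<Rightarrow> ('a \<Rightarrow> 'b) \<Rightarrow> 'a set \<Rightarrow> bool" where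
  "chart_smooth a b f A \<longleftrightarrow> A \<subseteq> cdom a \<and> openin (top_of_set (cmodel a)) (cmap a ` A) \<and>
     f ` A \<subseteq> cdom b \<and> bastiani_smooth (cmodel a) (cmap a ` A) (cmap b \<circ> f \<circ> cinv a)"

text \<open>Charts are free here; \<open>tangent_map\<close> and \<open>from_chart\<close> are the
  instances for the charts chosen by \<open>chart_at\<close>.\<close>

definition chart_deriv ::
    "('a, 'e::lctvs) chart \<Rightarrow> ('b, 'f::lctvs) chart \<Rightarrow> ('a \<Rightarrow> 'b) \<Rightarrow> 'a \<Rightarrow> 'e \<Rightarrow> 'f" where
  "chart_deriv a b f x = dir_deriv (cmap b \<circ> f \<circ> cinv a) (cmap a x)"

lemma tangent_map_chart_deriv:
  "tangent_map M N f x = chart_deriv (chart_at M x) (chart_at N (f x)) f x"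
  by (simp add: tangent_map_def chart_deriv_def fun_eq_iff)

lemma from_chart_chart_deriv: "from_chart M c x = chart_deriv c (chart_at M x) (\<lambda>x. x) x"
  by (simp add: from_chart_def chart_deriv_def fun_eq_iff comp_def)

lemma is_chart_subspace:
  "is_chart c \<Longrightarrow> subspace (cmodel c)" "is_chart c \<Longrightarrow> closed (cmodel c)"
  "is_chart c \<Longrightarrow> cmap c ` cdom c \<subseteq> cmodel c"
  by (auto simp: is_chart_def openin_open)

lemma chart_smooth_vimage:
  assumes "is_chart a" "is_chart b" "chart_smooth a b f A"
    "B \<subseteq> cdom b" "openin (top_of_set (cmodel b)) (cmap b ` B)"
  shows "openin (top_of_set (cmodel a)) (cmap a ` (A \<inter> f -` B))"
proof -
  let ?h = "cmap b \<circ> f \<circ> cinv a"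
  have "?h ` (cmap a ` A) \<subseteq> cmodel b"
  proof (clarsimp)
    fix x assume "x \<in> A"
    then have "x \<in> cdom a" "f x \<in> cdom b" using assms by (auto simp: chart_smooth_def)
    then show "cmap b (f (cinv a (cmap a x))) \<in> cmodel b"
      using assms is_chart_subspace(3)[of b] by (auto simp: cinv_cmap)
  qed
  moreover have "continuous_on (cmap a ` A) ?h"
    by (rule bastiani_smooth_continuous[OF _ is_chart_subspace(1)[OF assms(1)]])
       (use assms(3) in \<open>simp add: chart_smooth_def\<close>)
  ultimately have "openin (top_of_set (cmodel a)) (cmap a ` A \<inter> ?h -` (cmap b ` B))"
    using assms by (intro openin_preimage) (auto simp: chart_smooth_def)
  then show ?thesis
    using assms by (subst cmap_image_vimage[where b = b]) (auto simp: chart_smooth_def)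
qed

lemma chart_smooth_subset:
  "chart_smooth a b f A \<Longrightarrow> A' \<subseteq> A \<Longrightarrow> openin (top_of_set (cmodel a)) (cmap a ` A')
      \<Longrightarrow> chart_smooth a b f A'"
  unfolding chart_smooth_def by (auto intro: bastiani_smooth_subset)

lemma chart_smooth_cong:
  assumes "is_chart a" "chart_smooth a b f A" "\<And>x. x \<in> A \<Longrightarrow> f x = g x"
  shows "chart_smooth a b g A"
proof -
  have "bastiani_smooth (cmodel a) (cmap a ` A) (cmap b \<circ> g \<circ> cinv a)"
    by (rule bastiani_smooth_cong[where f = "cmap b \<circ> f \<circ> cinv a"])
       (use assms in \<open>auto simp: chart_smooth_def is_chart_subspace cinv_cmap subset_iff\<close>)
  then show ?thesis using assms by (auto simp: chart_smooth_def)
qed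

lemma chart_deriv_cong:
  assumes "is_chart a" "A \<subseteq> cdom a" "openin (top_of_set (cmodel a)) (cmap a ` A)"
      "\<And>x. x \<in> A \<Longrightarrow> f x = g x"
    "x \<in> A" "v \<in> cmodel a"
  shows "chart_deriv a b f x v = chart_deriv a b g x v"
  unfolding chart_deriv_def
  by (rule dir_deriv_cong[OF assms(3)])
     (use assms in \<open>auto simp: is_chart_subspace cinv_cmap subset_iff\<close>)

lemma chart_smooth_compose:
  assumes a: "is_chart a" and b: "is_chart b"
    and f: "chart_smooth a b f A" and g: "chart_smooth b e g B" and fA: "f ` A \<subseteq> B"
  shows "chart_smooth a e (\<lambda>x. g (f x)) A"
    and chart_deriv_compose: "x \<in> A \<Longrightarrow> v \<in> cmodel a \<Longrightarrow>
      chart_deriv a e (\<lambda>x. g (f x)) x v = chart_deriv b e g (f x) (chart_deriv a b f x v)"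
proof -
  let ?f = "cmap b \<circ> f \<circ> cinv a" and ?g = "cmap e \<circ> g \<circ> cinv b"
  let ?gf = "cmap e \<circ> (\<lambda>x. g (f x)) \<circ> cinv a"
  have A: "A \<subseteq> cdom a" "openin (top_of_set (cmodel a)) (cmap a ` A)" "bastiani_smooth
      (cmodel a) (cmap a ` A) ?f"
    and B: "B \<subseteq> cdom b" "openin (top_of_set (cmodel b)) (cmap b ` B)" "bastiani_smooth
        (cmodel b) (cmap b ` B) ?g"
    "g ` B \<subseteq> cdom e"
    using f g by (auto simp: chart_smooth_def)
  have f': "?f (cmap a x) = cmap b (f x)" "f x \<in> cdom b" "f x \<in> B" if "x \<in> A" for x
    using that A(1) B(1) fA a by (auto simp: cinv_cmap subset_iff)
  then have im: "?f ` (cmap a ` A) \<subseteq> cmap b ` B" by auto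
  have eq: "(?g \<circ> ?f) y = ?gf y" if "y \<in> cmap a ` A" for y
  proof -
    obtain x where x: "x \<in> A" "y = cmap a x" using \<open>y \<in> cmap a ` A\<close> by auto
    moreover have "cinv a (cmap a x) = x" "cinv b (cmap b (f x)) = f x"
      using x f' A(1) a b by (auto simp: cinv_cmap)
    ultimately show ?thesis by simp
  qed
  note sub = is_chart_subspace[OF a] is_chart_subspace[OF b]
  have "bastiani_smooth (cmodel a) (cmap a ` A) (?g \<circ> ?f)"
    by (rule bastiani_smooth_compose[OF A(3) B(3) sub(1) A(2) sub(4,5) B(2) im])
  then have "bastiani_smooth (cmodel a) (cmap a ` A) ?gf"
    by (rule bastiani_smooth_cong[OF A(2) sub(1) eq, rotated])
  moreover have "(\<lambda>x. g (f x)) ` A \<subseteq> cdom e" using B(4) fA by blast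
  ultimately show "chart_smooth a e (\<lambda>x. g (f x)) A"
    using A(1,2) by (simp add: chart_smooth_def)
  assume x: "x \<in> A" and v: "v \<in> cmodel a"
  have "dir_deriv ?gf (cmap a x) v = dir_deriv (?g \<circ> ?f) (cmap a x) v"
    by (rule dir_deriv_cong[OF A(2) sub(1)]) (use eq x v in auto)
  also have "\<dots> = dir_deriv ?g (?f (cmap a x)) (dir_deriv ?f (cmap a x) v)"
    by (rule dir_deriv_compose[OF A(3) B(3) sub(1) A(2) sub(4,5) B(2) im]) (use x v in auto)
  finally show "chart_deriv a e (\<lambda>x. g (f x)) x v = chart_deriv b e g (f x) (chart_deriv a b f x v)"
    using f'(1)[OF x] by (simp add: chart_deriv_def)
qed

lemma chart_deriv_mem:
  assumes "is_chart a" "is_chart b" "chart_smooth a b f A" "x \<in> A" "v \<in> cmodel a"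
  shows "chart_deriv a b f x v \<in> cmodel b"
proof -
  have "iter_deriv (cmap b \<circ> f \<circ> cinv a) [v] (cmap a x) \<in> cmodel b"
  proof (rule iter_deriv_mem[where F = "cmodel a" and U = "cmap a ` A"])
    show "(cmap b \<circ> f \<circ> cinv a) ` cmap a ` A \<subseteq> cmodel b"
      using assms is_chart_subspace(3)[of b] by (auto simp: chart_smooth_def cinv_cmap subset_iff)
  qed (use assms in \<open>auto simp: chart_smooth_def is_chart_subspace\<close>)
  then show ?thesis by (simp add: chart_deriv_def)
qed

lemma chart_deriv_linear:
  assumes "is_chart a" "chart_smooth a b f A" "x \<in> A" "u \<in> cmodel a" "v \<in> cmodel a"
  shows "chart_deriv a b f x (u + v) = chart_deriv a b f x u + chart_deriv a b f x v"
    and "chart_deriv a b f x (r *\<^sub>R v) = r *\<^sub>R chart_deriv a b f x v"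
proof -
  have "cont_diff (cmodel a) (cmap a ` A) (iter_deriv (cmap b \<circ> f \<circ> cinv a) [])"
    using assms by (intro bastiani_smooth_cont_diff) (auto simp: chart_smooth_def is_chart_subspace)
  then have c: "cont_diff (cmodel a) (cmap a ` A) (cmap b \<circ> f \<circ> cinv a)" by simp
  show "chart_deriv a b f x (u + v) = chart_deriv a b f x u + chart_deriv a b f x v"
    unfolding chart_deriv_def
    by (rule dir_deriv_add[OF c]) (use assms in \<open>auto simp: chart_smooth_def is_chart_subspace\<close>)
  show "chart_deriv a b f x (r *\<^sub>R v) = r *\<^sub>R chart_deriv a b f x v"
    unfolding chart_deriv_def
    by (rule dir_deriv_scale[OF c]) (use assms in \<open>auto simp: chart_smooth_def is_chart_subspace\<close>)
qed

lemma bastiani_smooth_ident: "bastiani_smooth F U (\<lambda>x :: 'e::lctvs. x)"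
  by (rule bastiani_smooth_linear) (auto intro: linear_ident)

lemma chart_smooth_ident:
  assumes c: "is_chart c"
  shows "chart_smooth c c (\<lambda>x. x) (cdom c)" "x \<in> cdom c \<Longrightarrow> v \<in> cmodel c
      \<Longrightarrow> chart_deriv c c (\<lambda>x. x) x v = v"
proof -
  have o: "openin (top_of_set (cmodel c)) (cmap c ` cdom c)" using c by (simp add: is_chart_def)
  have eq: "y = (cmap c \<circ> (\<lambda>x. x) \<circ> cinv c) y" if "y \<in> cmap c ` cdom c" for y
    using that c by (auto simp: cinv_cmap)
  show "chart_smooth c c (\<lambda>x. x) (cdom c)"
    unfolding chart_smooth_def
    by (intro conjI o bastiani_smooth_cong[OF o is_chart_subspace(1)[OF c] eq
        bastiani_smooth_ident]) auto
  assume "x \<in> cdom c" "v \<in> cmodel c"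
  then have "chart_deriv c c (\<lambda>x. x) x v = dir_deriv (\<lambda>y. y) (cmap c x) v"
    unfolding chart_deriv_def
    by (intro dir_deriv_cong[OF o is_chart_subspace(1)[OF c] _ _ eq[symmetric]]) auto
  then show "chart_deriv c c (\<lambda>x. x) x v = v"
    using dir_deriv_linear(1)[OF linear_ident] by (simp add: id_def)
qed

text \<open>A transition map is the identity read in two charts, so all questions about
  compatibility become instances of \<open>chart_smooth_compose\<close>.\<close>

lemma compatible_chart_smooth:
  "compatible c d \<Longrightarrow> chart_smooth c d (\<lambda>x. x) (cdom c \<inter> cdom d)"
  by (auto simp: compatible_def chart_smooth_def comp_def)

lemma chart_smooth_compatible:
  "chart_smooth c d (\<lambda>x. x) (cdom c \<inter> cdom d) \<Longrightarrow> compatible c d"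
  by (auto simp: compatible_def chart_smooth_def comp_def)

lemma chart_open_transfer:
  assumes "is_chart c" "is_chart d" "compatible d c" "W \<subseteq> cdom c" "W \<subseteq> cdom d"
    and "openin (top_of_set (cmodel c)) (cmap c ` W)"
  shows "openin (top_of_set (cmodel d)) (cmap d ` W)"
proof -
  have "openin (top_of_set (cmodel d)) (cmap d ` ((cdom d \<inter> cdom c) \<inter> (\<lambda>x. x) -` W))"
    by (rule chart_smooth_vimage[OF assms(2,1) compatible_chart_smooth[OF assms(3)] assms(4,6)])
  moreover have "(cdom d \<inter> cdom c) \<inter> (\<lambda>x. x) -` W = W" using assms by auto
  ultimately show ?thesis by simp
qed

lemma chart_smooth_local:
  assumes a: "is_chart a"
    and loc: "\<And>x. x \<in> A \<Longrightarrow> \<exists>W. x \<in> W \<and> W \<subseteq> A \<and> chart_smooth a b f W"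
  shows "chart_smooth a b f A"
proof -
  obtain W where W: "x \<in> W x \<and> W x \<subseteq> A \<and> chart_smooth a b f (W x)" if "x \<in> A" for x
    using loc by metis
  have "bastiani_smooth (cmodel a) (cmap a ` A) (cmap b \<circ> f \<circ> cinv a)"
  proof (rule bastiani_smooth_local)
    fix y assume "y \<in> cmap a ` A"
    then obtain x where "x \<in> A" "y = cmap a x" by auto
    then show "\<exists>V. openin (top_of_set (cmodel a)) V \<and> y \<in> V \<and> V \<subseteq> cmap a ` A \<and>
        bastiani_smooth (cmodel a) V (cmap b \<circ> f \<circ> cinv a)"
      using W[of x] by (intro exI[of _ "cmap a ` W x"] conjI image_mono) (auto
          simp: chart_smooth_def)
  qed (use a in \<open>simp add: is_chart_subspace\<close>)
  moreover have "openin (top_of_set (cmodel a)) (\<Union>x\<in>A. cmap a ` W x)"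
    using W by (intro openin_Union) (auto simp: chart_smooth_def)
  moreover have "(\<Union>x\<in>A. cmap a ` W x) = cmap a ` A" using W by blast
  moreover have "A \<subseteq> cdom a" "f ` A \<subseteq> cdom b" using W by (auto simp: chart_smooth_def)
  ultimately show ?thesis by (simp add: chart_smooth_def)
qed

section \<open>Atlases and their topology\<close>

text \<open>The Hausdorff condition plays no role in the calculus; it is needed for the orbit only.\<close>
definition atlas_mfd :: "('a, 'e::lctvs) mfd \<Rightarrow> bool" where
  "atlas_mfd M \<longleftrightarrow> points M = (\<Union>c \<in> charts M. cdom c) \<and> (\<forall>c \<in> charts M. is_chart c) \<and>
     (\<forall>c \<in> charts M. \<forall>d \<in> charts M. compatible c d)"

lemma manifold_atlas: "manifold M \<Longrightarrow> atlas_mfd M"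
  by (simp add: manifold_def atlas_mfd_def)

lemma charts_max_charts: "atlas_mfd M \<Longrightarrow> c \<in> charts M \<Longrightarrow> c \<in> max_charts M"
  by (auto simp: max_charts_def atlas_mfd_def)

lemma openin_mtop_atlas:
  assumes "atlas_mfd M"
  shows "openin (mtop M) W \<longleftrightarrow> W \<subseteq> points M \<and>
     (\<forall>c \<in> charts M. openin (top_of_set (cmodel c)) (cmap c ` (W \<inter> cdom c)))"
proof -
  let ?P = "\<lambda>W. W \<subseteq> points M \<and>
     (\<forall>c \<in> charts M. openin (top_of_set (cmodel c)) (cmap c ` (W \<inter> cdom c)))"
  have "?P (V \<inter> W)" if V: "?P V" and W: "?P W" for V W
  proof (intro conjI ballI)
    fix c assume c: "c \<in> charts M"
    then have "is_chart c" using assms by (auto simp: atlas_mfd_def)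
    then have "cmap c ` ((V \<inter> cdom c) \<inter> (W \<inter> cdom c))
        = cmap c ` (V \<inter> cdom c) \<inter> cmap c ` (W \<inter> cdom c)"
      by (intro cmap_image_Int) auto
    moreover have "(V \<inter> cdom c) \<inter> (W \<inter> cdom c) = V \<inter> W \<inter> cdom c" by blast
    ultimately show "openin (top_of_set (cmodel c)) (cmap c ` (V \<inter> W \<inter> cdom c))"
      using V W c by (simp add: openin_Int)
  qed (use V in auto)
  moreover have "?P (\<Union>\<W>)" if "\<forall>W \<in> \<W>. ?P W" for \<W>
  proof (intro conjI ballI)
    fix c assume c: "c \<in> charts M"
    have "cmap c ` (\<Union>\<W> \<inter> cdom c) = (\<Union>W \<in> \<W>. cmap c ` (W \<inter> cdom c))" by blast
    then show "openin (top_of_set (cmodel c)) (cmap c ` (\<Union>\<W> \<inter> cdom c))"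
      using that c by auto
  qed (use that in auto)
  ultimately have "istopology ?P" unfolding istopology_def by blast
  then show ?thesis unfolding mtop_def by (simp add: topology_inverse')
qed

lemma max_chartsD:
  assumes "c \<in> max_charts M"
  shows "is_chart c" "cdom c \<subseteq> points M" "d \<in> charts M
      \<Longrightarrow> compatible c d" "d \<in> charts M \<Longrightarrow> compatible d c"
  using assms by (auto simp: max_charts_def)

text \<open>Transition maps are homeomorphisms between open sets, so a subset of one chart domain
  can be tested in this chart alone. The lemma covers the maximal atlas because the adapted charts
  of a submanifold are cut out of charts in it.\<close>

lemma openin_mtop_chart:
  assumes M: "atlas_mfd M" and c: "c \<in> max_charts M" and W: "W \<subseteq> cdom c"
  shows "openin (mtop M) W \<longleftrightarrow> openin (top_of_set (cmodel c)) (cmap c ` W)"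
proof
  note cD = max_chartsD[OF c]
  assume o: "openin (mtop M) W"
  have "openin (top_of_set (cmodel c)) (cmap c ` (W \<inter> cdom d))" if d: "d \<in> charts M" for d
  proof (rule chart_open_transfer[OF _ cD(1) cD(3)[OF d]])
    show cd: "is_chart d" using M d by (simp add: atlas_mfd_def)
    have "cmap d ` ((W \<inter> cdom d) \<inter> (cdom d \<inter> cdom c))
        = cmap d ` (W \<inter> cdom d) \<inter> cmap d ` (cdom d \<inter> cdom c)"
      using cd by (intro cmap_image_Int) auto
    moreover have "(W \<inter> cdom d) \<inter> (cdom d \<inter> cdom c) = W \<inter> cdom d" using W by auto
    moreover have "openin (top_of_set (cmodel d)) (cmap d ` (cdom d \<inter> cdom c))"
      using cD(4)[OF d] by (simp add: compatible_def)
    moreover have "openin (top_of_set (cmodel d)) (cmap d ` (W \<inter> cdom d))"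
      using o d by (simp add: openin_mtop_atlas[OF M])
    ultimately show "openin (top_of_set (cmodel d)) (cmap d ` (W \<inter> cdom d))" by simp
  qed (use W in auto)
  then have "openin (top_of_set (cmodel c)) (\<Union>d\<in>charts M. cmap c ` (W \<inter> cdom d))" by auto
  moreover have "W \<subseteq> (\<Union>d\<in>charts M. cdom d)" using W cD(2) M by (auto simp: atlas_mfd_def)
  then have "(\<Union>d\<in>charts M. cmap c ` (W \<inter> cdom d)) = cmap c ` W" by blast
  ultimately show "openin (top_of_set (cmodel c)) (cmap c ` W)" by simp
next
  note cD = max_chartsD[OF c]
  assume o: "openin (top_of_set (cmodel c)) (cmap c ` W)"
  have "openin (top_of_set (cmodel d)) (cmap d ` (W \<inter> cdom d))" if d: "d \<in> charts M" for d
  proof (rule chart_open_transfer[OF cD(1) _ cD(4)[OF d]])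
    show cd: "is_chart d" using M d by (simp add: atlas_mfd_def)
    have "cmap c ` (W \<inter> (cdom c \<inter> cdom d)) = cmap c ` W \<inter> cmap c ` (cdom c \<inter> cdom d)"
      using cD(1) W by (intro cmap_image_Int) auto
    moreover have "W \<inter> (cdom c \<inter> cdom d) = W \<inter> cdom d" using W by auto
    moreover have "openin (top_of_set (cmodel c)) (cmap c ` (cdom c \<inter> cdom d))"
      using cD(3)[OF d] by (simp add: compatible_def)
    ultimately show "openin (top_of_set (cmodel c)) (cmap c ` (W \<inter> cdom d))" using o by auto
  qed (use W in auto)
  then show "openin (mtop M) W"
    using W cD(2) by (auto simp: openin_mtop_atlas[OF M])
qed

lemma topspace_mtop: "atlas_mfd M \<Longrightarrow> topspace (mtop M) = points M"
proof -
  assume M: "atlas_mfd M"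
  have "openin (mtop M) (points M)"
    unfolding openin_mtop_atlas[OF M]
  proof (intro conjI ballI)
    fix c assume "c \<in> charts M"
    then have "is_chart c" "points M \<inter> cdom c = cdom c" using M by (auto simp: atlas_mfd_def)
    then show "openin (top_of_set (cmodel c)) (cmap c ` (points M \<inter> cdom c))"
      by (simp add: is_chart_def)
  qed simp
  then show ?thesis
    using openin_mtop_atlas[OF M, of "topspace (mtop M)"] openin_subset by blast
qed

lemma openin_cdom: "atlas_mfd M \<Longrightarrow> c \<in> max_charts M \<Longrightarrow> openin (mtop M) (cdom c)"
  by (simp add: openin_mtop_chart max_charts_def is_chart_def)

lemma chart_at:
  assumes "atlas_mfd M" "x \<in> points M"
  shows "chart_at M x \<in> charts M" "x \<in> cdom (chart_at M x)" "is_chart (chart_at M x)"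
    "chart_at M x \<in> max_charts M"
proof -
  have "\<exists>c. c \<in> charts M \<and> x \<in> cdom c" using assms by (auto simp: atlas_mfd_def)
  from someI_ex[OF this] show "chart_at M x \<in> charts M" "x \<in> cdom (chart_at M x)"
    by (auto simp: chart_at_def)
  with assms show "is_chart (chart_at M x)" "chart_at M x \<in> max_charts M"
    by (auto simp: atlas_mfd_def charts_max_charts)
qed

section \<open>Smoothness at a point and tangent maps\<close>

text \<open>\<open>smooth_map\<close> demands continuity and all pairs of charts; this pointwise
  form asks for one pair and one neighbourhood, which is what constructions provide. The two agree
  by \<open>smooth_map_iff\<close>.\<close>

definition smooth_at :: "('a, 'e::lctvs) mfd \<Rightarrow> ('b, 'f::lctvs) mfd \<Rightarrow> ('a \<Rightarrow> 'b) \<Rightarrow> 'a \<Rightarrow> bool" where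
  "smooth_at M N f x \<longleftrightarrow> (\<exists>c \<in> charts M. \<exists>d \<in> charts N. \<exists>W. x \<in> W \<and> chart_smooth c d f W)"

lemma smooth_at_points:
  "atlas_mfd M \<Longrightarrow> smooth_at M N f x \<Longrightarrow> x \<in> points M"
  "atlas_mfd N \<Longrightarrow> smooth_at M N f x \<Longrightarrow> f x \<in> points N"
  by (auto simp: smooth_at_def atlas_mfd_def chart_smooth_def)

text \<open>Around each common point the transition factors through a chart of the atlas itself, and
  smoothness is local.\<close>

lemma max_charts_compatible:
  assumes M: "atlas_mfd M" and c: "c \<in> max_charts M" and c': "c' \<in> max_charts M"
  shows "compatible c c'"
proof (rule chart_smooth_compatible, rule chart_smooth_local)
  show ic: "is_chart c" using max_chartsD[OF c] by simp
  fix x assume x: "x \<in> cdom c \<inter> cdom c'"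
  then have "x \<in> points M" using max_chartsD[OF c] by auto
  note d = chart_at[OF M this]
  let ?d = "chart_at M x"
  let ?V = "cdom c \<inter> cdom c' \<inter> cdom ?d"
  have "openin (mtop M) ?V" using openin_cdom[OF M] c c' d by (intro openin_Int) auto
  then have o: "openin (top_of_set (cmodel c)) (cmap c ` ?V)"
    by (subst (asm) openin_mtop_chart[OF M c]) auto
  have "chart_smooth c ?d (\<lambda>x. x) ?V"
    by (rule chart_smooth_subset[OF compatible_chart_smooth[OF max_chartsD(3)[OF c d(1)]] _ o]) auto
  from chart_smooth_compose(1)[OF ic d(3) this compatible_chart_smooth[OF
      max_chartsD(4)[OF c' d(1)]]]
  have "chart_smooth c c' (\<lambda>x. x) ?V" by auto
  then show "\<exists>W. x \<in> W \<and> W \<subseteq> cdom c \<inter> cdom c' \<and> chart_smooth c c' (\<lambda>x. x) W"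
    using x d by (intro exI[of _ ?V]) auto
qed

lemma chart_smooth_change:
  assumes M: "atlas_mfd M" and N: "atlas_mfd N"
    and c: "c \<in> max_charts M" and d: "d \<in> max_charts N" and W: "x \<in> W" "chart_smooth c d f W"
    and c': "c' \<in> max_charts M" "x \<in> cdom c'" and d': "d' \<in> max_charts N" "f x \<in> cdom d'"
  obtains V where "x \<in> V" "openin (mtop M) V" "chart_smooth c' d' f V"
proof -
  note ch = max_chartsD(1)[OF c] max_chartsD(1)[OF d] and ch' = max_chartsD(1)[OF c'(1)]
  note cc = max_charts_compatible[OF M c'(1) c] and dd = max_charts_compatible[OF N d d'(1)]
  define V where "V = (W \<inter> cdom c') \<inter> f -` (cdom d \<inter> cdom d')"
  have Wc: "W \<subseteq> cdom c" using W(2) by (simp add: chart_smooth_def)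
  have "openin (top_of_set (cmodel c)) (cmap c ` (W \<inter> f -` (cdom d \<inter> cdom d')))"
    using compatible_def dd by (intro chart_smooth_vimage[OF ch W(2)]) auto
  then have "openin (mtop M) (W \<inter> f -` (cdom d \<inter> cdom d'))"
    using Wc by (subst openin_mtop_chart[OF M c]) auto
  then have "openin (mtop M) ((W \<inter> f -` (cdom d \<inter> cdom d')) \<inter> cdom c')"
    using openin_cdom[OF M c'(1)] by (rule openin_Int)
  moreover have "(W \<inter> f -` (cdom d \<inter> cdom d')) \<inter> cdom c' = V" by (auto simp: V_def)
  ultimately have oV: "openin (mtop M) V" by simp
  have xV: "x \<in> V" using W c' d' by (auto simp: V_def chart_smooth_def)
  have VV: "V \<subseteq> cdom c" "V \<subseteq> cdom c'" "V \<subseteq> W" using Wc by (auto simp: V_def)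
  have oc: "openin (top_of_set (cmodel c)) (cmap c ` V)" "openin (top_of_set
      (cmodel c')) (cmap c' ` V)"
    using oV openin_mtop_chart[OF M c VV(1)] openin_mtop_chart[OF M c'(1) VV(2)] by simp_all
  have 1: "chart_smooth c' c (\<lambda>x. x) V"
    by (rule chart_smooth_subset[OF compatible_chart_smooth[OF cc]]) (use VV oc in auto)
  have 2: "chart_smooth c d f V" by (rule chart_smooth_subset[OF W(2) VV(3) oc(1)])
  have "chart_smooth c' d f V"
    using chart_smooth_compose[OF ch' ch(1) 1 2] by simp
  from chart_smooth_compose[OF ch' ch(2) this compatible_chart_smooth[OF dd]]
  have "chart_smooth c' d' f V" by (auto simp: V_def)
  then show thesis using xV oV that by blast
qed

lemma smooth_at_charts:
  assumes M: "atlas_mfd M" and N: "atlas_mfd N" and f: "smooth_at M N f x"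
    and c': "c' \<in> max_charts M" "x \<in> cdom c'" and d': "d' \<in> max_charts N" "f x \<in> cdom d'"
  obtains W where "x \<in> W" "openin (mtop M) W" "chart_smooth c' d' f W"
proof -
  obtain c d W where c: "c \<in> charts M" and d: "d \<in> charts N" and W: "x \<in> W" "chart_smooth c d f W"
    using f by (auto simp: smooth_at_def)
  show thesis
    using chart_smooth_change[OF M N charts_max_charts[OF M c]
        charts_max_charts[OF N d] W c' d'] that .
qed

lemma smooth_atI:
  assumes M: "atlas_mfd M" and N: "atlas_mfd N"
    and c: "c \<in> max_charts M" and d: "d \<in> max_charts N" and W: "x \<in> W" "chart_smooth c d f W"
  shows "smooth_at M N f x"
proof -
  have pts: "x \<in> points M" "f x \<in> points N"
    using W max_chartsD(2)[OF c] max_chartsD(2)[OF d] by (auto simp: chart_smooth_def)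
  note a = chart_at[OF M pts(1)] and b = chart_at[OF N pts(2)]
  obtain V where "x \<in> V" "openin (mtop M) V" "chart_smooth (chart_at M x) (chart_at N (f x)) f V"
    using chart_smooth_change[OF M N c d W a(4,2) b(4,2)] .
  then show ?thesis using a(1) b(1) unfolding smooth_at_def by blast
qed

text \<open>Continuity makes the domain of each coordinate expression open. Conversely, coordinate
  expressions that are smooth near every point are continuous, and preimages of open sets are then
  unions of open sets of single charts.\<close>

lemma smooth_map_iff:
  assumes M: "atlas_mfd M" and N: "atlas_mfd N"
  shows "smooth_map M N f \<longleftrightarrow> (\<forall>x \<in> points M. smooth_at M N f x)"
proof
  assume f: "smooth_map M N f"
  show "\<forall>x \<in> points M. smooth_at M N f x"
  proof
    fix x assume x: "x \<in> points M"
    have cont: "continuous_map (mtop M) (mtop N) f" using f by (simp add: smooth_map_def)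
    then have "f x \<in> points N"
      using x continuous_map_image_subset_topspace[OF cont] by (auto simp: topspace_mtop M N)
    then obtain c d where c: "c \<in> charts M" "x \<in> cdom c" and d: "d \<in> charts N" "f x \<in> cdom d"
      using M N x by (auto simp: atlas_mfd_def)
    have "openin (mtop N) (cdom d)" using openin_cdom[OF N charts_max_charts[OF N d(1)]] .
    then have "openin (mtop M) {x \<in> points M. f x \<in> cdom d}"
      using openin_continuous_map_preimage[OF cont] by (simp add: topspace_mtop M)
    then have "openin (top_of_set (cmodel c)) (cmap c ` ({x \<in> points M. f x \<in> cdom d} \<inter> cdom c))"
      using c by (simp add: openin_mtop_atlas[OF M])
    moreover have "{x \<in> points M. f x \<in> cdom d} \<inter> cdom c = cdom c \<inter> f -` cdom d"
      using c M by (auto simp: atlas_mfd_def)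
    ultimately have "chart_smooth c d f (cdom c \<inter> f -` cdom d)"
      using f c d by (auto simp: chart_smooth_def smooth_map_def)
    then show "smooth_at M N f x"
      unfolding smooth_at_def
      using c d by (intro bexI[of _ c] bexI[of _ d] exI[of _ "cdom c \<inter> f -` cdom d"]) auto
  qed
next
  assume f: "\<forall>x \<in> points M. smooth_at M N f x"
  show "smooth_map M N f"
    unfolding smooth_map_def continuous_map_def
  proof (intro conjI allI impI ballI)
    show "f \<in> topspace (mtop M) \<rightarrow> topspace (mtop N)"
      using f smooth_at_points(2)[OF N, of M f] by (simp add: topspace_mtop M N Pi_iff)
    fix V assume V: "openin (mtop N) V"
    show "openin (mtop M) {x \<in> topspace (mtop M). f x \<in> V}"
    proof (subst openin_subopen, safe)
      fix x assume x: "x \<in> topspace (mtop M)" "f x \<in> V"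
      then obtain c d W where c: "c \<in> charts M" and d: "d \<in> charts N"
          and W: "x \<in> W" "chart_smooth c d f W"
        using f by (auto simp: smooth_at_def topspace_mtop M)
      have ch: "is_chart c" "is_chart d" using M N c d by (auto simp: atlas_mfd_def)
      have Wc: "W \<subseteq> cdom c" "f ` W \<subseteq> cdom d" using W(2) by (auto simp: chart_smooth_def)
      have "openin (top_of_set (cmodel c)) (cmap c ` (W \<inter> f -` (V \<inter> cdom d)))"
        using V d by (intro chart_smooth_vimage[OF ch W(2)]) (auto simp: openin_mtop_atlas[OF N])
      then have "openin (mtop M) (W \<inter> f -` (V \<inter> cdom d))"
        using Wc by (subst openin_mtop_chart[OF M charts_max_charts[OF M c]]) auto
      then show "\<exists>T. openin (mtop M) T \<and> x \<in> T \<and> T \<subseteq> {x \<in> topspace (mtop M). f x \<in> V}"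
        using W x Wc by (intro exI[of _ "W \<inter> f -` (V \<inter> cdom d)"]) (auto dest: openin_subset)
    qed
  next
    fix c d assume c: "c \<in> charts M" and d: "d \<in> charts N"
    have cc: "is_chart c" using M c by (auto simp: atlas_mfd_def)
    have "chart_smooth c d f (cdom c \<inter> f -` cdom d)"
    proof (rule chart_smooth_local[OF cc])
      fix x assume x: "x \<in> cdom c \<inter> f -` cdom d"
      then have xx: "x \<in> cdom c" "f x \<in> cdom d" "smooth_at M N f x"
        using f c M by (auto simp: atlas_mfd_def)
      obtain W where "x \<in> W" "openin (mtop M) W" "chart_smooth c d f W"
        using smooth_at_charts[OF M N xx(3) charts_max_charts[OF M c] xx(1)
            charts_max_charts[OF N d] xx(2)] .
      then show "\<exists>W. x \<in> W \<and> W \<subseteq> cdom c \<inter> f -` cdom d \<and> chart_smooth c d f W"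
        by (intro exI[of _ W]) (auto simp: chart_smooth_def)
    qed
    then show "bastiani_smooth (cmodel c) (cmap c ` (cdom c \<inter> f -` cdom d)) (cmap d \<circ> f \<circ> cinv c)"
      by (simp add: chart_smooth_def)
  qed
qed

lemma smooth_at_chart_at:
  assumes M: "atlas_mfd M" and N: "atlas_mfd N" and f: "smooth_at M N f x"
  obtains W where "x \<in> W" "openin (mtop M) W" "chart_smooth (chart_at M x) (chart_at N (f x)) f W"
proof -
  have "x \<in> points M" "f x \<in> points N" using smooth_at_points(1)[OF M f]
      smooth_at_points(2)[OF N f] by auto
  then show thesis
    using smooth_at_charts[OF M N f] chart_at M N that by metis
qed

text \<open>Shrinks the domain of the first map to the part that lands in \<open>B\<close>, so that
  \<open>chart_smooth_compose\<close> applies to maps known only near a point.\<close>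

lemma chart_smooth_Int_vimage:
  assumes a: "is_chart a" and b: "is_chart b"
    and f: "chart_smooth a b f A" and g: "chart_smooth b e g B"
  shows "chart_smooth a b f (A \<inter> f -` B)"
  by (rule chart_smooth_subset[OF f _ chart_smooth_vimage[OF a b f]])
     (use g in \<open>auto simp: chart_smooth_def\<close>)

text \<open>\<open>tangent_map\<close> uses one fixed chart per point, so both factors read the
  intermediate point in the same chart and no change of coordinates appears in the chain
  rule.\<close>

lemma
  assumes M: "atlas_mfd M" and N: "atlas_mfd N" and P: "atlas_mfd P"
    and f: "smooth_at M N f x" and g: "smooth_at N P g (f x)"
  shows smooth_at_compose: "smooth_at M P (\<lambda>x. g (f x)) x"
    and tangent_map_compose: "v \<in> tangent_space M x \<Longrightarrow>
      tangent_map M P (\<lambda>x. g (f x)) x v = tangent_map N P g (f x) (tangent_map M N f x v)"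
proof -
  let ?a = "chart_at M x" and ?b = "chart_at N (f x)" and ?e = "chart_at P (g (f x))"
  have pts: "x \<in> points M" "f x \<in> points N" "g (f x) \<in> points P"
    using smooth_at_points(1)[OF M f] smooth_at_points(2)[OF N f]
        smooth_at_points(2)[OF P g] by auto
  note a = chart_at[OF M pts(1)] and b = chart_at[OF N pts(2)] and e = chart_at[OF P pts(3)]
  obtain W where W: "x \<in> W" "chart_smooth ?a ?b f W"
    using smooth_at_chart_at[OF M N f] by blast
  obtain W' where W': "f x \<in> W'" "chart_smooth ?b ?e g W'"
    using smooth_at_chart_at[OF N P g] by blast
  note V = chart_smooth_Int_vimage[OF a(3) b(3) W(2) W'(2)]
  have im: "f ` (W \<inter> f -` W') \<subseteq> W'" by auto
  show "smooth_at M P (\<lambda>x. g (f x)) x"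
    by (rule smooth_atI[OF M P a(4) e(4) _ chart_smooth_compose(1)[OF a(3) b(3) V W'(2) im]])
       (use W W' in auto)
  assume "v \<in> tangent_space M x"
  then show "tangent_map M P (\<lambda>x. g (f x)) x v = tangent_map N P g (f x) (tangent_map M N f x v)"
    unfolding tangent_map_chart_deriv tangent_space_def
    using W W' by (intro chart_deriv_compose[OF a(3) b(3) V W'(2) im]) auto
qed

lemma tangent_map_mem:
  assumes M: "atlas_mfd M" and N: "atlas_mfd N" and f: "smooth_at M N f x"
      and v: "v \<in> tangent_space M x"
  shows "tangent_map M N f x v \<in> tangent_space N (f x)"
proof -
  have pts: "x \<in> points M" "f x \<in> points N" using smooth_at_points(1)[OF M f]
      smooth_at_points(2)[OF N f] by auto
  obtain W where "x \<in> W" "chart_smooth (chart_at M x) (chart_at N (f x)) f W"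
    using smooth_at_chart_at[OF M N f] by blast
  then show ?thesis
    unfolding tangent_map_chart_deriv using v chart_at[OF M pts(1)] chart_at[OF N pts(2)]
    by (auto simp: tangent_space_def intro: chart_deriv_mem)
qed

lemma
  assumes M: "atlas_mfd M" and N: "atlas_mfd N" and f: "smooth_at M N f x"
    and u: "u \<in> tangent_space M x" and v: "v \<in> tangent_space M x"
  shows tangent_map_add: "tangent_map M N f x (u + v) = tangent_map M N f x u
      + tangent_map M N f x v"
    and tangent_map_scale: "tangent_map M N f x (r *\<^sub>R v) = r *\<^sub>R tangent_map M N f x v"
proof -
  have pts: "x \<in> points M" using smooth_at_points(1)[OF M f] by auto
  obtain W where W: "x \<in> W" "chart_smooth (chart_at M x) (chart_at N (f x)) f W"
    using smooth_at_chart_at[OF M N f] by blast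
  note lin = chart_deriv_linear[OF chart_at(3)[OF M pts] W(2,1) u[unfolded tangent_space_def]
      v[unfolded tangent_space_def]]
  show "tangent_map M N f x (u + v) = tangent_map M N f x u + tangent_map M N f x v"
    unfolding tangent_map_chart_deriv by (rule lin)
  show "tangent_map M N f x (r *\<^sub>R v) = r *\<^sub>R tangent_map M N f x v"
    unfolding tangent_map_chart_deriv by (rule lin)
qed

lemma
  assumes M: "atlas_mfd M" and x: "x \<in> points M"
  shows smooth_at_ident: "smooth_at M M (\<lambda>x. x) x"
    and tangent_map_ident: "v \<in> tangent_space M x \<Longrightarrow> tangent_map M M (\<lambda>x. x) x v = v"
proof -
  note a = chart_at[OF M x]
  show "smooth_at M M (\<lambda>x. x) x"
    by (rule smooth_atI[OF M M a(4) a(4) a(2) chart_smooth_ident(1)[OF a(3)]])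
  show "v \<in> tangent_space M x \<Longrightarrow> tangent_map M M (\<lambda>x. x) x v = v"
    unfolding tangent_map_chart_deriv tangent_space_def
      by (rule chart_smooth_ident(2)[OF a(3) a(2)])
qed

lemma
  assumes M: "atlas_mfd M" and V: "openin (mtop M) V" "x \<in> V" and eq: "\<And>y. y \<in> V \<Longrightarrow> f y = g y"
  shows tangent_map_cong: "v \<in> tangent_space M x \<Longrightarrow> tangent_map M N f x v = tangent_map M N g x v"
    and smooth_at_cong: "atlas_mfd N \<Longrightarrow> smooth_at M N f x \<Longrightarrow> smooth_at M N g x"
proof -
  have x: "x \<in> points M" using V openin_subset topspace_mtop[OF M] by blast
  note a = chart_at[OF M x]
  assume v: "v \<in> tangent_space M x"
  have "openin (mtop M) (V \<inter> cdom (chart_at M x))"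
    using V openin_cdom[OF M a(4)] by (intro openin_Int)
  then have "openin (top_of_set (cmodel (chart_at M x))) (cmap (chart_at M x) ` (V \<inter>
      cdom (chart_at M x)))"
    by (subst (asm) openin_mtop_chart[OF M a(4)]) auto
  then have "chart_deriv (chart_at M x) (chart_at N (f x)) f x v
      = chart_deriv (chart_at M x) (chart_at N (f x)) g x v"
    using v a V eq by (intro chart_deriv_cong[OF a(3), where A
        = "V \<inter> cdom (chart_at M x)"]) (auto simp: tangent_space_def)
  then show "tangent_map M N f x v = tangent_map M N g x v"
    unfolding tangent_map_chart_deriv using eq[OF V(2)] by simp
next
  have x: "x \<in> points M" using V openin_subset topspace_mtop[OF M] by blast
  note a = chart_at[OF M x]
  assume N: "atlas_mfd N" and f: "smooth_at M N f x"
  obtain W where W: "x \<in> W" "openin (mtop M) W" "chart_smooth (chart_at M x) (chart_at N (f x)) f W"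
    using smooth_at_chart_at[OF M N f] by blast
  have Wc: "W \<subseteq> cdom (chart_at M x)" using W by (simp add: chart_smooth_def)
  have "openin (mtop M) (W \<inter> V)" using W V by blast
  then have "openin (top_of_set (cmodel (chart_at M x))) (cmap (chart_at M x) ` (W \<inter> V))"
    using Wc by (subst (asm) openin_mtop_chart[OF M a(4)]) auto
  then have "chart_smooth (chart_at M x) (chart_at N (f x)) f (W \<inter> V)"
    by (intro chart_smooth_subset[OF W(3)]) auto
  then have "chart_smooth (chart_at M x) (chart_at N (f x)) g (W \<inter> V)"
    by (rule chart_smooth_cong[OF a(3)]) (use eq in auto)
  then show "smooth_at M N g x"
    using W V smooth_at_points(2)[OF N f]
    by (intro smooth_atI[OF M N a(4) chart_at(4)[OF N]]) auto
qed

lemma smooth_at_const: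
  assumes M: "atlas_mfd M" and N: "atlas_mfd N" and "x \<in> points M" "y \<in> points N"
  shows "smooth_at M N (\<lambda>_. y) x" and "v \<in> tangent_space M x \<Longrightarrow> tangent_map M N (\<lambda>_. y) x v = 0"
proof -
  note a = chart_at[OF M assms(3)] and b = chart_at[OF N assms(4)]
  have c: "cmap (chart_at N y) \<circ> (\<lambda>_. y) \<circ> cinv (chart_at M x) = (\<lambda>_. cmap (chart_at N y) y)"
    by (simp add: comp_def)
  have "chart_smooth (chart_at M x) (chart_at N y) (\<lambda>_. y) (cdom (chart_at M x))"
    unfolding chart_smooth_def c using a b by (auto simp: is_chart_def bastiani_smooth_const)
  then show "smooth_at M N (\<lambda>_. y) x" by (intro smooth_atI[OF M N a(4) b(4) a(2)])
  show "tangent_map M N (\<lambda>_. y) x v = 0"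
    unfolding tangent_map_def c by (rule dir_derivI) simp
qed

section \<open>Products\<close>

definition prod_chart :: "('a, 'e) chart \<Rightarrow> ('b, 'f) chart \<Rightarrow> ('a \<times> 'b, 'e \<times> 'f) chart" where
  "prod_chart c d = \<lparr>cdom = cdom c \<times> cdom d, cmap = map_prod (cmap c) (cmap d), cmodel
      = cmodel c \<times> cmodel d\<rparr>"

lemma prod_chart_simps [simp]:
  "cdom (prod_chart c d) = cdom c \<times> cdom d"
  "cmap (prod_chart c d) = map_prod (cmap c) (cmap d)"
  "cmodel (prod_chart c d) = cmodel c \<times> cmodel d"
  by (simp_all add: prod_chart_def)

lemma prod_mfd_simps [simp]:
  "points (prod_mfd M N) = points M \<times> points N"
  "charts (prod_mfd M N) = {prod_chart c d | c d. c \<in> charts M \<and> d \<in> charts N}"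
  by (simp_all add: prod_mfd_def prod_chart_def)

lemma is_chart_prod:
  assumes "is_chart c" "is_chart d"
  shows "is_chart (prod_chart c d)"
  using assms unfolding is_chart_def
  by (auto intro!: map_prod_inj_on subspace_Times closed_Times openin_Times simp:
      map_prod_surj_on[OF refl refl])

lemma chart_open_Times:
  "openin (top_of_set (cmodel c)) (cmap c ` A) \<Longrightarrow> openin (top_of_set (cmodel d)) (cmap d ` B) \<Longrightarrow>
   openin (top_of_set (cmodel (prod_chart c d))) (cmap (prod_chart c d) ` (A \<times> B))"
  by (auto intro!: openin_Times simp: map_prod_surj_on[OF refl refl])

lemma chart_smooth_projections:
  assumes "is_chart c" "is_chart d"
  shows "chart_smooth (prod_chart c d) c fst (cdom c \<times> cdom d)" "chart_smooth (prod_chart c d) d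
      snd (cdom c \<times> cdom d)"
proof -
  let ?p = "prod_chart c d"
  have p: "is_chart ?p" using is_chart_prod assms .
  have o: "openin (top_of_set (cmodel ?p)) (cmap ?p ` (cdom c \<times> cdom d))"
    using p by (simp add: is_chart_def)
  have eq: "cinv ?p (cmap ?p q) = q" if "q \<in> cdom c \<times> cdom d" for q
    using cinv_cmap[OF p] that by simp
  have "bastiani_smooth (cmodel ?p) (cmap ?p ` (cdom c \<times> cdom d)) (cmap c \<circ> fst \<circ> cinv ?p)"
  proof (rule bastiani_smooth_cong[OF o is_chart_subspace(1)[OF p]])
    show "bastiani_smooth (cmodel ?p) (cmap ?p ` (cdom c \<times> cdom d)) fst"
      by (rule bastiani_smooth_linear) (auto intro: linear_fst continuous_on_fst continuous_on_id)
  qed (use eq in auto)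
  with o show "chart_smooth ?p c fst (cdom c \<times> cdom d)" by (auto simp: chart_smooth_def)
  have "bastiani_smooth (cmodel ?p) (cmap ?p ` (cdom c \<times> cdom d)) (cmap d \<circ> snd \<circ> cinv ?p)"
  proof (rule bastiani_smooth_cong[OF o is_chart_subspace(1)[OF p]])
    show "bastiani_smooth (cmodel ?p) (cmap ?p ` (cdom c \<times> cdom d)) snd"
      by (rule bastiani_smooth_linear) (auto intro: linear_snd continuous_on_snd continuous_on_id)
  qed (use eq in auto)
  with o show "chart_smooth ?p d snd (cdom c \<times> cdom d)" by (auto simp: chart_smooth_def)
qed

lemma chart_smooth_Pair:
  assumes a: "is_chart a" and f: "chart_smooth a b f A" and g: "chart_smooth a b' g A"
  shows "chart_smooth a (prod_chart b b') (\<lambda>x. (f x, g x)) A"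
proof -
  have "bastiani_smooth (cmodel a) (cmap a ` A) (\<lambda>y. ((cmap b \<circ> f \<circ> cinv a) y, (cmap
      b' \<circ> g \<circ> cinv a) y))"
  proof (rule bastiani_smooth_Pair[OF _ _ is_chart_subspace(1)[OF a]])
    show "bastiani_smooth (cmodel a) (cmap a ` A) (cmap b \<circ> f \<circ> cinv a)"
      "openin (top_of_set (cmodel a)) (cmap a ` A)"
      using f by (simp_all add: chart_smooth_def)
    show "bastiani_smooth (cmodel a) (cmap a ` A) (cmap b' \<circ> g \<circ> cinv a)"
      using g by (simp add: chart_smooth_def)
  qed
  moreover have "(\<lambda>y. ((cmap b \<circ> f \<circ> cinv a) y, (cmap b' \<circ> g \<circ> cinv a) y)) =
      cmap (prod_chart b b') \<circ> (\<lambda>x. (f x, g x)) \<circ> cinv a"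
    by (simp add: fun_eq_iff)
  ultimately show ?thesis using f g by (auto simp: chart_smooth_def)
qed

lemma atlas_mfd_prod:
  assumes M: "atlas_mfd M" and N: "atlas_mfd N"
  shows "atlas_mfd (prod_mfd M N)"
  unfolding atlas_mfd_def
proof (intro conjI ballI)
  have pts: "points M = (\<Union>c\<in>charts M. cdom c)" "points N = (\<Union>c\<in>charts N. cdom c)"
    using M N by (auto simp: atlas_mfd_def)
  have "(\<Union>c\<in>charts (prod_mfd M N). cdom c) = (\<Union>c\<in>charts M. \<Union>d\<in>charts N. cdom c \<times> cdom d)"
    by fastforce
  also have "\<dots> = points (prod_mfd M N)" unfolding prod_mfd_simps pts by blast
  finally show "points (prod_mfd M N) = (\<Union>c\<in>charts (prod_mfd M N). cdom c)" by simp
  fix p assume "p \<in> charts (prod_mfd M N)"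
  then obtain c d where p: "p = prod_chart c d" "c \<in> charts M" "d \<in> charts N" by auto
  then have cd: "is_chart c" "is_chart d" using M N by (auto simp: atlas_mfd_def)
  then show ip: "is_chart p" using p is_chart_prod by blast
  fix p' assume "p' \<in> charts (prod_mfd M N)"
  then obtain c' d' where p': "p' = prod_chart c' d'" "c' \<in> charts M" "d' \<in> charts N" by auto
  have comp: "compatible c c'" "compatible d d'" using p p' M N by (auto simp: atlas_mfd_def)
  let ?A = "(cdom c \<inter> cdom c') \<times> (cdom d \<inter> cdom d')"
  have o: "openin (top_of_set (cmodel p)) (cmap p ` ?A)"
    using comp unfolding p(1) by (intro chart_open_Times) (auto simp: compatible_def)
  have "chart_smooth p c fst ?A" "chart_smooth p d snd ?A"
    using o chart_smooth_projections[OF cd] unfolding p(1) by (auto elim!: chart_smooth_subset)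
  then have "chart_smooth p c' (\<lambda>q. fst q) ?A" "chart_smooth p d' (\<lambda>q. snd q) ?A"
    using chart_smooth_compose(1)[OF ip cd(1) _ compatible_chart_smooth[OF comp(1)], of fst ?A]
      chart_smooth_compose(1)[OF ip cd(2) _ compatible_chart_smooth[OF comp(2)], of snd ?A] by auto
  from chart_smooth_Pair[OF ip this] have "chart_smooth p p' (\<lambda>x. x) ?A" by (simp add: p')
  moreover have "?A = cdom p \<inter> cdom p'" by (auto simp: p p')
  ultimately show "compatible p p'" by (intro chart_smooth_compatible) simp
qed

lemma
  assumes M: "atlas_mfd M" and N: "atlas_mfd N" and x: "x \<in> points M \<times> points N"
  shows smooth_at_fst: "smooth_at (prod_mfd M N) M fst x"
      and smooth_at_snd: "smooth_at (prod_mfd M N) N snd x"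
proof -
  have pts: "fst x \<in> points M" "snd x \<in> points N" using x by auto
  note a = chart_at[OF M pts(1)] and b = chart_at[OF N pts(2)]
  have "prod_chart (chart_at M (fst x)) (chart_at N (snd x)) \<in> max_charts (prod_mfd M N)"
    using a b by (intro charts_max_charts atlas_mfd_prod M N) auto
  note smooth = smooth_atI[OF atlas_mfd_prod[OF M N] _ this]
  have x': "x \<in> cdom (chart_at M (fst x)) \<times> cdom (chart_at N (snd x))"
    using a b by (auto simp: mem_Times_iff)
  show "smooth_at (prod_mfd M N) M fst x"
    by (rule smooth[OF M a(4) x' chart_smooth_projections(1)[OF a(3) b(3)]])
  show "smooth_at (prod_mfd M N) N snd x"
    by (rule smooth[OF N b(4) x' chart_smooth_projections(2)[OF a(3) b(3)]])
qed

lemma smooth_at_Pair: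
  assumes X: "atlas_mfd X" and M: "atlas_mfd M" and N: "atlas_mfd N"
    and f: "smooth_at X M f x" and g: "smooth_at X N g x"
  shows "smooth_at X (prod_mfd M N) (\<lambda>x. (f x, g x)) x"
proof -
  have pts: "x \<in> points X" "f x \<in> points M" "g x \<in> points N"
    using smooth_at_points(1)[OF X f] smooth_at_points(2)[OF M f]
      smooth_at_points(2)[OF N g] by auto
  note a = chart_at[OF X pts(1)] and b = chart_at[OF M pts(2)] and b' = chart_at[OF N pts(3)]
  obtain W where W: "x \<in> W" "openin (mtop X) W" "chart_smooth (chart_at X x) (chart_at M (f x)) f W"
    using smooth_at_chart_at[OF X M f] by blast
  obtain W' where W': "x \<in> W'" "openin (mtop X) W'" "chart_smooth (chart_at X x)
      (chart_at N (g x)) g W'"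
    using smooth_at_chart_at[OF X N g] by blast
  have "W \<inter> W' \<subseteq> cdom (chart_at X x)" using W by (auto simp: chart_smooth_def)
  then have o: "openin (top_of_set (cmodel (chart_at X x))) (cmap (chart_at X x) ` (W \<inter> W'))"
    using W W' openin_mtop_chart[OF X a(4)] by blast
  have "chart_smooth (chart_at X x) (prod_chart (chart_at M (f x)) (chart_at N (g x))) (\<lambda>x.
      (f x, g x)) (W \<inter> W')"
    using chart_smooth_subset[OF W(3) _ o] chart_smooth_subset[OF W'(3) _ o]
    by (intro chart_smooth_Pair a) auto
  moreover have "prod_chart (chart_at M (f x)) (chart_at N (g x)) \<in> max_charts (prod_mfd M N)"
    using b b' by (intro charts_max_charts atlas_mfd_prod M N) auto
  ultimately show ?thesis
    using W W' by (intro smooth_atI[OF X atlas_mfd_prod[OF M N] a(4)]) auto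
qed

section \<open>Submanifolds\<close>

definition sub_chart :: "('a, 'e) chart \<Rightarrow> 'a set \<Rightarrow> 'e set \<Rightarrow> ('a, 'e) chart" where
  "sub_chart c N F = \<lparr>cdom = cdom c \<inter> N, cmap = cmap c, cmodel = F\<rparr>"

lemma sub_chart_simps [simp]:
  "cdom (sub_chart c N F) = cdom c \<inter> N" "cmap (sub_chart c N F)
      = cmap c" "cmodel (sub_chart c N F) = F"
  by (simp_all add: sub_chart_def)

lemma sub_mfd_simps:
  "points (sub_mfd M N) = N"
  "charts (sub_mfd M N) = {sub_chart c N F | c F. c \<in> max_charts M \<and> subspace F \<and> closed F \<and>
     F \<subseteq> cmodel c \<and> cmap c ` (cdom c \<inter> N) = cmap c ` cdom c \<inter> F}"
  by (simp_all add: sub_mfd_def sub_chart_def)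

text \<open>\<open>chart_smooth\<close> never refers to the model space of the target chart, so
  restricting the target to \<open>N\<close> costs only the inclusion of the image. This lets closed
  subspaces without complement serve as models.\<close>

lemma chart_smooth_sub_chart_target:
  "chart_smooth a c f A \<Longrightarrow> f ` A \<subseteq> N \<Longrightarrow> chart_smooth a (sub_chart c N F) f A"
  by (auto simp: chart_smooth_def)

lemma sub_chart_inclusion:
  assumes c: "is_chart c" and F: "subspace F" "closed F" "F \<subseteq> cmodel c"
    and N: "cmap c ` (cdom c \<inter> N) = cmap c ` cdom c \<inter> F"
  shows "is_chart (sub_chart c N F)"
    and "chart_smooth (sub_chart c N F) c (\<lambda>x. x) (cdom c \<inter> N)"
proof -
  have "openin (top_of_set F) (cmap c ` cdom c \<inter> F)"
    using c F(3) by (auto simp: is_chart_def openin_open)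
  then show s: "is_chart (sub_chart c N F)"
    using c F N by (auto simp: is_chart_def intro: inj_on_subset)
  have "chart_smooth (sub_chart c N F) (sub_chart c N F) (\<lambda>x. x) (cdom (sub_chart c N F))"
    by (rule chart_smooth_ident(1)[OF s])
  then show "chart_smooth (sub_chart c N F) c (\<lambda>x. x) (cdom c \<inter> N)"
    by (auto simp: chart_smooth_def)
qed

text \<open>A transition between adapted charts is the restriction of a transition of
  \<open>M\<close> to the flattened part, and it takes values in \<open>N\<close>.\<close>

lemma atlas_mfd_sub:
  assumes M: "atlas_mfd M" and N: "submanifold M N"
  shows "atlas_mfd (sub_mfd M N)"
  unfolding atlas_mfd_def
proof (intro conjI ballI)
  show "points (sub_mfd M N) = (\<Union>c\<in>charts (sub_mfd M N). cdom c)"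
    using N by (auto simp: submanifold_def sub_mfd_simps)
  fix C assume "C \<in> charts (sub_mfd M N)"
  then obtain c F where c: "C = sub_chart c N F" "c \<in> max_charts M" "subspace F"
      "closed F" "F \<subseteq> cmodel c"
    "cmap c ` (cdom c \<inter> N) = cmap c ` cdom c \<inter> F" by (auto simp: sub_mfd_simps)
  note ic = max_chartsD(1)[OF c(2)]
  note inc = sub_chart_inclusion[OF ic c(3-6)]
  show C: "is_chart C" using inc c by simp
  fix C' assume "C' \<in> charts (sub_mfd M N)"
  then obtain c' F' where c': "C' = sub_chart c' N F'" "c' \<in> max_charts M"
    by (auto simp: sub_mfd_simps)
  let ?A = "cdom C \<inter> cdom C'"
  note comp = max_charts_compatible[OF M c(2) c'(2)]
  have "cmap c ` ((cdom c \<inter> N) \<inter> (cdom c \<inter> cdom c'))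
      = cmap c ` (cdom c \<inter> N) \<inter> cmap c ` (cdom c \<inter> cdom c')"
    by (rule cmap_image_Int[OF ic]) auto
  also have "\<dots> = F \<inter> cmap c ` (cdom c \<inter> cdom c')" using c(6) by auto
  finally have im: "cmap c ` ?A = F \<inter> cmap c ` (cdom c \<inter> cdom c')"
    by (simp add: c(1) c'(1) Int_ac)
  obtain X where X: "open X" "cmap c ` (cdom c \<inter> cdom c') = cmodel c \<inter> X"
    using comp by (auto simp: compatible_def openin_open)
  have "openin (top_of_set F) (F \<inter> X)" using X by (auto simp: openin_open)
  moreover have "F \<inter> X = cmap C ` ?A" using im X c by auto
  ultimately have o: "openin (top_of_set (cmodel C)) (cmap C ` ?A)" by (simp add: c)
  have "chart_smooth C c (\<lambda>x. x) ?A"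
    unfolding c(1) by (rule chart_smooth_subset[OF inc(2)]) (use o c in auto)
  from chart_smooth_compose(1)[OF C ic this compatible_chart_smooth[OF comp]]
  have "chart_smooth C c' (\<lambda>x. x) ?A" by (auto simp: c(1) c'(1))
  then have "chart_smooth C C' (\<lambda>x. x) ?A"
    unfolding c'(1) by (rule chart_smooth_sub_chart_target) auto
  then show "compatible C C'" by (rule chart_smooth_compatible)
qed

lemma sub_mfd_chart:
  assumes M: "atlas_mfd M" and N: "submanifold M N" and x: "x \<in> N"
  obtains c F where "c \<in> max_charts M" "x \<in> cdom c" "is_chart (sub_chart c N F)" "F \<subseteq> cmodel c"
    "sub_chart c N F \<in> max_charts (sub_mfd M N)"
    "chart_smooth (sub_chart c N F) c (\<lambda>x. x) (cdom c \<inter> N)"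
    "cmap c ` (cdom c \<inter> N) = cmap c ` cdom c \<inter> F"
proof -
  obtain C where C: "C \<in> charts (sub_mfd M N)" "x \<in> cdom C" using N x
    by (auto simp: submanifold_def)
  then obtain c F where c: "C = sub_chart c N F" "c \<in> max_charts M" "subspace F"
      "closed F" "F \<subseteq> cmodel c"
    "cmap c ` (cdom c \<inter> N) = cmap c ` cdom c \<inter> F" by (auto simp: sub_mfd_simps)
  show thesis
    by (rule that[OF c(2) _ _ c(5) _ _ c(6)])
       (use sub_chart_inclusion[OF max_chartsD(1)[OF c(2)] c(3-6)] c C
          charts_max_charts[OF atlas_mfd_sub[OF M N] C(1)] in auto)
qed

lemma smooth_at_inclusion:
  assumes M: "atlas_mfd M" and N: "submanifold M N" and x: "x \<in> N"
  shows "smooth_at (sub_mfd M N) M (\<lambda>x. x) x"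
proof -
  from sub_mfd_chart[OF assms] obtain c F where "c \<in> max_charts M" "x \<in> cdom c"
    "sub_chart c N F \<in> max_charts (sub_mfd M N)" "chart_smooth (sub_chart c N F) c
        (\<lambda>x. x) (cdom c \<inter> N)"
    by metis
  then show ?thesis using x by (intro smooth_atI[OF atlas_mfd_sub[OF M N] M]) auto
qed

lemma smooth_at_sub_mfd:
  assumes X: "atlas_mfd X" and M: "atlas_mfd M" and N: "submanifold M N"
    and f: "smooth_at X M f x" and V: "openin (mtop X) V" "x \<in> V" "f ` V \<subseteq> N"
  shows "smooth_at X (sub_mfd M N) f x"
proof -
  have "f x \<in> N" using V by auto
  from sub_mfd_chart[OF M N this] obtain c F where c: "c \<in> max_charts M" "f x \<in> cdom c"
    "sub_chart c N F \<in> max_charts (sub_mfd M N)" by metis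
  note a = chart_at[OF X smooth_at_points(1)[OF X f]]
  obtain W where W: "x \<in> W" "openin (mtop X) W" "chart_smooth (chart_at X x) c f W"
    using smooth_at_charts[OF X M f a(4,2) c(1,2)] .
  have sub: "W \<inter> V \<subseteq> cdom (chart_at X x)" using W(3) by (auto simp: chart_smooth_def)
  have "openin (mtop X) (W \<inter> V)" using W V by blast
  then have "openin (top_of_set (cmodel (chart_at X x))) (cmap (chart_at X x) ` (W \<inter> V))"
    using openin_mtop_chart[OF X a(4) sub] by simp
  then have "chart_smooth (chart_at X x) c f (W \<inter> V)" by (intro chart_smooth_subset[OF W(3)]) auto
  then have "chart_smooth (chart_at X x) (sub_chart c N F) f (W \<inter> V)"
    by (rule chart_smooth_sub_chart_target) (use V in auto)
  then show ?thesis using W V c by (intro smooth_atI[OF X atlas_mfd_sub[OF M N] a(4) c(3)]) auto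
qed

text \<open>Reconciles two notions of component: the hypothesis on \<open>H\<close> speaks of
  components in the subspace topology, while openness of components comes from the charts of
  \<open>N\<close>.\<close>

lemma mtop_sub_mfd:
  assumes M: "atlas_mfd M" and N: "submanifold M N"
  shows "mtop (sub_mfd M N) = subtopology (mtop M) N"
proof -
  note S = atlas_mfd_sub[OF M N]
  have NM: "N \<subseteq> points M" using N by (simp add: submanifold_def)
  have "smooth_map (sub_mfd M N) M (\<lambda>x. x)"
    using smooth_at_inclusion[OF M N] by (auto simp: smooth_map_iff[OF S M] sub_mfd_simps)
  then have cont: "continuous_map (mtop (sub_mfd M N)) (mtop M) (\<lambda>x. x)"
    by (simp add: smooth_map_def)
  have "openin (mtop (sub_mfd M N)) W \<longleftrightarrow> (\<exists>V. openin (mtop M) V \<and> W = V \<inter> N)" for W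
  proof
    assume W: "openin (mtop (sub_mfd M N)) W"
    then have WN: "W \<subseteq> N" using openin_subset topspace_mtop[OF S] by (fastforce simp: sub_mfd_simps)
    have "\<exists>V. openin (mtop M) V \<and> x \<in> V \<and> V \<inter> N \<subseteq> W" if x: "x \<in> W" for x
    proof -
      from x WN have xN: "x \<in> N" by auto
      from sub_mfd_chart[OF M N this] obtain c F where c: "c \<in> max_charts M" "x \<in> cdom c"
        "is_chart (sub_chart c N F)" "F \<subseteq> cmodel c" "sub_chart c N F \<in> max_charts (sub_mfd M N)"
        "cmap c ` (cdom c \<inter> N) = cmap c ` cdom c \<inter> F" by metis
      note ic = max_chartsD(1)[OF c(1)]
      have "openin (mtop (sub_mfd M N)) (W \<inter> (cdom c \<inter> N))"
        using openin_Int[OF W openin_cdom[OF S c(5)]] by simp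
      then have "openin (top_of_set F) (cmap c ` (W \<inter> (cdom c \<inter> N)))"
        by (subst (asm) openin_mtop_chart[OF S c(5)]) auto
      then obtain X where X: "open X" "cmap c ` (W \<inter> (cdom c \<inter> N)) = F \<inter> X"
        by (auto simp: openin_open)
      \<comment> \<open>The coordinate image of the given set near \<open>x\<close> is the trace on
        \<open>F\<close> of an open set \<open>X\<close>; the preimage of \<open>X\<close> itself
        under the ambient chart is the required open subset of \<open>M\<close>.\<close>
      define V where "V = cdom c \<inter> cmap c -` X"
      have "cmap c ` V = cmap c ` cdom c \<inter> X" by (auto simp: V_def)
      then have "openin (top_of_set (cmodel c)) (cmap c ` V)"
        using ic X by (auto simp: is_chart_def intro: openin_Int_open)
      then have "openin (mtop M) V" using openin_mtop_chart[OF M c(1), of V] by (auto simp: V_def)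
      moreover have "x \<in> V"
      proof -
        have "cmap c x \<in> cmap c ` (W \<inter> (cdom c \<inter> N))" using x xN c by auto
        then show ?thesis using X c by (auto simp: V_def)
      qed
      moreover have "V \<inter> N \<subseteq> W"
      proof
        fix y assume y: "y \<in> V \<inter> N"
        then have "cmap c y \<in> cmap c ` (cdom c \<inter> N)" by (auto simp: V_def)
        then have "cmap c y \<in> F \<inter> X" using c(6) y by (auto simp: V_def)
        then have "cmap c y \<in> cmap c ` (W \<inter> (cdom c \<inter> N))" using X by simp
        then obtain z where "z \<in> W" "z \<in> cdom c" "cmap c z = cmap c y" by auto
        moreover have "inj_on (cmap c) (cdom c)" "y \<in> cdom c" using ic y
          by (auto simp: is_chart_def V_def)
        ultimately show "y \<in> W" by (auto dest: inj_onD)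
      qed
      ultimately show ?thesis by blast
    qed
    then obtain V where V: "openin (mtop M) (V x) \<and> x \<in> V x \<and> V x \<inter> N \<subseteq> W" if "x \<in> W" for x by metis
    then have "openin (mtop M) (\<Union>x\<in>W. V x)" by auto
    moreover have "W = (\<Union>x\<in>W. V x) \<inter> N" using V WN by auto
    ultimately show "\<exists>V. openin (mtop M) V \<and> W = V \<inter> N" by blast
  next
    assume "\<exists>V. openin (mtop M) V \<and> W = V \<inter> N"
    then obtain V where V: "openin (mtop M) V" "W = V \<inter> N" by auto
    have "openin (mtop (sub_mfd M N)) {x \<in> topspace (mtop (sub_mfd M N)). x \<in> V}"
      by (rule openin_continuous_map_preimage[OF cont V(1)])
    moreover have "{x \<in> topspace (mtop (sub_mfd M N)). x \<in> V} = W"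
      using V by (auto simp: topspace_mtop[OF S] sub_mfd_simps)
    ultimately show "openin (mtop (sub_mfd M N)) W" by simp
  qed
  then show ?thesis by (simp add: topology_eq openin_subtopology)
qed

lemma max_charts_restrict:
  assumes M: "atlas_mfd M" and c: "c \<in> charts M" and W: "openin (mtop M) W"
  shows "sub_chart c W (cmodel c) \<in> max_charts M"
proof -
  have ic: "is_chart c" using M c by (auto simp: atlas_mfd_def)
  have cm: "c \<in> max_charts M" using charts_max_charts[OF M c] .
  let ?s = "sub_chart c W (cmodel c)"
  have oW: "openin (mtop M) (cdom c \<inter> W)" using openin_cdom[OF M cm] W by (intro openin_Int)
  then have o: "openin (top_of_set (cmodel c)) (cmap c ` (cdom c \<inter> W))"
    by (subst (asm) openin_mtop_chart[OF M cm]) auto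
  have s: "is_chart ?s" using ic o by (auto simp: is_chart_def intro: inj_on_subset)
  have sc: "chart_smooth ?s c (\<lambda>x. x) (cdom c \<inter> W)"
    using chart_smooth_ident(1)[OF s] by (auto simp: chart_smooth_def)
  have "compatible ?s d \<and> compatible d ?s" if d: "d \<in> charts M" for d
  proof
    have id: "is_chart d" and dm: "d \<in> max_charts M" using M d charts_max_charts[OF M d]
      by (auto simp: atlas_mfd_def)
    have comp: "compatible c d" "compatible d c" using M c d by (auto simp: atlas_mfd_def)
    let ?A = "cdom c \<inter> W \<inter> cdom d"
    have oA: "openin (mtop M) ?A" using openin_Int[OF oW openin_cdom[OF M dm]] .
    then have oc: "openin (top_of_set (cmodel c)) (cmap c ` ?A)" "openin (top_of_set
        (cmodel d)) (cmap d ` ?A)"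
      using openin_mtop_chart[OF M cm, of ?A] openin_mtop_chart[OF M dm, of ?A] by auto
    have "chart_smooth ?s c (\<lambda>x. x) ?A" by (rule chart_smooth_subset[OF sc]) (use oc in auto)
    from chart_smooth_compose(1)[OF s ic this compatible_chart_smooth[OF comp(1)]]
    have "chart_smooth ?s d (\<lambda>x. x) ?A" by auto
    then show "compatible ?s d" by (intro chart_smooth_compatible) simp
    have "chart_smooth d c (\<lambda>x. x) ?A"
      by (rule chart_smooth_subset[OF compatible_chart_smooth[OF comp(2)]]) (use oc in auto)
    then have "chart_smooth d ?s (\<lambda>x. x) ?A" by (rule chart_smooth_sub_chart_target) auto
    then show "compatible d ?s" by (intro chart_smooth_compatible) (simp add: Int_ac)
  qed
  then show ?thesis using s max_chartsD(2)[OF cm] by (auto simp: max_charts_def)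
qed

lemma submanifold_open:
  assumes M: "atlas_mfd M" and W: "openin (mtop M) W"
  shows "submanifold M W"
  unfolding submanifold_def
proof (intro conjI subsetI)
  show WM: "\<And>x. x \<in> W \<Longrightarrow> x \<in> points M" using W openin_subset topspace_mtop[OF M] by blast
  fix x assume x: "x \<in> W"
  note c = chart_at[OF M WM[OF x]]
  \<comment> \<open>Cutting the chart down to \<open>W\<close> beforehand makes the whole model
    space an admissible choice of \<open>F\<close>.\<close>
  let ?s = "sub_chart (chart_at M x) W (cmodel (chart_at M x))"
  have m: "?s \<in> max_charts M" using max_charts_restrict[OF M c(1) W] .
  have "sub_chart ?s W (cmodel (chart_at M x)) \<in> charts (sub_mfd M W)"
    unfolding sub_mfd_simps
    using m is_chart_subspace[OF c(3)] by (intro CollectI exI[of _ ?s] exI[of _ "cmodel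
        (chart_at M x)"]) auto
  moreover have "x \<in> cdom (sub_chart ?s W (cmodel (chart_at M x)))" using x c by simp
  ultimately show "x \<in> (\<Union>c\<in>charts (sub_mfd M W). cdom c)" by blast
qed

text \<open>Local sections of a submersion are smooth on \<open>sub_mfd M W\<close>. Near a point of
  \<open>W\<close> the identity is also smooth from \<open>M\<close> into this submanifold, and
  composing with it removes the restriction.\<close>

lemma smooth_at_open_sub:
  assumes M: "atlas_mfd M" and X: "atlas_mfd X" and W: "openin (mtop M) W" "x \<in> W"
    and s: "smooth_map (sub_mfd M W) X s"
  shows "smooth_at M X s x"
proof -
  note sub = submanifold_open[OF M W(1)]
  note aS = atlas_mfd_sub[OF M sub]
  have x: "x \<in> points M" using W openin_subset topspace_mtop[OF M] by blast
  have "smooth_at M (sub_mfd M W) (\<lambda>x. x) x"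
    by (rule smooth_at_sub_mfd[OF M M sub smooth_at_ident[OF M x] W]) auto
  moreover have "smooth_at (sub_mfd M W) X s x"
    using s W by (simp add: smooth_map_iff[OF aS X] sub_mfd_simps)
  ultimately show ?thesis using smooth_at_compose[OF M aS X, of "\<lambda>x. x" x s] by simp
qed

section \<open>Components of a manifold are open\<close>

lemma convex_connected_lc:
  fixes S :: "'a::lctvs set"
  assumes "convex S"
  shows "connected S"
proof (cases "S = {}")
  case False
  then obtain a where a: "a \<in> S" by auto
  define seg where "seg = (\<lambda>b. (\<lambda>t. a + t *\<^sub>R (b - a)) ` {0..1::real})"
  have eq: "a + t *\<^sub>R (b - a) = (1 - t) *\<^sub>R a + t *\<^sub>R b" for t b by (simp add: algebra_simps)
  have "continuous_on {0..1} (\<lambda>t::real. a + t *\<^sub>R (b - a))" for b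
    unfolding continuous_on_def by (intro ballI tendsto_add tendsto_const
        tendsto_scaleR_lc tendsto_ident_at)
  then have "connected (seg b)" for b
    unfolding seg_def by (intro connected_continuous_image) auto
  moreover have "a \<in> seg b" for b unfolding seg_def by (rule image_eqI[of _ _ 0]) auto
  then have "\<Inter>(seg ` S) \<noteq> {}" by blast
  ultimately have "connected (\<Union>(seg ` S))" by (intro connected_Union) auto
  moreover have "\<Union>(seg ` S) = S"
  proof (intro equalityI subsetI)
    fix y assume "y \<in> \<Union>(seg ` S)"
    then show "y \<in> S" using a assms by (auto simp: seg_def eq intro!: convexD)
  next
    fix y assume y: "y \<in> S"
    have "y \<in> seg y" unfolding seg_def by (rule image_eqI[of _ _ 1]) auto
    with y show "y \<in> \<Union>(seg ` S)" by auto
  qed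
  ultimately show ?thesis by simp
qed simp

text \<open>A convex open set of the model space around the coordinates of \<open>x\<close> meets
  the model subspace in a convex, hence connected set, and the inverse chart is continuous on
  it.\<close>

lemma mfd_connected_neighbourhood:
  assumes M: "atlas_mfd M" and x: "x \<in> points M"
  obtains V where "openin (mtop M) V" "x \<in> V" "connectedin (mtop M) V"
proof -
  let ?c = "chart_at M x"
  note c = chart_at[OF M x]
  obtain X where X: "open X" "cmap ?c ` cdom ?c = cmodel ?c \<inter> X"
    using c(3) by (auto simp: is_chart_def openin_open)
  have "cmap ?c x \<in> cmap ?c ` cdom ?c" using c(2) by (rule imageI)
  then have xX: "cmap ?c x \<in> X" "cmap ?c x \<in> cmodel ?c" by (simp_all add: X(2))
  obtain B where B: "open B" "convex B" "cmap ?c x \<in> B" "B \<subseteq> X"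
    using locally_convex[OF X(1) xX(1)] by auto
  define D where "D = cmodel ?c \<inter> B"
  have DS: "D \<subseteq> cmap ?c ` cdom ?c" using X B by (auto simp: D_def)
  have "convex D" unfolding D_def
    by (intro convex_Int B subspace_imp_convex is_chart_subspace c)
  then have "connectedin (top_of_set (cmap ?c ` cdom ?c)) D"
    using DS by (simp add: connectedin_subtopology convex_connected_lc)
  moreover have "continuous_map (top_of_set (cmap ?c ` cdom ?c)) (mtop M) (cinv ?c)"
    unfolding continuous_map_def
  proof (intro conjI allI impI)
    show "cinv ?c \<in> topspace (top_of_set (cmap ?c ` cdom ?c)) \<rightarrow> topspace (mtop M)"
      using max_chartsD(2)[OF c(4)] by (auto simp: topspace_mtop[OF M] cinv_cmap[OF c(3)])
    fix U assume U: "openin (mtop M) U"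
    have "openin (mtop M) (U \<inter> cdom ?c)" using U openin_cdom[OF M c(4)] by (intro openin_Int)
    then have "openin (top_of_set (cmodel ?c)) (cmap ?c ` (U \<inter> cdom ?c))"
      by (subst (asm) openin_mtop_chart[OF M c(4)]) auto
    then have "openin (top_of_set (cmap ?c ` cdom ?c)) (cmap ?c ` (U \<inter> cdom ?c))"
      by (rule openin_subset_trans) (use is_chart_subspace[OF c(3)] in auto)
    moreover have "cmap ?c ` (U \<inter> cdom ?c) = {y \<in> topspace (top_of_set (cmap ?c ` cdom
        ?c)). cinv ?c y \<in> U}"
      by (auto simp: cinv_cmap[OF c(3)])
    ultimately show "openin (top_of_set (cmap ?c ` cdom ?c)) {y \<in> topspace (top_of_set (cmap ?c `
        cdom ?c)). cinv ?c y \<in> U}"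
      by simp
  qed
  ultimately have con: "connectedin (mtop M) (cinv ?c ` D)"
    by (rule connectedin_continuous_map_image[rotated])
  have sub: "cinv ?c ` D \<subseteq> cdom ?c" using DS by (auto simp: cinv_cmap[OF c(3)] subset_iff)
  have im: "cmap ?c ` cinv ?c ` D = D"
  proof -
    have "cmap ?c (cinv ?c y) = y" if "y \<in> D" for y
      using that DS by (auto simp: cinv_cmap[OF c(3)] subset_iff)
    then show ?thesis by (simp add: image_image)
  qed
  have "openin (mtop M) (cinv ?c ` D)"
    unfolding openin_mtop_chart[OF M c(4) sub] im unfolding D_def by (rule openin_open_Int[OF B(1)])
  moreover have "x \<in> cinv ?c ` D"
    using c(2,3) B(3) xX by (intro image_eqI[of _ _ "cmap ?c x"]) (simp_all add: cinv_cmap D_def)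
  ultimately show thesis using con that by blast
qed

lemma openin_connected_component_mfd:
  assumes M: "atlas_mfd M" and C: "C \<in> connected_components_of (mtop M)"
  shows "openin (mtop M) C"
proof (subst openin_subopen, intro ballI)
  fix x assume x: "x \<in> C"
  then have "x \<in> points M"
    using connected_components_of_subset[OF C] topspace_mtop[OF M] by auto
  then obtain V where V: "openin (mtop M) V" "x \<in> V" "connectedin (mtop M) V"
    using mfd_connected_neighbourhood[OF M] by blast
  then have "V \<subseteq> C" using connected_components_of_maximal[OF C V(3)] x by (auto simp: disjnt_iff)
  then show "\<exists>T. openin (mtop M) T \<and> x \<in> T \<and> T \<subseteq> C" using V by blast
qed


section \<open>Transport of a symplectic structure\<close>

text \<open>Forms are tested in arbitrary charts through \<open>from_chart\<close>, tangent maps in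
  the charts of \<open>chart_at\<close>. The first part changes the chart in the source, the second
  one in the target; both are the chain rule for a map composed with an identity.\<close>

lemma tangent_map_from_chart:
  assumes M: "atlas_mfd M" and N: "atlas_mfd N" and f: "smooth_at M N f x"
    and c: "c \<in> max_charts M" "x \<in> cdom c" and u: "u \<in> cmodel c"
  shows "tangent_map M N f x (from_chart M c x u) = chart_deriv c (chart_at N (f x)) f x u"
    and "d \<in> max_charts N \<Longrightarrow> f x \<in> cdom d \<Longrightarrow>
      chart_deriv c (chart_at N (f x)) f x u = from_chart N d (f x) (chart_deriv c d f x u)"
proof -
  have pts: "x \<in> points M" "f x \<in> points N" using smooth_at_points(1)[OF M f]
      smooth_at_points(2)[OF N f] by auto
  note a = chart_at[OF M pts(1)] and b = chart_at[OF N pts(2)]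
  note ic = max_chartsD(1)[OF c(1)]
  obtain W where W: "x \<in> W" "openin (mtop M) W" "chart_smooth (chart_at M x) (chart_at N (f x)) f W"
    using smooth_at_charts[OF M N f a(4,2) b(4,2)] .
  have s: "chart_smooth c (chart_at M x) (\<lambda>x. x) (cdom c \<inter> cdom (chart_at M x))"
    by (rule compatible_chart_smooth[OF max_charts_compatible[OF M c(1) a(4)]])
  note V = chart_smooth_Int_vimage[OF ic a(3) s W(3)]
  show "tangent_map M N f x (from_chart M c x u) = chart_deriv c (chart_at N (f x)) f x u"
    unfolding tangent_map_chart_deriv from_chart_chart_deriv
    by (rule chart_deriv_compose[OF ic a(3) V W(3), symmetric]) (use W c a u in auto)
  assume d: "d \<in> max_charts N" "f x \<in> cdom d"
  obtain W' where W': "x \<in> W'" "openin (mtop M) W'" "chart_smooth c d f W'"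
    using smooth_at_charts[OF M N f c d] .
  have s': "chart_smooth d (chart_at N (f x)) (\<lambda>x. x) (cdom d \<inter> cdom (chart_at N (f x)))"
    by (rule compatible_chart_smooth[OF max_charts_compatible[OF N d(1) b(4)]])
  note V' = chart_smooth_Int_vimage[OF ic max_chartsD(1)[OF d(1)] W'(3) s']
  show "chart_deriv c (chart_at N (f x)) f x u = from_chart N d (f x) (chart_deriv c d f x u)"
    unfolding from_chart_chart_deriv
    by (rule chart_deriv_compose[OF ic max_chartsD(1)[OF d(1)] V' s']) (use W' d b u in auto)
qed

text \<open>The target of \<open>f\<close> may be a bare set: its charts, and through them its
  topology, are copied from \<open>C\<close>. Below, \<open>f\<close> is the descended momentum map
  and the target consists of functionals.\<close>

definition transport_chart :: "('a, 'e) chart \<Rightarrow> 'a set \<Rightarrow> ('a \<Rightarrow> 'b) \<Rightarrow> ('b, 'e) chart" where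
  "transport_chart c C f = \<lparr>cdom = f ` (cdom c \<inter> C), cmap
      = cmap c \<circ> inv_into C f, cmodel = cmodel c\<rparr>"

definition transport_mfd :: "('a, 'e) mfd \<Rightarrow> 'a set \<Rightarrow> ('a \<Rightarrow> 'b) \<Rightarrow> ('b, 'e) mfd" where
  "transport_mfd Q C f = \<lparr>points = f ` C, charts = (\<lambda>c. transport_chart c C f) ` charts Q\<rparr>"

lemma transport_simps [simp]:
  "cdom (transport_chart c C f) = f ` (cdom c \<inter> C)"
  "cmap (transport_chart c C f) = cmap c \<circ> inv_into C f"
  "cmodel (transport_chart c C f) = cmodel c"
  "points (transport_mfd Q C f) = f ` C"
  "charts (transport_mfd Q C f) = (\<lambda>c. transport_chart c C f) ` charts Q"
  by (simp_all add: transport_chart_def transport_mfd_def)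

context
  fixes Q :: "('a, 'e::lctvs) mfd" and C :: "'a set" and f :: "'a \<Rightarrow> 'b"
  assumes Q: "atlas_mfd Q" and C: "openin (mtop Q) C" and f: "inj_on f C"
begin

private abbreviation (input) "Orb \<equiv> transport_mfd Q C f"
private abbreviation (input) "finv \<equiv> inv_into C f"

lemma transport_subset: "C \<subseteq> points Q"
  using C openin_subset topspace_mtop[OF Q] by blast

lemma transport_open_image:
  assumes "c \<in> charts Q"
  shows "openin (top_of_set (cmodel c)) (cmap c ` (cdom c \<inter> C))"
proof -
  have c: "c \<in> max_charts Q" using charts_max_charts[OF Q assms] .
  have "openin (mtop Q) (cdom c \<inter> C)" using openin_cdom[OF Q c] C by (rule openin_Int)
  then show ?thesis using openin_mtop_chart[OF Q c, of "cdom c \<inter> C"] by simp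
qed

lemma transport_cmap_image:
  "A \<subseteq> C \<Longrightarrow> cmap (transport_chart c C f) ` f ` A = cmap c ` A"
  using f by (force simp: image_comp intro!: image_cong)

lemma transport_is_chart:
  assumes c: "c \<in> charts Q"
  shows "is_chart (transport_chart c C f)"
proof -
  have ic: "is_chart c" using Q c by (simp add: atlas_mfd_def)
  have "inj_on (cmap c \<circ> finv) (f ` (cdom c \<inter> C))"
  proof (rule comp_inj_on)
    show "inj_on finv (f ` (cdom c \<inter> C))" by (rule inj_on_inv_into) auto
    have "finv ` f ` (cdom c \<inter> C) = cdom c \<inter> C" using f by (auto simp: image_image)
    then show "inj_on (cmap c) (finv ` f ` (cdom c \<inter> C))"
      using ic by (auto simp: is_chart_def intro: inj_on_subset)
  qed
  then show ?thesis
    using ic transport_open_image[OF c] transport_cmap_image[of "cdom c \<inter> C" c]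
    by (simp add: is_chart_def)
qed

text \<open>In corresponding charts both \<open>f\<close> and its inverse have the identity of the
  model space as coordinate expression.\<close>

lemma transport_chart_smooth:
  assumes c: "c \<in> charts Q"
  shows "chart_smooth (transport_chart c C f) c finv (cdom (transport_chart c C f))" "chart_smooth
      c (transport_chart c C f) f (cdom c \<inter> C)"
    "\<nu> \<in> cdom (transport_chart c C f) \<Longrightarrow> u \<in> cmodel c
        \<Longrightarrow> chart_deriv (transport_chart c C f) c finv \<nu> u = u"
proof -
  have ic: "is_chart c" using Q c by (simp add: atlas_mfd_def)
  note iT = transport_is_chart[OF c]
  have im: "cmap (transport_chart c C f) ` cdom (transport_chart c C f) = cmap c ` (cdom c \<inter> C)"
    using transport_cmap_image[of "cdom c \<inter> C" c] by simp
  note o = transport_open_image[OF c] and F = is_chart_subspace(1)[OF ic]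
  have 1: "y = (cmap c \<circ> finv \<circ> cinv (transport_chart c C f)) y"
      if y: "y \<in> cmap c ` (cdom c \<inter> C)" for y
  proof -
    obtain x where x: "x \<in> cdom c \<inter> C" "y = cmap c x" using y by auto
    have "cmap (transport_chart c C f) (f x) = y" using x f by simp
    moreover have "cinv (transport_chart c C f) (cmap (transport_chart c C f) (f x)) = f x"
      using x by (intro cinv_cmap iT) auto
    ultimately show ?thesis using x f by simp
  qed
  have 2: "y = (cmap (transport_chart c C f) \<circ> f \<circ> cinv c) y" if "y \<in> cmap c ` (cdom c \<inter> C)" for y
    using that f by (auto simp: cinv_cmap[OF ic])
  have gi: "finv ` cdom (transport_chart c C f) \<subseteq> cdom c" using f by auto
  have b1: "bastiani_smooth (cmodel c) (cmap c ` (cdom c \<inter> C)) (cmap c \<circ> finv \<circ> cinv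
      (transport_chart c C f))"
    by (rule bastiani_smooth_cong[OF o F 1 bastiani_smooth_ident])
  have b2: "bastiani_smooth (cmodel c) (cmap c ` (cdom c \<inter> C)) (cmap (transport_chart
      c C f) \<circ> f \<circ> cinv c)"
    by (rule bastiani_smooth_cong[OF o F 2 bastiani_smooth_ident])
  show "chart_smooth (transport_chart c C f) c finv (cdom (transport_chart c C f))"
    unfolding chart_smooth_def im using gi o b1 by (simp only: transport_simps) auto
  show "chart_smooth c (transport_chart c C f) f (cdom c \<inter> C)"
    unfolding chart_smooth_def using o b2 by (simp only: transport_simps) auto
  assume \<nu>: "\<nu> \<in> cdom (transport_chart c C f)" and u: "u \<in> cmodel c"
  have "cmap (transport_chart c C f) \<nu> \<in> cmap c ` (cdom c \<inter> C)" using \<nu> im by blast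
  then have "dir_deriv (\<lambda>y. y) (cmap (transport_chart c C f) \<nu>) u
      = dir_deriv (cmap c \<circ> finv \<circ> cinv (transport_chart c C f)) (cmap (transport_chart c C f) \<nu>) u"
    by (rule dir_deriv_cong[OF o F _ u 1])
  then show "chart_deriv (transport_chart c C f) c finv \<nu> u = u"
    unfolding chart_deriv_def using dir_deriv_linear(1)[OF linear_ident, of "cmap
        (transport_chart c C f) \<nu>" u] by simp
qed

lemma atlas_mfd_transport: "atlas_mfd Orb"
  unfolding atlas_mfd_def
proof (intro conjI ballI)
  show "points Orb = (\<Union>c\<in>charts Orb. cdom c)"
  proof -
    have "C \<subseteq> (\<Union>c\<in>charts Q. cdom c)" using transport_subset Q by (simp add: atlas_mfd_def)
    then have "f ` C = (\<Union>c\<in>charts Q. f ` (cdom c \<inter> C))" by blast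
    then show ?thesis by simp
  qed
  fix D assume "D \<in> charts Orb"
  then obtain c where c: "D = (transport_chart c C f)" "c \<in> charts Q" by auto
  then show D: "is_chart D" using transport_is_chart by simp
  fix D' assume "D' \<in> charts Orb"
  then obtain c' where c': "D' = (transport_chart c' C f)" "c' \<in> charts Q" by auto
  have ic: "is_chart c" "is_chart c'" "compatible c c'" using Q c c' by (auto simp: atlas_mfd_def)
  let ?A = "f ` (cdom c \<inter> cdom c' \<inter> C)"
  have A: "?A = cdom D \<inter> cdom D'" using f by (auto simp: c c' dest: inj_onD)
  have "openin (mtop Q) (cdom c \<inter> cdom c' \<inter> C)"
    using openin_cdom[OF Q charts_max_charts[OF Q c(2)]] openin_cdom[OF Q
        charts_max_charts[OF Q c'(2)]] C
    by (intro openin_Int) auto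
  then have "openin (top_of_set (cmodel c)) (cmap c ` (cdom c \<inter> cdom c' \<inter> C))"
    by (subst (asm) openin_mtop_chart[OF Q charts_max_charts[OF Q c(2)]]) auto
  then have o: "openin (top_of_set (cmodel D)) (cmap D ` ?A)"
    using transport_cmap_image[of "cdom c \<inter> cdom c' \<inter> C" c] c by simp
  have 1: "chart_smooth D c finv ?A"
    by (rule chart_smooth_subset[OF transport_chart_smooth(1)[OF c(2), folded
        c(1)] _ o]) (auto simp: c)
  have 2: "chart_smooth D c' finv ?A"
    using chart_smooth_compose(1)[OF D ic(1) 1 compatible_chart_smooth[OF ic(3)]] f by auto
  have "chart_smooth D D' (\<lambda>y. f (finv y)) ?A"
    using chart_smooth_compose(1)[OF D ic(2) 2 transport_chart_smooth(2)[OF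
        c'(2)]] f by (auto simp: c')
  then have "chart_smooth D D' (\<lambda>y. y) ?A"
    by (rule chart_smooth_cong[OF D]) (use f in auto)
  then show "compatible D D'" unfolding A by (rule chart_smooth_compatible)
qed

lemma smooth_at_transport: "x \<in> C \<Longrightarrow> smooth_at Q Orb f x"
proof -
  assume x: "x \<in> C"
  then obtain c where c: "c \<in> charts Q" "x \<in> cdom c" using transport_subset Q
    by (auto simp: atlas_mfd_def)
  then show ?thesis
    unfolding smooth_at_def transport_simps
    using x transport_chart_smooth(2)[OF c(1)]
    by (intro bexI[of _ c] bexI[of _ "(transport_chart c C f)"] exI[of _ "cdom c \<inter> C"]) auto
qed

lemma smooth_at_transport_inv: "y \<in> f ` C \<Longrightarrow> smooth_at Orb Q finv y"
proof -
  assume "y \<in> f ` C"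
  then obtain x where x: "x \<in> C" "y = f x" by auto
  then obtain c where c: "c \<in> charts Q" "x \<in> cdom c" using transport_subset Q
    by (auto simp: atlas_mfd_def)
  have "y \<in> cdom (transport_chart c C f)" "(transport_chart c C f) \<in> charts Orb" using c x by auto
  then show ?thesis
    using transport_chart_smooth(1)[OF c(1)] c(1) unfolding smooth_at_def by blast
qed

lemma smooth_map_transport_inv: "smooth_map Orb Q finv"
  using smooth_at_transport_inv by (simp add: smooth_map_iff[OF atlas_mfd_transport Q])

text \<open>The inverse of \<open>f\<close> is continuous and injective, so disjoint neighbourhoods
  in \<open>Q\<close> pull back to disjoint neighbourhoods.\<close>

lemma manifold_transport:
  assumes "manifold Q"
  shows "manifold Orb"
proof -
  have cont: "continuous_map (mtop Orb) (mtop Q) finv"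
    using smooth_map_transport_inv by (simp add: smooth_map_def)
  have top: "topspace (mtop Orb) = f ` C" using topspace_mtop[OF atlas_mfd_transport] by simp
  have "Hausdorff_space (mtop Orb)"
    unfolding Hausdorff_space_def
  proof (intro allI impI)
    fix x y assume xy: "x \<in> topspace (mtop Orb) \<and> y \<in> topspace (mtop Orb) \<and> x \<noteq> y"
    then have "finv x \<noteq> finv y" "finv x \<in> topspace (mtop Q)" "finv y \<in> topspace (mtop Q)"
      using transport_subset f by (auto simp: top topspace_mtop[OF Q] inj_on_def)
    moreover have "Hausdorff_space (mtop Q)" using assms by (simp add: manifold_def)
    ultimately obtain U V where UV: "openin (mtop Q) U" "openin (mtop Q) V" "finv x \<in> U"
        "finv y \<in> V" "disjnt U V"
      unfolding Hausdorff_space_def by blast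
    let ?p = "\<lambda>U. {z \<in> topspace (mtop Orb). finv z \<in> U}"
    show "\<exists>U V. openin (mtop Orb) U \<and> openin (mtop Orb) V \<and> x \<in> U \<and> y \<in> V \<and> disjnt U V"
      using openin_continuous_map_preimage[OF cont] UV xy
      by (intro exI[of _ "?p U"] exI[of _ "?p V"]) (auto simp: disjnt_iff)
  qed
  then show ?thesis using atlas_mfd_transport by (simp add: manifold_def atlas_mfd_def)
qed

lemma tangent_map_transport:
  "x \<in> C \<Longrightarrow> v \<in> tangent_space Q x \<Longrightarrow> tangent_map Orb Q finv (f x) (tangent_map Q Orb f x v) = v"
  "y \<in> f ` C \<Longrightarrow> u \<in> tangent_space Orb y \<Longrightarrow> tangent_map Q Orb f (finv y)
      (tangent_map Orb Q finv y u) = u"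
proof -
  note A = atlas_mfd_transport
  show "tangent_map Orb Q finv (f x) (tangent_map Q Orb f x v) = v" if x: "x \<in> C"
      and v: "v \<in> tangent_space Q x"
  proof -
    have "tangent_map Orb Q finv (f x) (tangent_map Q Orb f x v)
        = tangent_map Q Q (\<lambda>x. finv (f x)) x v"
      using x by (intro tangent_map_compose[OF Q A Q _ _ v, symmetric] smooth_at_transport
          smooth_at_transport_inv) auto
    also have "\<dots> = tangent_map Q Q (\<lambda>x. x) x v"
      by (rule tangent_map_cong[OF Q C x _ v]) (use f in auto)
    also have "\<dots> = v" using x transport_subset by (intro tangent_map_ident[OF Q _ v]) auto
    finally show ?thesis .
  qed
  show "tangent_map Q Orb f (finv y) (tangent_map Orb Q finv y u) = u" if y: "y \<in> f ` C"
      and u: "u \<in> tangent_space Orb y"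
  proof -
    have "tangent_map Q Orb f (finv y) (tangent_map Orb Q finv y u)
        = tangent_map Orb Orb (\<lambda>y. f (finv y)) y u"
      using y f by (intro tangent_map_compose[OF A Q A _ _ u, symmetric] smooth_at_transport
          smooth_at_transport_inv) auto
    also have "\<dots> = tangent_map Orb Orb (\<lambda>y. y) y u"
      using y openin_topspace[of "mtop Orb"] topspace_mtop[OF A]
      by (intro tangent_map_cong[OF A, where V = "f ` C"] u) (auto simp: f_inv_into_f)
    also have "\<dots> = u" using y by (intro tangent_map_ident[OF A _ u]) auto
    finally show ?thesis .
  qed
qed

text \<open>Since the coordinate expression of the inverse is the identity, the pulled back form has
  literally the same coordinates as \<omega>. Smoothness and closedness then transfer by congruence,
  with no formula for the exterior derivative of a pullback.\<close>

lemma transport_form_in_chart: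
  assumes c: "c \<in> charts Q" and z: "z \<in> cmap c ` (cdom c \<inter> C)" and u: "u \<in> cmodel c"
      and v: "v \<in> cmodel c"
  shows "form_in_chart Orb (pullback Orb Q finv \<omega>) (transport_chart c C f) z u v
      = form_in_chart Q \<omega> c z u v"
proof -
  note A = atlas_mfd_transport
  have ic: "is_chart c" using Q c by (simp add: atlas_mfd_def)
  have Tm: "(transport_chart c C f) \<in> max_charts Orb" using charts_max_charts[OF A] c by auto
  obtain x where x: "x \<in> cdom c" "x \<in> C" "z = cmap c x" using z by auto
  have cx: "cinv c z = x" using x cinv_cmap[OF ic] by simp
  have "cmap (transport_chart c C f) (f x) = z" using x f by simp
  moreover have "cinv (transport_chart c C f) (cmap (transport_chart c C f) (f x)) = f x" using x
    by (intro cinv_cmap transport_is_chart c) auto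
  ultimately have cT: "cinv (transport_chart c C f) z = f x" by simp
  have gfx: "finv (f x) = x" using x f by simp
  have fx: "f x \<in> cdom (transport_chart c C f)" using x by auto
  have *: "tangent_map Orb Q finv (f x) (from_chart Orb (transport_chart c C f) (f x) u)
      = from_chart Q c x u" if u: "u \<in> cmodel c" for u
  proof -
    have s: "smooth_at Orb Q finv (f x)" using x by (intro smooth_at_transport_inv) auto
    have uT: "u \<in> cmodel (transport_chart c C f)" using u by simp
    have "tangent_map Orb Q finv (f x) (from_chart Orb (transport_chart c C f) (f x) u)
        = from_chart Q c (finv (f x)) (chart_deriv (transport_chart c C f) c finv (f x) u)"
      using tangent_map_from_chart[OF A Q s Tm fx uT] charts_max_charts[OF Q c] x(1) gfx by auto
    then show ?thesis using transport_chart_smooth(3)[OF c fx u] gfx by simp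
  qed
  show ?thesis
    unfolding form_in_chart_def pullback_def cT cx gfx *[OF u] *[OF v] ..
qed

lemma symplectic_manifold_transport:
  assumes \<omega>: "symplectic_manifold Q \<omega>"
  shows "symplectic_manifold Orb (pullback Orb Q finv \<omega>)"
proof -
  note A = atlas_mfd_transport
  note gs = smooth_at_transport_inv
  note wd = \<omega>[unfolded symplectic_manifold_def smooth_form2_def]
  have gy: "finv y \<in> points Q" "finv y \<in> C" if "y \<in> f ` C" for y
    using that transport_subset f by auto
  have mem: "tangent_map Orb Q finv y u \<in> tangent_space Q (finv y)"
      if "y \<in> f ` C" "u \<in> tangent_space Orb y" for y u
    using that by (intro tangent_map_mem[OF A Q gs]) auto
  have im: "cmap (transport_chart c C f) ` cdom (transport_chart c C f)
      = cmap c ` (cdom c \<inter> C)" for c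
    using transport_cmap_image[of "cdom c \<inter> C" c] by simp
  show ?thesis
    unfolding symplectic_manifold_def smooth_form2_def
  proof (intro conjI ballI)
    show "manifold Orb" using wd manifold_transport by blast
    fix y u assume y: "y \<in> points Orb" and u: "u \<in> tangent_space Orb y"
    have yC: "y \<in> f ` C" using y by simp
    have lin: "linear_form_on (tangent_space Q (finv y)) (\<omega> (finv y) (tangent_map Orb Q finv y u))"
      using wd gy(1)[OF yC] mem[OF yC u] by blast
    show "linear_form_on (tangent_space Orb y) (pullback Orb Q finv \<omega> y u)"
      unfolding linear_form_on_def pullback_def
    proof (intro conjI ballI allI)
      fix v w r assume v: "v \<in> tangent_space Orb y"
      show "\<omega> (finv y) (tangent_map Orb Q finv y u) (tangent_map Orb Q finv y (r *\<^sub>R v)) =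
          r * \<omega> (finv y) (tangent_map Orb Q finv y u) (tangent_map Orb Q finv y v)"
        using lin mem[OF yC v] by (simp add: tangent_map_scale[OF A Q gs[OF yC] v
            v] linear_form_on_def)
      assume w: "w \<in> tangent_space Orb y"
      show "\<omega> (finv y) (tangent_map Orb Q finv y u) (tangent_map Orb Q finv y (v + w)) =
          \<omega> (finv y) (tangent_map Orb Q finv y u) (tangent_map Orb Q finv y v)
              + \<omega> (finv y) (tangent_map Orb Q finv y u) (tangent_map Orb Q finv y w)"
        using lin mem[OF yC v] mem[OF yC w] by (simp add: tangent_map_add[OF A Q gs[OF yC] v
            w] linear_form_on_def)
    qed
    fix v assume v: "v \<in> tangent_space Orb y"
    show "pullback Orb Q finv \<omega> y u v = - pullback Orb Q finv \<omega> y v u"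
      unfolding pullback_def using wd gy(1)[OF yC] mem[OF yC u] mem[OF yC v] by blast
  next
    fix D assume "D \<in> charts Orb"
    then obtain c where c: "D = (transport_chart c C f)" "c \<in> charts Q" by auto
    have F: "subspace (cmodel c)" using Q c by (simp add: atlas_mfd_def is_chart_subspace)
    note o = transport_open_image[OF c(2)]
    let ?F3 = "cmodel c \<times> cmodel c \<times> cmodel c"
        and ?U3 = "cmap c ` (cdom c \<inter> C) \<times> cmodel c \<times> cmodel c"
    have "bastiani_smooth ?F3 ?U3 (\<lambda>(y, u, v). form_in_chart Orb (pullback Orb Q finv \<omega>)
        (transport_chart c C f) y u v)"
    proof (rule bastiani_smooth_cong)
      show "openin (top_of_set ?F3) ?U3" using o by (intro openin_Times) auto
      show "subspace ?F3" using F by (intro subspace_Times)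
      have "bastiani_smooth ?F3 (cmap c ` cdom c \<times> cmodel c \<times> cmodel c) (\<lambda>(y, u, v).
          form_in_chart Q \<omega> c y u v)"
        using wd c by blast
      then show "bastiani_smooth ?F3 ?U3 (\<lambda>(y, u, v). form_in_chart Q \<omega> c y u v)"
        by (rule bastiani_smooth_subset) auto
    qed (auto simp: transport_form_in_chart[OF c(2)])
    then show "bastiani_smooth (cmodel D \<times> cmodel D \<times> cmodel D) (cmap D ` cdom D
        \<times> cmodel D \<times> cmodel D)
        (\<lambda>(y, u, v). form_in_chart Orb (pullback Orb Q finv \<omega>) D y u v)"
      unfolding c(1) im by simp
  next
    show "closed_form2 Orb (pullback Orb Q finv \<omega>)"
      unfolding closed_form2_def
    proof (intro ballI)
      fix D y u v w assume "D \<in> charts Orb"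
      then obtain c where c: "D = (transport_chart c C f)" "c \<in> charts Q" by auto
      assume "y \<in> cmap D ` cdom D" "u \<in> cmodel D" "v \<in> cmodel D" "w \<in> cmodel D"
      then have y: "y \<in> cmap c ` (cdom c \<inter> C)" and uvw: "u \<in> cmodel c" "v \<in> cmodel c" "w \<in> cmodel c"
        unfolding c(1) im by simp_all
      have F: "subspace (cmodel c)" using Q c by (simp add: atlas_mfd_def is_chart_subspace)
      have d: "dir_deriv (\<lambda>z. form_in_chart Orb (pullback Orb Q finv \<omega>) D z v w) y u =
          dir_deriv (\<lambda>z. form_in_chart Q \<omega> c z v w) y u"
        if "u \<in> cmodel c" "v \<in> cmodel c" "w \<in> cmodel c" for u v w
        unfolding c(1)
        by (rule dir_deriv_cong[OF transport_open_image[OF c(2)] F y that(1)])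
           (rule transport_form_in_chart[OF c(2) _ that(2,3)])
      have "y \<in> cmap c ` cdom c" using y by blast
      then show "dir_deriv (\<lambda>z. form_in_chart Orb (pullback Orb Q finv \<omega>) D z v w) y u +
          dir_deriv (\<lambda>z. form_in_chart Orb (pullback Orb Q finv \<omega>) D z w u) y v +
          dir_deriv (\<lambda>z. form_in_chart Orb (pullback Orb Q finv \<omega>) D z u v) y w = 0"
        using wd c(2) uvw unfolding closed_form2_def d[OF uvw] d[OF uvw(2,3,1)]
            d[OF uvw(3,1,2)] by blast
    qed
    show "weakly_nondegenerate Orb (pullback Orb Q finv \<omega>)"
      unfolding weakly_nondegenerate_def
    proof (intro ballI impI)
      fix y u assume y: "y \<in> points Orb" and u: "u \<in> tangent_space Orb y"
        and zero: "\<forall>v\<in>tangent_space Orb y. pullback Orb Q finv \<omega> y u v = 0"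
      have yC: "y \<in> f ` C" using y by simp
      have "\<omega> (finv y) (tangent_map Orb Q finv y u) w = 0"
          if w: "w \<in> tangent_space Q (finv y)" for w
      proof -
        have fy: "f (finv y) = y" using yC by (simp add: f_inv_into_f)
        have "tangent_map Q Orb f (finv y) w \<in> tangent_space Orb (f (finv y))"
          by (rule tangent_map_mem[OF Q A smooth_at_transport w]) (use gy[OF yC] in simp)
        then have "pullback Orb Q finv \<omega> y u (tangent_map Q Orb f (finv y) w) = 0"
          using zero unfolding fy by blast
        moreover have "tangent_map Orb Q finv y (tangent_map Q Orb f (finv y) w) = w"
          using tangent_map_transport(1)[OF gy(2)[OF yC] w] unfolding fy .
        ultimately show ?thesis by (simp only: pullback_def)
      qed
      then have z: "tangent_map Orb Q finv y u = 0"
        using \<omega> gy(1)[OF yC] mem[OF yC u]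
        unfolding symplectic_manifold_def weakly_nondegenerate_def by blast
      \<comment> \<open>The derivative of \<open>f\<close> sends 0 to 0 by homogeneity, and it
        recovers \<open>u\<close> from the image of \<open>u\<close> under the derivative of the
        inverse, which is 0.\<close>
      have "0 \<in> tangent_space Q (finv y)" using mem[OF yC u] z by simp
      then have "tangent_map Q Orb f (finv y) (0 *\<^sub>R 0) = 0 *\<^sub>R tangent_map Q Orb f (finv y) 0"
        using gy[OF yC] by (intro tangent_map_scale[OF Q A smooth_at_transport]) auto
      then show "u = 0" using tangent_map_transport(2)[OF yC u] z by simp
    qed
  qed
qed

lemma symplectic_diffeo_transport:
  "symplectic_diffeo (sub_mfd Q C) (pullback (sub_mfd Q C) Q (\<lambda>x. x) \<omega>) Orb
      (pullback Orb Q finv \<omega>) f"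
proof -
  note A = atlas_mfd_transport
  note sC = submanifold_open[OF Q C]
  note S = atlas_mfd_sub[OF Q sC]
  let ?S = "sub_mfd Q C"
  have pts: "points ?S = C" by (simp add: sub_mfd_simps)
  have inc: "smooth_at ?S Q (\<lambda>x. x) x" if "x \<in> C" for x by (rule smooth_at_inclusion[OF Q sC that])
  have fs: "smooth_at ?S Orb f x" if "x \<in> C" for x
    using smooth_at_compose[OF S Q A inc[OF that] smooth_at_transport[OF that]] .
  have smf: "smooth_map ?S Orb f" using fs by (simp add: smooth_map_iff[OF S A] pts)
  have "smooth_at Orb ?S finv y" if y: "y \<in> f ` C" for y
  proof (rule smooth_at_sub_mfd[OF A Q sC smooth_at_transport_inv[OF y]])
    show "openin (mtop Orb) (f ` C)" using openin_topspace[of "mtop Orb"]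
        topspace_mtop[OF A] by simp
  qed (use y f in auto)
  then have smg: "smooth_map Orb ?S (inv_into (points ?S) f)"
    by (simp add: smooth_map_iff[OF A S] pts)
  have eq: "pullback ?S Orb f (pullback Orb Q finv \<omega>) x u v = pullback ?S Q (\<lambda>x. x) \<omega> x u v"
    if x: "x \<in> C" and u: "u \<in> tangent_space ?S x" and v: "v \<in> tangent_space ?S x" for x u v
  proof -
    have "tangent_map Orb Q finv (f x) (tangent_map ?S Orb f x u) = tangent_map ?S Q (\<lambda>x. x) x u"
      if u: "u \<in> tangent_space ?S x" for u
    proof -
      have "tangent_map Orb Q finv (f x) (tangent_map ?S Orb f x u)
          = tangent_map ?S Q (\<lambda>x. finv (f x)) x u"
        using x by (intro tangent_map_compose[OF S A Q fs _ u, symmetric]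
            smooth_at_transport_inv) auto
      also have "\<dots> = tangent_map ?S Q (\<lambda>x. x) x u"
        using x f openin_topspace[of "mtop ?S"] topspace_mtop[OF S]
        by (intro tangent_map_cong[OF S, where V = C] u) (auto simp: pts)
      finally show ?thesis .
    qed
    then show ?thesis using u v x f by (simp add: pullback_def)
  qed
  show ?thesis
    unfolding symplectic_diffeo_def diffeomorphism_def symplectic_map_def form2_eq_def
  proof (intro conjI ballI)
    show "bij_betw f (points ?S) (points Orb)" using f by (simp add: pts bij_betw_def)
  next
    fix x u v assume "x \<in> points ?S" "u \<in> tangent_space ?S x" "v \<in> tangent_space ?S x"
    then show "pullback ?S Orb f (pullback Orb Q finv \<omega>) x u v = pullback ?S Q (\<lambda>x. x) \<omega> x u v"
      unfolding pts by (rule eq)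
  qed (rule smf smg)+
qed

end


section \<open>The adjoint action and the Lie bracket\<close>

lemma openin_points: "atlas_mfd M \<Longrightarrow> openin (mtop M) (points M)"
  using openin_topspace[of "mtop M"] topspace_mtop[of M] by simp

lemma chart_deriv_Pair:
  assumes a: "is_chart a" and f: "chart_smooth a b f A" and g: "chart_smooth a b' g A"
    and x: "x \<in> A" and v: "v \<in> cmodel a"
  shows "chart_deriv a (prod_chart b b') (\<lambda>x. (f x, g x)) x v
      = (chart_deriv a b f x v, chart_deriv a b' g x v)"
proof -
  let ?f = "cmap b \<circ> f \<circ> cinv a" and ?g = "cmap b' \<circ> g \<circ> cinv a"
  have "iter_deriv (\<lambda>y. (?f y, ?g y)) [v] (cmap a x)
      = (iter_deriv ?f [v] (cmap a x), iter_deriv ?g [v] (cmap a x))"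
  proof (rule iter_deriv_Pair)
    show "bastiani_smooth (cmodel a) (cmap a ` A) ?f" "openin (top_of_set (cmodel a)) (cmap a ` A)"
      using f by (simp_all add: chart_smooth_def)
    show "bastiani_smooth (cmodel a) (cmap a ` A) ?g" using g by (simp add: chart_smooth_def)
  qed (use x v a in \<open>auto simp: is_chart_subspace\<close>)
  moreover have "(\<lambda>y. (?f y, ?g y)) = cmap (prod_chart b b') \<circ> (\<lambda>x. (f x, g x)) \<circ> cinv a"
    by (simp add: fun_eq_iff)
  ultimately show ?thesis by (simp add: chart_deriv_def)
qed

text \<open>By linearity the derivative of \<open>m\<close> in the direction \<open>(u, w)\<close>
  is the sum of those in \<open>(u, 0)\<close> and \<open>(0, w)\<close>. This is the product rule
  used for the group multiplication.\<close>

lemma tangent_map_two_variables: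
  assumes X: "atlas_mfd X" and M: "atlas_mfd M" and N: "atlas_mfd N" and P: "atlas_mfd P"
    and f: "smooth_at X M f x" and g: "smooth_at X N g x"
    and m: "smooth_at (prod_mfd M N) P m (f x, g x)" and v: "v \<in> tangent_space X x"
  shows "tangent_map X P (\<lambda>t. m (f t, g t)) x v =
    tangent_map X P (\<lambda>t. m (f t, g x)) x v + tangent_map X P (\<lambda>t. m (f x, g t)) x v"
proof -
  note MN = atlas_mfd_prod[OF M N]
  have pts: "x \<in> points X" "f x \<in> points M" "g x \<in> points N" "m (f x, g x) \<in> points P"
    using smooth_at_points(1)[OF X f] smooth_at_points(2)[OF M f] smooth_at_points(2)[OF N g]
      smooth_at_points(2)[OF P m] by auto
  note a = chart_at[OF X pts(1)] and b = chart_at[OF M pts(2)] and b' = chart_at[OF N pts(3)]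
    and e = chart_at[OF P pts(4)]
  let ?a = "chart_at X x" and ?b = "chart_at M (f x)" and ?b' = "chart_at N (g x)"
      and ?e = "chart_at P (m (f x, g x))"
  let ?C = "prod_chart ?b ?b'"
  have iC: "is_chart ?C" using is_chart_prod b b' by blast
  have C: "?C \<in> max_charts (prod_mfd M N)"
    using b b' by (intro charts_max_charts MN) auto
  have xC: "(f x, g x) \<in> cdom ?C" using b b' by simp
  obtain B where B: "(f x, g x) \<in> B" "chart_smooth ?C ?e m B"
    using smooth_at_charts[OF MN P m C xC e(4,2)] by blast
  have v': "v \<in> cmodel ?a" using v by (simp add: tangent_space_def)
  \<comment> \<open>Stated for all maps with the same values at \<open>x\<close>, so that it covers
    the pair \<open>(f, g)\<close> and both pairs in which one map is replaced by its constant
    value.\<close>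
  have main: "chart_deriv ?a ?e (\<lambda>t. m (f' t, g' t)) x v
      = chart_deriv ?C ?e m (f x, g x) (chart_deriv ?a ?b f' x v, chart_deriv ?a ?b' g' x v)
      \<and> chart_deriv ?a ?b f' x v \<in> cmodel ?b \<and> chart_deriv ?a ?b' g' x v \<in> cmodel ?b'"
    if f': "smooth_at X M f' x" and g': "smooth_at X N g' x"
        and eq: "f' x = f x" "g' x = g x" for f' g'
  proof -
    obtain W where W: "x \<in> W" "openin (mtop X) W" "chart_smooth ?a ?b f' W"
      using smooth_at_chart_at[OF X M f'] unfolding eq by blast
    obtain W' where W': "x \<in> W'" "openin (mtop X) W'" "chart_smooth ?a ?b' g' W'"
      using smooth_at_chart_at[OF X N g'] unfolding eq by blast
    have "W \<inter> W' \<subseteq> cdom ?a" using W by (auto simp: chart_smooth_def)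
    then have o: "openin (top_of_set (cmodel ?a)) (cmap ?a ` (W \<inter> W'))"
      using W W' openin_mtop_chart[OF X a(4)] by blast
    have s: "chart_smooth ?a ?b f' (W \<inter> W')" "chart_smooth ?a ?b' g' (W \<inter> W')"
      using chart_smooth_subset[OF W(3) _ o] chart_smooth_subset[OF W'(3) _ o] by auto
    note sp = chart_smooth_Pair[OF a(3) s]
    note V = chart_smooth_Int_vimage[OF a(3) iC sp B(2)]
    have "chart_deriv ?a ?e (\<lambda>t. m (f' t, g' t)) x v =
        chart_deriv ?C ?e m (f' x, g' x) (chart_deriv ?a ?C (\<lambda>t. (f' t, g' t)) x v)"
      by (rule chart_deriv_compose[OF a(3) iC V B(2) _ _ v']) (use W W' B eq in auto)
    also have "chart_deriv ?a ?C (\<lambda>t. (f' t, g' t)) x v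
        = (chart_deriv ?a ?b f' x v, chart_deriv ?a ?b' g' x v)"
      by (rule chart_deriv_Pair[OF a(3) s _ v']) (use W W' in auto)
    finally show ?thesis
      using chart_deriv_mem[OF a(3) b(3) W(3,1) v'] chart_deriv_mem[OF a(3) b'(3)
          W'(3,1) v'] eq by simp
  qed
  have const: "chart_deriv ?a ?b (\<lambda>_. f x) x v = 0" "chart_deriv ?a ?b' (\<lambda>_. g x) x v = 0"
    using smooth_at_const(2)[OF X M pts(1,2) v] smooth_at_const(2)[OF X N pts(1,3) v]
    by (simp_all add: tangent_map_chart_deriv)
  let ?u = "chart_deriv ?a ?b f x v" and ?w = "chart_deriv ?a ?b' g x v"
  have 1: "chart_deriv ?a ?e (\<lambda>t. m (f t, g t)) x v = chart_deriv ?C ?e m (f x, g x) (?u, ?w)"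
    and mem: "?u \<in> cmodel ?b" "?w \<in> cmodel ?b'"
    using main[OF f g] by auto
  have 2: "chart_deriv ?a ?e (\<lambda>t. m (f t, g x)) x v = chart_deriv ?C ?e m (f x, g x) (?u, 0)"
    using main[OF f smooth_at_const(1)[OF X N pts(1,3)]] const by simp
  have 3: "chart_deriv ?a ?e (\<lambda>t. m (f x, g t)) x v = chart_deriv ?C ?e m (f x, g x) (0, ?w)"
    using main[OF smooth_at_const(1)[OF X M pts(1,2)] g] const by simp
  have "chart_deriv ?C ?e m (f x, g x) ((?u, 0) + (0, ?w)) =
      chart_deriv ?C ?e m (f x, g x) (?u, 0) + chart_deriv ?C ?e m (f x, g x) (0, ?w)"
    using mem is_chart_subspace[OF b(3)] is_chart_subspace[OF b'(3)]
    by (intro chart_deriv_linear[OF iC B(2,1)]) (auto intro: subspace_0)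
  then show ?thesis
    unfolding tangent_map_chart_deriv by (simp add: 1 2 3)
qed

lemma lie_groupD:
  assumes "is_lie_group G"
  shows "Group.group G" "manifold (gmfd G)" "atlas_mfd (gmfd G)" "points (gmfd G)
      = carrier G" "\<one>\<^bsub>G\<^esub> \<in> carrier G"
    and "x \<in> carrier G \<Longrightarrow> y \<in> carrier G \<Longrightarrow> smooth_at (prod_mfd (gmfd G) (gmfd G)) (gmfd G) (\<lambda>(x,
        y). x \<otimes>\<^bsub>G\<^esub> y) (x, y)"
    and "x \<in> carrier G \<Longrightarrow> smooth_at (gmfd G) (gmfd G) (\<lambda>x. inv\<^bsub>G\<^esub> x) x"
proof -
  show g: "Group.group G" and m: "manifold (gmfd G)" using assms by (simp_all add: is_lie_group_def)
  show A: "atlas_mfd (gmfd G)" using m by (rule manifold_atlas)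
  show p: "points (gmfd G) = carrier G" by (simp add: gmfd_def)
  show "\<one>\<^bsub>G\<^esub> \<in> carrier G" using g by (simp add: group.is_monoid)
  show "x \<in> carrier G \<Longrightarrow> y \<in> carrier G \<Longrightarrow> smooth_at (prod_mfd (gmfd G) (gmfd G)) (gmfd G) (\<lambda>(x,
      y). x \<otimes>\<^bsub>G\<^esub> y) (x, y)"
    using assms unfolding is_lie_group_def smooth_map_iff[OF atlas_mfd_prod[OF A
        A] A] by (simp add: p)
  show "x \<in> carrier G \<Longrightarrow> smooth_at (gmfd G) (gmfd G) (\<lambda>x. inv\<^bsub>G\<^esub> x) x"
    using assms unfolding is_lie_group_def smooth_map_iff[OF A A] by (simp add: p)
qed

text \<open>Differentiate the product of \<open>t\<close> and its inverse, which is constantly the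
  identity, by the product rule.\<close>

lemma tangent_map_inverse:
  assumes G: "is_lie_group G" and \<xi>: "\<xi> \<in> lie_alg G"
  shows "tangent_map (gmfd G) (gmfd G) (\<lambda>x. inv\<^bsub>G\<^esub> x) \<one>\<^bsub>G\<^esub> \<xi> = - \<xi>"
proof -
  note D = lie_groupD[OF G]
  interpret group G by (rule D(1))
  let ?M = "gmfd G"
  have o: "openin (mtop ?M) (carrier G)" using openin_points[OF D(3)] D(4) by simp
  have \<xi>': "\<xi> \<in> tangent_space ?M \<one>\<^bsub>G\<^esub>" using \<xi> by (simp add: lie_alg_def)
  let ?m = "\<lambda>(x, y). x \<otimes>\<^bsub>G\<^esub> y"
  have "tangent_map ?M ?M (\<lambda>t. ?m (t, inv\<^bsub>G\<^esub> t)) \<one>\<^bsub>G\<^esub> \<xi> =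
      tangent_map ?M ?M (\<lambda>t. ?m (t, inv\<^bsub>G\<^esub> \<one>\<^bsub>G\<^esub>)) \<one>\<^bsub>G\<^esub> \<xi>
          + tangent_map ?M ?M (\<lambda>t. ?m (\<one>\<^bsub>G\<^esub>, inv\<^bsub>G\<^esub> t)) \<one>\<^bsub>G\<^esub> \<xi>"
    by (rule tangent_map_two_variables[OF D(3) D(3) D(3) D(3) _ _ _ \<xi>'])
       (use D smooth_at_ident[OF D(3)] in auto)
  moreover have "tangent_map ?M ?M (\<lambda>t. ?m (t, inv\<^bsub>G\<^esub> t)) \<one>\<^bsub>G\<^esub> \<xi>
      = tangent_map ?M ?M (\<lambda>_. \<one>\<^bsub>G\<^esub>) \<one>\<^bsub>G\<^esub> \<xi>"
    by (rule tangent_map_cong[OF D(3) o _ _ \<xi>']) auto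
  moreover have "tangent_map ?M ?M (\<lambda>_. \<one>\<^bsub>G\<^esub>) \<one>\<^bsub>G\<^esub> \<xi> = 0"
    by (rule smooth_at_const(2)[OF D(3) D(3) _ _ \<xi>']) (auto simp: D(4))
  moreover have "tangent_map ?M ?M (\<lambda>t. ?m (t, inv\<^bsub>G\<^esub> \<one>\<^bsub>G\<^esub>)) \<one>\<^bsub>G\<^esub> \<xi>
      = tangent_map ?M ?M (\<lambda>t. t) \<one>\<^bsub>G\<^esub> \<xi>"
    by (rule tangent_map_cong[OF D(3) o _ _ \<xi>']) auto
  moreover have "tangent_map ?M ?M (\<lambda>t. t) \<one>\<^bsub>G\<^esub> \<xi> = \<xi>"
    by (rule tangent_map_ident[OF D(3) _ \<xi>']) (simp add: D(4))
  moreover have "tangent_map ?M ?M (\<lambda>t. ?m (\<one>\<^bsub>G\<^esub>, inv\<^bsub>G\<^esub> t)) \<one>\<^bsub>G\<^esub> \<xi>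
      = tangent_map ?M ?M (\<lambda>t. inv\<^bsub>G\<^esub> t) \<one>\<^bsub>G\<^esub> \<xi>"
    by (rule tangent_map_cong[OF D(3) o _ _ \<xi>']) auto
  ultimately show ?thesis by (simp add: eq_neg_iff_add_eq_0 add.commute)
qed

lemma chart_at_vs_mfd: "y \<in> V \<Longrightarrow> chart_at (vs_mfd V) y = \<lparr>cdom = V, cmap = id, cmodel = V\<rparr>"
  unfolding chart_at_def vs_mfd_def by (rule some_equality) auto

lemma atlas_mfd_real: "atlas_mfd real_mfd"
proof -
  let ?c = "\<lparr>cdom = UNIV, cmap = id, cmodel = UNIV\<rparr> :: (real, real) chart"
  have "is_chart ?c" by (simp add: is_chart_def subspace_UNIV)
  moreover have "cinv ?c = id" by (simp add: cinv_def fun_eq_iff)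
  then have "compatible ?c ?c" using bastiani_smooth_ident
    by (simp add: compatible_def id_def comp_def)
  ultimately show ?thesis by (simp add: atlas_mfd_def vs_mfd_def)
qed

lemma points_real_mfd [simp]: "points real_mfd = UNIV"
  by (simp add: vs_mfd_def)

lemma conjugation_smooth:
  assumes G: "is_lie_group G" and x: "x \<in> carrier G" and y: "y \<in> carrier G"
  shows "smooth_at (prod_mfd (gmfd G) (gmfd G)) (gmfd G) (\<lambda>p. fst p \<otimes>\<^bsub>G\<^esub> snd p \<otimes>\<^bsub>G\<^esub>
      inv\<^bsub>G\<^esub> fst p) (x, y)"
proof -
  note D = lie_groupD[OF G]
  interpret group G by (rule D(1))
  let ?M = "gmfd G"
  let ?P = "prod_mfd ?M ?M"
  note PA = atlas_mfd_prod[OF D(3) D(3)]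
  have p: "(x, y) \<in> points ?M \<times> points ?M" using x y D by simp
  note f = smooth_at_fst[OF D(3) D(3) p] and s = smooth_at_snd[OF D(3) D(3) p]
  have "smooth_at ?P ?M (\<lambda>p. (\<lambda>(x, y). x \<otimes>\<^bsub>G\<^esub> y) (fst p, snd p)) (x, y)"
    by (rule smooth_at_compose[OF PA PA D(3) smooth_at_Pair[OF PA D(3) D(3) f s]])
        (use x y D(6) in simp)
  then have 1: "smooth_at ?P ?M (\<lambda>p. fst p \<otimes>\<^bsub>G\<^esub> snd p) (x, y)"
    by (simp add: case_prod_unfold)
  have 2: "smooth_at ?P ?M (\<lambda>p. inv\<^bsub>G\<^esub> fst p) (x, y)"
    by (rule smooth_at_compose[OF PA D(3) D(3) f]) (use x D(7) in simp)
  have "smooth_at ?P ?M (\<lambda>p. (\<lambda>(x, y). x \<otimes>\<^bsub>G\<^esub> y) (fst p \<otimes>\<^bsub>G\<^esub> snd p, inv\<^bsub>G\<^esub> fst p)) (x, y)"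
    by (rule smooth_at_compose[OF PA PA D(3) smooth_at_Pair[OF PA D(3) D(3) 1 2]])
        (use x y D(6) in simp)
  then show ?thesis by (simp add: case_prod_unfold)
qed

lemma smooth_at_slice:
  assumes M: "atlas_mfd M" and N: "atlas_mfd N" and P: "atlas_mfd P"
    and m: "smooth_at (prod_mfd M N) P m (x, y)"
  shows "smooth_at N P (\<lambda>y. m (x, y)) y" "smooth_at M P (\<lambda>x. m (x, y)) x"
proof -
  note MN = atlas_mfd_prod[OF M N]
  have p: "x \<in> points M" "y \<in> points N" using smooth_at_points(1)[OF MN m] by auto
  show "smooth_at N P (\<lambda>y. m (x, y)) y"
    by (rule smooth_at_compose[OF N MN P smooth_at_Pair[OF N M N smooth_at_const(1)[OF N M p(2,1)]
        smooth_at_ident[OF N p(2)]] m])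
  show "smooth_at M P (\<lambda>x. m (x, y)) x"
    by (rule smooth_at_compose[OF M MN P smooth_at_Pair[OF M M N smooth_at_ident[OF M p(1)]
        smooth_at_const(1)[OF M N p]] m])
qed

lemma Ad_mem:
  assumes G: "is_lie_group G" and g: "g \<in> carrier G" and \<eta>: "\<eta> \<in> lie_alg G"
  shows "Ad G g \<eta> \<in> lie_alg G"
proof -
  note D = lie_groupD[OF G]
  interpret group G by (rule D(1))
  have "smooth_at (gmfd G) (gmfd G) (\<lambda>x. g \<otimes>\<^bsub>G\<^esub> x \<otimes>\<^bsub>G\<^esub> inv\<^bsub>G\<^esub> g) \<one>\<^bsub>G\<^esub>"
    using smooth_at_slice(1)[OF D(3) D(3) D(3) conjugation_smooth[OF G g D(5)]] by simp
  from tangent_map_mem[OF D(3) D(3) this] show ?thesis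
    using g \<eta> by (simp add: Ad_def lie_alg_def)
qed

text \<open>The bracket is a derivative of \<open>Ad\<close>, and \<mu> may be interchanged with it
  once the limit is known to exist inside the Lie algebra, the only place where \<mu> is linear and
  continuous. Existence comes from second order smoothness: \<open>Ad\<close> is a first derivative
  of conjugation in its second variable, so the bracket is a mixed second derivative.\<close>

lemma pairing_lie_bracket:
  assumes G: "is_lie_group G" and \<mu>: "\<mu> \<in> dual (lie_alg G)" and \<xi>: "\<xi> \<in> lie_alg G"
      and \<eta>: "\<eta> \<in> lie_alg G"
  shows "tangent_map (gmfd G) real_mfd (\<lambda>g. \<mu> (Ad G g \<eta>)) \<one>\<^bsub>G\<^esub> \<xi> = \<mu> (lie_bracket G \<xi> \<eta>)"
proof -
  note D = lie_groupD[OF G]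
  interpret group G by (rule D(1))
  let ?M = "gmfd G"
  have one: "\<one>\<^bsub>G\<^esub> \<in> points ?M" by (simp add: D(4))
  note c = chart_at[OF D(3) one]
  define c where "c = chart_at ?M \<one>\<^bsub>G\<^esub>"
  note c = c[folded c_def]
  define F where "F = cmodel c"
  have la: "lie_alg G = F" by (simp add: lie_alg_def tangent_space_def c_def F_def)
  have \<xi>F: "\<xi> \<in> F" and \<eta>F: "\<eta> \<in> F" using \<xi> \<eta> la by auto
  have F: "subspace F" "closed F" using is_chart_subspace[OF c(3)] by (auto simp: F_def)
  let ?C = "prod_chart c c"
  have iC: "is_chart ?C" using is_chart_prod c by blast
  note PA = atlas_mfd_prod[OF D(3) D(3)]
  have Cm: "?C \<in> max_charts (prod_mfd ?M ?M)" using c by (intro charts_max_charts PA) auto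
  let ?\<kappa> = "\<lambda>p. fst p \<otimes>\<^bsub>G\<^esub> snd p \<otimes>\<^bsub>G\<^esub> inv\<^bsub>G\<^esub> fst p"
  obtain W where W: "(\<one>\<^bsub>G\<^esub>, \<one>\<^bsub>G\<^esub>) \<in> W" "openin (mtop (prod_mfd ?M ?M)) W" "chart_smooth ?C c ?\<kappa> W"
    by (rule smooth_at_charts[OF PA D(3) conjugation_smooth[OF G D(5) D(5)] Cm _
        c(4)]) (use c in auto)
  have Wc: "W \<subseteq> cdom c \<times> cdom c" using W(3) by (simp add: chart_smooth_def)
  define K where "K = cmap c \<circ> ?\<kappa> \<circ> cinv ?C"
  define U where "U = cmap ?C ` W"
  have K: "bastiani_smooth (F \<times> F) U K" and Uo: "openin (top_of_set (F \<times> F)) U"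
    using W(3) by (simp_all add: chart_smooth_def K_def U_def F_def)
  define z where "z = cmap c \<one>\<^bsub>G\<^esub>"
  have zU: "(z, z) \<in> U" using W(1) unfolding U_def z_def by (rule image_eqI[rotated]) simp
  have FF: "subspace (F \<times> F)" using F by (intro subspace_Times)
  have 0: "0 \<in> F" using F by (simp add: subspace_0)
  \<comment> \<open>Conjugation fixes the identity, so the chart \<open>c\<close> serves in source
    and target for every \<open>g\<close> nearby; in it \<open>Ad G g \<eta>\<close> is the
    derivative of \<open>K\<close> in the second variable.\<close>
  have AdK: "Ad G g \<eta> = iter_deriv K [(0, \<eta>)] (cmap c g, z)" if gW: "(g, \<one>\<^bsub>G\<^esub>) \<in> W" for g
  proof -
    have g: "g \<in> carrier G" "g \<in> cdom c" using gW Wc max_chartsD(2)[OF c(4)] D(4) by auto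
    have pt: "g \<in> points ?M" using g D(4) by simp
    have "chart_smooth c c (\<lambda>x. x) (cdom c)" by (rule chart_smooth_ident(1)[OF c(3)])
    moreover have cc: "cmap c \<circ> (\<lambda>_. g) \<circ> cinv c = (\<lambda>_. cmap c g)" by (simp add: comp_def)
    then have "chart_smooth c c (\<lambda>_. g) (cdom c)"
      unfolding chart_smooth_def using c g by (auto simp: bastiani_smooth_const is_chart_def)
    ultimately have s: "chart_smooth c c (\<lambda>_. g) (cdom c)" "chart_smooth c c
        (\<lambda>x. x) (cdom c)" by auto
    note V = chart_smooth_Int_vimage[OF c(3) iC chart_smooth_Pair[OF c(3) s] W(3)]
    have "Ad G g \<eta> = chart_deriv c c (\<lambda>x. ?\<kappa> (g, x)) \<one>\<^bsub>G\<^esub> \<eta>"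
      using g by (simp add: Ad_def tangent_map_chart_deriv c_def)
    also have "\<dots> = chart_deriv ?C c ?\<kappa> (g, \<one>\<^bsub>G\<^esub>) (chart_deriv c ?C (\<lambda>x. (g, x)) \<one>\<^bsub>G\<^esub> \<eta>)"
      by (rule chart_deriv_compose[OF c(3) iC V W(3)]) (use c gW \<eta>F in \<open>auto simp: F_def\<close>)
    also have "chart_deriv c ?C (\<lambda>x. (g, x)) \<one>\<^bsub>G\<^esub> \<eta>
        = (chart_deriv c c (\<lambda>_. g) \<one>\<^bsub>G\<^esub> \<eta>, chart_deriv c c (\<lambda>x. x) \<one>\<^bsub>G\<^esub> \<eta>)"
      by (rule chart_deriv_Pair[OF c(3) s]) (use c \<eta>F in \<open>auto simp: F_def\<close>)
    also have "chart_deriv c c (\<lambda>x. x) \<one>\<^bsub>G\<^esub> \<eta> = \<eta>"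
      by (rule chart_smooth_ident(2)[OF c(3)]) (use c \<eta>F in \<open>auto simp: F_def\<close>)
    also have "chart_deriv c c (\<lambda>_. g) \<one>\<^bsub>G\<^esub> \<eta> = 0"
      unfolding chart_deriv_def cc by (rule dir_derivI) simp
    finally show ?thesis by (simp add: chart_deriv_def K_def z_def)
  qed
  define A where "A = (\<lambda>y. Ad G (cinv c y) \<eta>)"
  have zA: "A z = \<eta>"
  proof -
    have "A z = Ad G \<one>\<^bsub>G\<^esub> \<eta>" using cinv_cmap[OF c(3,2)] by (simp add: A_def z_def)
    also have "\<dots> = tangent_map ?M ?M (\<lambda>x. x) \<one>\<^bsub>G\<^esub> \<eta>"
      unfolding Ad_def
      by (rule tangent_map_cong[OF D(3) openin_points[OF D(3)] one])
         (use \<eta> in \<open>auto simp: D(4) lie_alg_def\<close>)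
    also have "\<dots> = \<eta>" using \<eta> by (intro tangent_map_ident[OF D(3) one]) (simp add: lie_alg_def)
    finally show ?thesis .
  qed
  have ev: "\<forall>\<^sub>F t in at (0::real). (z + t *\<^sub>R \<xi>, z) \<in> U"
  proof -
    have "\<forall>\<^sub>F t in at (0::real). (z, z) + t *\<^sub>R (\<xi>, 0) \<in> U"
      by (rule line_in[OF Uo FF zU]) (use \<xi>F 0 in auto)
    then show ?thesis by simp
  qed
  have gU: "(cinv c y, \<one>\<^bsub>G\<^esub>) \<in> W \<and> cmap c (cinv c y) = y" if yU: "(y, z) \<in> U" for y
  proof -
    obtain g x where gx: "(g, x) \<in> W" "y = cmap c g" "z = cmap c x" using yU by (auto simp: U_def)
    then have "x = \<one>\<^bsub>G\<^esub>" using Wc c by (auto simp: z_def is_chart_def dest: inj_onD)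
    moreover have "cinv c y = g" using gx Wc cinv_cmap[OF c(3)] by auto
    ultimately show ?thesis using gx by simp
  qed
  \<comment> \<open>The head of the list is differentiated last: first \<eta> in the conjugated
    variable, then \<xi> in the conjugating one.\<close>
  define b where "b = iter_deriv K [(\<xi>, 0), (0, \<eta>)] (z, z)"
  have "((\<lambda>t::real. (iter_deriv K [(0, \<eta>)] ((z, z) + t *\<^sub>R (\<xi>, 0))
      - iter_deriv K [(0, \<eta>)] (z, z)) /\<^sub>R t) \<longlongrightarrow> b) (at 0)"
    unfolding b_def by (rule bastiani_smooth_deriv[OF K]) (use zU \<xi>F \<eta>F 0 in auto)
  moreover have "\<forall>\<^sub>F t in at (0::real). (iter_deriv K [(0, \<eta>)] ((z, z) + t *\<^sub>R (\<xi>, 0))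
      - iter_deriv K [(0, \<eta>)] (z, z)) /\<^sub>R t
      = (A (z + t *\<^sub>R \<xi>) - A z) /\<^sub>R t"
    using ev
  proof eventually_elim
    case (elim t)
    have "A (z + t *\<^sub>R \<xi>) = iter_deriv K [(0, \<eta>)] (z + t *\<^sub>R \<xi>, z)"
      using gU[OF elim] AdK by (auto simp: A_def)
    moreover have "A z = iter_deriv K [(0, \<eta>)] (z, z)" using gU[OF zU] AdK by (auto simp: A_def)
    ultimately show ?case by simp
  qed
  ultimately have lim: "((\<lambda>t::real. (A (z + t *\<^sub>R \<xi>) - A z) /\<^sub>R t) \<longlongrightarrow> b) (at 0)"
    by (rule Lim_transform_eventually)
  have Amem: "\<forall>\<^sub>F t in at (0::real). A (z + t *\<^sub>R \<xi>) \<in> F"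
    using ev
  proof eventually_elim
    case (elim t)
    have "cinv c (z + t *\<^sub>R \<xi>) \<in> carrier G" using gU[OF elim] Wc
        max_chartsD(2)[OF c(4)] D(4) by auto
    then show ?case using Ad_mem[OF G _ \<eta>] la by (simp add: A_def)
  qed
  \<comment> \<open>Keeps the quotients in \<open>F\<close>, where \<mu> is continuous, and with
    closedness of \<open>F\<close> puts their limit there as well.\<close>
  then have qF: "\<forall>\<^sub>F t in at (0::real). (A (z + t *\<^sub>R \<xi>) - A z) /\<^sub>R t \<in> F"
    by eventually_elim (use zA \<eta>F F in \<open>simp add: subspace_diff subspace_scale\<close>)
  have bF: "b \<in> F" by (rule Lim_in_closed_set[OF F(2) qF trivial_limit_at lim])
  have "lie_bracket G \<xi> \<eta> = dir_deriv A z \<xi>"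
  proof -
    have 1: "Ad G \<one>\<^bsub>G\<^esub> \<eta> \<in> lie_alg G" using Ad_mem[OF G D(5) \<eta>] .
    have "id \<circ> (\<lambda>g. Ad G g \<eta>) \<circ> cinv c = A" by (simp add: A_def fun_eq_iff)
    then show ?thesis
      by (simp add: lie_bracket_def tangent_map_def chart_at_vs_mfd[OF 1] z_def flip: c_def)
  qed
  then have br: "lie_bracket G \<xi> \<eta> = b" using dir_derivI[OF lim] by simp
  have lin: "linear_form_on F \<mu>" "continuous_on F \<mu>" using \<mu> la by (auto simp: dual_def)
  have "((\<lambda>t. \<mu> ((A (z + t *\<^sub>R \<xi>) - A z) /\<^sub>R t)) \<longlongrightarrow> \<mu> b) (at (0::real))"
    by (rule continuous_on_tendsto_compose[OF lin(2) lim bF qF])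
  moreover have "\<forall>\<^sub>F t in at (0::real). \<mu> ((A (z + t *\<^sub>R \<xi>) - A z) /\<^sub>R t) = (\<mu> (A (z
      + t *\<^sub>R \<xi>)) - \<mu> (A z)) /\<^sub>R t"
    using Amem
  proof eventually_elim
    case (elim t)
    have m: "A z \<in> F" using zA \<eta>F by simp
    have "\<mu> ((A (z + t *\<^sub>R \<xi>) - A z) /\<^sub>R t) = inverse t * \<mu> (A (z + t *\<^sub>R \<xi>) + (- 1) *\<^sub>R A z)"
      using lin(1) subspace_diff[OF F(1) elim m] unfolding linear_form_on_def by simp
    also have "\<mu> (A (z + t *\<^sub>R \<xi>) + (- 1) *\<^sub>R A z) = \<mu> (A (z + t *\<^sub>R \<xi>)) + (- 1) * \<mu> (A z)"
      using lin(1) elim m subspace_scale[OF F(1) m] unfolding linear_form_on_def by metis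
    finally show ?case by simp
  qed
  ultimately have "((\<lambda>t. (\<mu> (A (z + t *\<^sub>R \<xi>)) - \<mu> (A z)) /\<^sub>R t) \<longlongrightarrow> \<mu> b) (at (0::real))"
    by (rule Lim_transform_eventually)
  then have "dir_deriv (\<lambda>y. \<mu> (A y)) z \<xi> = \<mu> b" by (rule dir_derivI)
  moreover have "id \<circ> (\<lambda>g. \<mu> (Ad G g \<eta>)) \<circ> cinv c = (\<lambda>y. \<mu> (A y))" by (simp add: A_def fun_eq_iff)
  ultimately show ?thesis
    unfolding br tangent_map_def by (simp add: chart_at_vs_mfd z_def flip: c_def)
qed


section \<open>Reduced spaces and coadjoint orbits\<close>

lemma smooth_map_restrict_open:
  assumes M: "atlas_mfd M" and N: "atlas_mfd N" and W: "openin (mtop M) W"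
    and s: "smooth_map (sub_mfd M W) N s" and U: "openin (mtop N) U"
  shows "openin (mtop M) {y \<in> W. s y \<in> U}"
proof -
  note sub = submanifold_open[OF M W]
  have "continuous_map (mtop (sub_mfd M W)) (mtop N) s" using s by (simp add: smooth_map_def)
  moreover have "topspace (mtop (sub_mfd M W)) = W"
    using topspace_mtop[OF atlas_mfd_sub[OF M sub]] by (simp add: sub_mfd_simps)
  ultimately have "openin (mtop (sub_mfd M W)) {y \<in> W. s y \<in> U}"
    using openin_continuous_map_preimage[OF _ U] by force
  then have "openin (subtopology (mtop M) W) {y \<in> W. s y \<in> U}"
    by (simp add: mtop_sub_mfd[OF M sub])
  then show ?thesis using W by (simp add: openin_open_subtopology)
qed

text \<open>If \<open>s\<close> is a local section through \<open>x\<close>, the points that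
  \<open>s\<close> sends into \<open>U\<close> form an open neighbourhood of \<open>f x\<close>, and
  they lie in the image of \<open>U\<close>.\<close>

lemma submersion_open_image:
  assumes M: "atlas_mfd M" and N: "atlas_mfd N" and f: "submersion M N f" and U: "openin (mtop M) U"
  shows "openin (mtop N) (f ` U)"
proof (subst openin_subopen, intro ballI)
  fix y assume "y \<in> f ` U"
  then obtain x where x: "x \<in> U" "y = f x" by auto
  then have "x \<in> points M" using U openin_subset topspace_mtop[OF M] by blast
  then obtain W s where W: "openin (mtop N) W" "f x \<in> W" "smooth_map (sub_mfd N
      W) M s" "s (f x) = x"
    "\<forall>y \<in> W. f (s y) = y"
    using f unfolding submersion_def by blast
  have "openin (mtop N) {y \<in> W. s y \<in> U}" by (rule smooth_map_restrict_open[OF N M W(1,3) U])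
  moreover have "{y \<in> W. s y \<in> U} \<subseteq> f ` U"
  proof
    fix z assume "z \<in> {y \<in> W. s y \<in> U}"
    then have "f (s z) = z" "s z \<in> U" using W(5) by auto
    then show "z \<in> f ` U" by (metis imageI)
  qed
  moreover have "y \<in> {y \<in> W. s y \<in> U}" using W(2,4) x by simp
  ultimately show "\<exists>T. openin (mtop N) T \<and> y \<in> T \<and> T \<subseteq> f ` U" by blast
qed

text \<open>
  All that the argument needs of the group \<open>G\<close>: on \<open>N\<close> the fibres of \<open>J\<close> are those of \<open>\<pi>\<close>, and
  \<open>N\<close> is tangent to the orbits of \<open>H\<close>.
\<close>
locale momentum_quotient =
  fixes S :: "('s, 'e::lctvs) mfd" and \<omega> :: "('s, 'e) form2"
    and H :: "('h, 'f::lctvs) lie_group" and actH :: "'h \<Rightarrow> 's \<Rightarrow> 's"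
    and J :: "'s \<Rightarrow> 'f \<Rightarrow> real" and N :: "'s set"
    and Q :: "('b, 'q::lctvs) mfd" and \<omega>Q :: "('b, 'q) form2" and \<pi> :: "'s \<Rightarrow> 'b"
  assumes S: "symplectic_manifold S \<omega>"
    and H: "is_lie_group H" "left_action H S actH"
    and J: "momentum_map S \<omega> (lie_alg H) (inf_gen H S actH) J"
    and equivariant: "\<And>h s. h \<in> carrier H \<Longrightarrow> s \<in> points S \<Longrightarrow> J (actH h s) = coAd H h (J s)"
    and N: "submanifold S N"
    and Q: "manifold Q" "points Q = \<pi> ` N" "submersion (sub_mfd S N) Q \<pi>"
    and \<omega>Q: "symplectic_manifold Q \<omega>Q"
      "form2_eq (sub_mfd S N) (pullback (sub_mfd S N) Q \<pi> \<omega>Q) (pullback (sub_mfd S N) S (\<lambda>s. s) \<omega>)"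
    and fibres: "\<And>s t. s \<in> N \<Longrightarrow> t \<in> N \<Longrightarrow> J s = J t \<longleftrightarrow> \<pi> s = \<pi> t"
    and tangent: "\<And>s v. s \<in> N \<Longrightarrow> v \<in> tangent_space (sub_mfd S N) s \<Longrightarrow>
      tangent_map (sub_mfd S N) S (\<lambda>s. s) s v \<in> gen_space H S actH s"
    and transitive: "\<And>K. K \<in> component_sets S N \<Longrightarrow> transitive_on (carrier H) actH K"
begin

abbreviation "NN \<equiv> sub_mfd S N"
abbreviation "HH \<equiv> gmfd H"

text \<open>The choice of the representative does not matter, by \<open>fibres\<close>; see
  \<open>Jbar_\<pi>\<close>.\<close>

definition Jbar :: "'b \<Rightarrow> 'f \<Rightarrow> real" where
  "Jbar q = J (SOME s. s \<in> N \<and> \<pi> s = q)"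

text \<open>The generator of the \<open>H\<close>-action as a vector tangent to \<open>N\<close>
  instead of \<open>S\<close>. It lies over \<open>inf_gen\<close> under the inclusion and can be
  pushed to the quotient by \<pi>.\<close>

definition vel :: "'s \<Rightarrow> 'f \<Rightarrow> 'e" where
  "vel s \<xi> = tangent_map HH NN (\<lambda>h. actH h s) \<one>\<^bsub>H\<^esub> \<xi>"

lemma aS: "atlas_mfd S" using S by (simp add: symplectic_manifold_def manifold_atlas)
lemma aN: "atlas_mfd NN" by (rule atlas_mfd_sub[OF aS N])
lemma aQ: "atlas_mfd Q" using Q by (simp add: manifold_atlas)
lemmas HD = lie_groupD[OF H(1)]

lemma N_points: "s \<in> N \<Longrightarrow> s \<in> points S" using N by (auto simp: submanifold_def)
lemma NN_points [simp]: "points NN = N" by (simp add: sub_mfd_simps)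

lemma Jbar_\<pi>: "s \<in> N \<Longrightarrow> Jbar (\<pi> s) = J s"
proof -
  assume s: "s \<in> N"
  then have "\<exists>t. t \<in> N \<and> \<pi> t = \<pi> s" by auto
  from someI_ex[OF this] have t: "(SOME t. t \<in> N \<and> \<pi> t = \<pi> s) \<in> N"
    "\<pi> (SOME t. t \<in> N \<and> \<pi> t = \<pi> s) = \<pi> s" by auto
  show ?thesis unfolding Jbar_def using fibres[OF t(1) s] t(2) by simp
qed

lemma J_dual: "s \<in> points S \<Longrightarrow> J s \<in> dual (lie_alg H)"
  using J by (simp add: momentum_map_def)

lemma act_points: "h \<in> carrier H \<Longrightarrow> s \<in> points S \<Longrightarrow> actH h s \<in> points S"
  and act_one: "s \<in> points S \<Longrightarrow> actH \<one>\<^bsub>H\<^esub> s = s"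
  and act_mult: "g \<in> carrier H \<Longrightarrow> h \<in> carrier H \<Longrightarrow> s \<in> points S
      \<Longrightarrow> actH (g \<otimes>\<^bsub>H\<^esub> h) s = actH g (actH h s)"
  and act_smooth: "h \<in> carrier H \<Longrightarrow> s \<in> points S
      \<Longrightarrow> smooth_at (prod_mfd HH S) S (\<lambda>(h, s). actH h s) (h, s)"
proof -
  have sm: "smooth_at (prod_mfd HH S) S (\<lambda>(h, s). actH h s) (h, s)"
      if "h \<in> carrier H" "s \<in> points S" for h s
    using H(2) that unfolding left_action_def smooth_map_iff[OF atlas_mfd_prod[OF HD(3) aS] aS]
    by (simp add: HD(4))
  show "h \<in> carrier H \<Longrightarrow> s \<in> points S \<Longrightarrow> smooth_at (prod_mfd HH S) S (\<lambda>(h, s). actH h s) (h, s)"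
    using sm .
  show "h \<in> carrier H \<Longrightarrow> s \<in> points S \<Longrightarrow> actH h s \<in> points S"
    using smooth_at_points(2)[OF aS sm] by simp
qed (use H(2) in \<open>auto simp: left_action_def\<close>)

text \<open>Transitivity includes invariance, so the component through \<open>s\<close> is exactly
  the \<open>H\<close>-orbit of \<open>s\<close>; it is open because a manifold is locally
  connected.\<close>

lemma component_of:
  assumes "s \<in> N"
  obtains K where "K \<in> component_sets S N" "s \<in> K" "K \<subseteq> N" "K = (\<lambda>h. actH h s) ` carrier H"
    "openin (mtop NN) K" "connectedin (mtop NN) K"
proof -
  have top: "mtop NN = subtopology (mtop S) N" by (rule mtop_sub_mfd[OF aS N])
  have "s \<in> topspace (mtop NN)" using assms by (simp add: topspace_mtop[OF aN])
  then obtain K where K: "K \<in> connected_components_of (mtop NN)" "s \<in> K"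
    using Union_connected_components_of[of "mtop NN"] by blast
  then have KS: "K \<in> component_sets S N" by (simp add: component_sets_def top)
  have "K \<subseteq> N" using connected_components_of_subset[OF K(1)] topspace_mtop[OF aN] by simp
  moreover have "K = (\<lambda>h. actH h s) ` carrier H"
  proof (intro equalityI subsetI)
    fix t assume "t \<in> K"
    then obtain h where "h \<in> carrier H" "actH h s = t"
      using transitive[OF KS] K(2) unfolding transitive_on_def by blast
    then show "t \<in> (\<lambda>h. actH h s) ` carrier H" by blast
  qed (use transitive[OF KS] K(2) in \<open>auto simp: transitive_on_def\<close>)
  ultimately show thesis
    using that KS K(2) openin_connected_component_mfd[OF aN K(1)]
        connectedin_connected_components_of[OF K(1)]
    by blast
qed

lemma act_N: "h \<in> carrier H \<Longrightarrow> s \<in> N \<Longrightarrow> actH h s \<in> N"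
  by (metis component_of image_subset_iff)

text \<open>The action of \<open>H\<close> descends to the quotient: equivariance preserves equality
  of momentum values, and on \<open>N\<close> this equality is equality of classes.\<close>

lemma \<pi>_act: "h \<in> carrier H \<Longrightarrow> s \<in> N \<Longrightarrow> t \<in> N \<Longrightarrow> \<pi> s = \<pi> t \<Longrightarrow> \<pi> (actH h s) = \<pi> (actH h t)"
  using fibres[of s t] fibres[of "actH h s" "actH h t"] act_N equivariant N_points by simp

lemma inc_smooth: "s \<in> N \<Longrightarrow> smooth_at NN S (\<lambda>s. s) s"
  by (rule smooth_at_inclusion[OF aS N])

lemma \<pi>_smooth: "s \<in> N \<Longrightarrow> smooth_at NN Q \<pi> s"
  using Q(3) unfolding submersion_def smooth_map_iff[OF aN aQ] by simp

lemma section_at: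
  assumes "s \<in> N"
  obtains W sec where "openin (mtop Q) W" "\<pi> s \<in> W" "sec (\<pi> s) = s"
    "\<And>q. q \<in> W \<Longrightarrow> smooth_at Q NN sec q \<and> sec q \<in> N \<and> \<pi> (sec q) = q"
proof -
  obtain W sec where W: "openin (mtop Q) W" "\<pi> s \<in> W" "smooth_map (sub_mfd Q W)
      NN sec" "sec (\<pi> s) = s"
    "\<forall>y \<in> W. \<pi> (sec y) = y"
    using Q(3) assms unfolding submersion_def by force
  have "smooth_at Q NN sec q" if "q \<in> W" for q
    by (rule smooth_at_open_sub[OF aQ aN W(1) that W(3)])
  then have "smooth_at Q NN sec q \<and> sec q \<in> N \<and> \<pi> (sec q) = q" if "q \<in> W" for q
    using that W(5) smooth_at_points(2)[OF aN, of Q sec q] by simp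
  then show thesis by (rule that[of W sec, OF W(1,2,4)])
qed

section \<open>Tangent vectors of the quotient and generators of the action\<close>

lemma orbit_smooth:
  assumes s: "s \<in> N"
  shows "smooth_at HH NN (\<lambda>h. actH h s) \<one>\<^bsub>H\<^esub>" "smooth_at HH S (\<lambda>h. actH h s) \<one>\<^bsub>H\<^esub>"
proof -
  show 1: "smooth_at HH S (\<lambda>h. actH h s) \<one>\<^bsub>H\<^esub>"
    using smooth_at_slice(2)[OF HD(3) aS aS act_smooth[OF HD(5) N_points[OF s]]] by simp
  show "smooth_at HH NN (\<lambda>h. actH h s) \<one>\<^bsub>H\<^esub>"
    by (rule smooth_at_sub_mfd[OF HD(3) aS N 1 openin_points[OF HD(3)]]) (use act_N s HD in auto)
qed

lemma vel:
  assumes s: "s \<in> N" and \<xi>: "\<xi> \<in> lie_alg H"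
  shows "vel s \<xi> \<in> tangent_space NN s" "tangent_map NN S (\<lambda>s. s) s (vel s \<xi>) = inf_gen H S actH \<xi> s"
    "tangent_map NN Q \<pi> s (vel s \<xi>) = tangent_map HH Q (\<lambda>h. \<pi> (actH h s)) \<one>\<^bsub>H\<^esub> \<xi>"
    "smooth_at HH Q (\<lambda>h. \<pi> (actH h s)) \<one>\<^bsub>H\<^esub>"
proof -
  note one = act_one[OF N_points[OF s]]
  have \<xi>': "\<xi> \<in> tangent_space HH \<one>\<^bsub>H\<^esub>" using \<xi> by (simp add: lie_alg_def)
  show "vel s \<xi> \<in> tangent_space NN s"
    using tangent_map_mem[OF HD(3) aN orbit_smooth(1)[OF s] \<xi>'] one by (simp add: vel_def)
  have "smooth_at NN S (\<lambda>s. s) (actH \<one>\<^bsub>H\<^esub> s)" using inc_smooth s one by simp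
  from tangent_map_compose[OF HD(3) aN aS orbit_smooth(1)[OF s] this \<xi>']
  show "tangent_map NN S (\<lambda>s. s) s (vel s \<xi>) = inf_gen H S actH \<xi> s"
    by (simp add: vel_def inf_gen_def one)
  have p: "smooth_at NN Q \<pi> (actH \<one>\<^bsub>H\<^esub> s)" using \<pi>_smooth s one by simp
  from tangent_map_compose[OF HD(3) aN aQ orbit_smooth(1)[OF s] p \<xi>']
  show "tangent_map NN Q \<pi> s (vel s \<xi>) = tangent_map HH Q (\<lambda>h. \<pi> (actH h s)) \<one>\<^bsub>H\<^esub> \<xi>"
    by (simp add: vel_def one)
  show "smooth_at HH Q (\<lambda>h. \<pi> (actH h s)) \<one>\<^bsub>H\<^esub>"
    by (rule smooth_at_compose[OF HD(3) aN aQ orbit_smooth(1)[OF s] p])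
qed

text \<open>Differentiate the identity satisfied by \<pi> after a local section; the derivative of
  the section produces the preimage.\<close>

lemma \<pi>_surj:
  assumes s: "s \<in> N" and u: "u \<in> tangent_space Q (\<pi> s)"
  obtains v where "v \<in> tangent_space NN s" "tangent_map NN Q \<pi> s v = u"
proof -
  obtain W sec where W: "openin (mtop Q) W" "\<pi> s \<in> W" "sec (\<pi> s) = s"
    and sec: "\<And>q. q \<in> W \<Longrightarrow> smooth_at Q NN sec q \<and> sec q \<in> N \<and> \<pi> (sec q) = q"
    using section_at[OF s] by metis
  have sm: "smooth_at Q NN sec (\<pi> s)" using sec W by blast
  have ps: "\<pi> s \<in> points Q" using Q(2) s by blast
  have p: "smooth_at NN Q \<pi> (sec (\<pi> s))" using \<pi>_smooth s W by simp
  have "tangent_map NN Q \<pi> (sec (\<pi> s)) (tangent_map Q NN sec (\<pi> s) u)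
      = tangent_map Q Q (\<lambda>q. \<pi> (sec q)) (\<pi> s) u"
    by (rule tangent_map_compose[OF aQ aN aQ sm p u, symmetric])
  also have "\<dots> = tangent_map Q Q (\<lambda>q. q) (\<pi> s) u"
    by (rule tangent_map_cong[OF aQ W(1,2) _ u]) (use sec in blast)
  also have "\<dots> = u" by (rule tangent_map_ident[OF aQ ps u])
  finally show thesis
    using that[of "tangent_map Q NN sec (\<pi> s) u"] tangent_map_mem[OF aQ aN sm u] W(3) by simp
qed

lemma form_\<pi>:
  assumes "s \<in> N" "v \<in> tangent_space NN s" "w \<in> tangent_space NN s"
  shows "\<omega>Q (\<pi> s) (tangent_map NN Q \<pi> s v) (tangent_map NN Q \<pi> s w) =
    \<omega> s (tangent_map NN S (\<lambda>s. s) s v) (tangent_map NN S (\<lambda>s. s) s w)"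
  using \<omega>Q(2) assms by (simp add: form2_eq_def pullback_def)

lemma momentum:
  assumes "s \<in> points S" "\<xi> \<in> lie_alg H"
  shows "smooth_at S real_mfd (\<lambda>s. J s \<xi>) s"
    "v \<in> tangent_space S s \<Longrightarrow> tangent_map S real_mfd (\<lambda>s. J s \<xi>) s v = \<omega> s (inf_gen H S actH \<xi> s) v"
  using J assms unfolding momentum_map_def smooth_map_iff[OF aS atlas_mfd_real] by auto

lemma \<omega>_antisym:
  "s \<in> points S \<Longrightarrow> u \<in> tangent_space S s \<Longrightarrow> v \<in> tangent_space S s \<Longrightarrow> \<omega> s u v = - \<omega> s v u"
  using S unfolding symplectic_manifold_def smooth_form2_def by blast

lemma inc_mem: "s \<in> N \<Longrightarrow> v \<in> tangent_space NN s \<Longrightarrow> tangent_map NN S (\<lambda>s. s) s v \<in> tangent_space S s"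
  using tangent_map_mem[OF aN aS inc_smooth] .

lemma \<pi>_mem: "s \<in> N \<Longrightarrow> v \<in> tangent_space NN s \<Longrightarrow> tangent_map NN Q \<pi> s v \<in> tangent_space Q (\<pi> s)"
  using tangent_map_mem[OF aN aQ \<pi>_smooth] .

text \<open>Every vector of the quotient is the image of a vector of \<open>N\<close>, so the
  hypothesis says that the reduced form vanishes against the image of \<open>v\<close>. Weak
  nondegeneracy of the reduced form finishes.\<close>

lemma \<pi>_kernel:
  assumes s: "s \<in> N" and v: "v \<in> tangent_space NN s"
    and zero: "\<And>w. w \<in> tangent_space NN s \<Longrightarrow>
      \<omega> s (tangent_map NN S (\<lambda>s. s) s v) (tangent_map NN S (\<lambda>s. s) s w) = 0"
  shows "tangent_map NN Q \<pi> s v = 0"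
proof -
  have "\<omega>Q (\<pi> s) (tangent_map NN Q \<pi> s v) u = 0" if u: "u \<in> tangent_space Q (\<pi> s)" for u
  proof -
    obtain w where "w \<in> tangent_space NN s" "tangent_map NN Q \<pi> s w = u"
      using \<pi>_surj[OF s u] by blast
    then show ?thesis using form_\<pi>[OF s v] zero by metis
  qed
  moreover have "\<pi> s \<in> points Q" using Q(2) s by blast
  ultimately show ?thesis
    using \<omega>Q(1) \<pi>_mem[OF s v] unfolding symplectic_manifold_def weakly_nondegenerate_def by blast
qed

lemma NN_tangent_subspace: "s \<in> N \<Longrightarrow> subspace (tangent_space NN s)"
  using chart_at(3)[OF aN] by (simp add: tangent_space_def is_chart_subspace)

text \<open>The difference of the two vectors becomes 0 in \<open>S\<close>, so it is orthogonal to
  everything and \<open>\<pi>_kernel\<close> applies. Vectors of \<open>N\<close> can therefore be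
  compared in \<open>S\<close>, where the orthogonality hypotheses live.\<close>

lemma \<pi>_eq_of_inc_eq:
  assumes s: "s \<in> N" and v: "v \<in> tangent_space NN s" and v': "v' \<in> tangent_space NN s"
    and eq: "tangent_map NN S (\<lambda>s. s) s v = tangent_map NN S (\<lambda>s. s) s v'"
  shows "tangent_map NN Q \<pi> s v = tangent_map NN Q \<pi> s v'"
proof -
  note sub = NN_tangent_subspace[OF s]
  have m: "(- 1) *\<^sub>R v' \<in> tangent_space NN s" using sub v' by (rule subspace_scale)
  let ?d = "v + (- 1) *\<^sub>R v'"
  have d: "?d \<in> tangent_space NN s" using sub v m by (rule subspace_add)
  have 0: "tangent_map NN S (\<lambda>s. s) s ?d = 0"
    using eq by (simp only: tangent_map_add[OF aN aS inc_smooth[OF s] v m] tangent_map_scale[OF aN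
        aS inc_smooth[OF s] v' v']) simp
  have "\<omega> s 0 u = 0" if u: "u \<in> tangent_space S s" for u
  proof -
    have z: "0 \<in> tangent_space S s" using inc_mem[OF s d] 0 by simp
    have "linear_form_on (tangent_space S s) (\<omega> s u)"
      using S N_points[OF s] u unfolding symplectic_manifold_def smooth_form2_def by blast
    then have "\<omega> s u (0 *\<^sub>R 0) = 0 * \<omega> s u 0" using z unfolding linear_form_on_def by blast
    then show ?thesis using \<omega>_antisym[OF N_points[OF s] z u] by simp
  qed
  then have "tangent_map NN Q \<pi> s ?d = 0"
    using inc_mem[OF s] 0 by (intro \<pi>_kernel[OF s d]) simp
  then show ?thesis
    by (simp only: tangent_map_add[OF aN aQ \<pi>_smooth[OF s] v m] tangent_map_scale[OF aN aQ
        \<pi>_smooth[OF s] v' v']) simp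
qed

text \<open>The locale assumption \<open>tangent\<close> identifies the vector with a generator
  inside the tangent space of \<open>S\<close> only; \<open>\<pi>_eq_of_inc_eq\<close> carries the
  identification to the quotient.\<close>

lemma \<pi>_tangent:
  assumes s: "s \<in> N" and v: "v \<in> tangent_space NN s"
  obtains \<xi> where "\<xi> \<in> lie_alg H" "tangent_map NN S (\<lambda>s. s) s v = inf_gen H S actH \<xi> s"
    "tangent_map NN Q \<pi> s v = tangent_map NN Q \<pi> s (vel s \<xi>)"
proof -
  obtain \<xi> where \<xi>: "\<xi> \<in> lie_alg H" "tangent_map NN S (\<lambda>s. s) s v = inf_gen H S actH \<xi> s"
    using tangent[OF s v] by (auto simp: gen_space_def)
  moreover have "tangent_map NN Q \<pi> s v = tangent_map NN Q \<pi> s (vel s \<xi>)"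
    by (rule \<pi>_eq_of_inc_eq[OF s v]) (use vel[OF s \<xi>(1)] \<xi>(2) in auto)
  ultimately show thesis using that by blast
qed

text \<open>The coadjoint action pairs with \<open>Ad\<close> of the inverse, so differentiating
  equivariance produces a minus sign through \<open>tangent_map_inverse\<close>. A second minus sign
  from antisymmetry cancels it, since the momentum map is paired with \<eta> and differentiated
  along \<xi>.\<close>

lemma form_generators:
  assumes s: "s \<in> N" and \<xi>: "\<xi> \<in> lie_alg H" and \<eta>: "\<eta> \<in> lie_alg H"
  shows "\<omega> s (inf_gen H S actH \<xi> s) (inf_gen H S actH \<eta> s) = J s (lie_bracket H \<xi> \<eta>)"
proof -
  note sp = N_points[OF s] and one = act_one[OF N_points[OF s]]
  interpret group H by (rule HD(1))
  have \<xi>': "\<xi> \<in> tangent_space HH \<one>\<^bsub>H\<^esub>" using \<xi> by (simp add: lie_alg_def)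
  have mem: "inf_gen H S actH \<zeta> s \<in> tangent_space S s" if "\<zeta> \<in> lie_alg H" for \<zeta>
    using vel(1,2)[OF s that] inc_mem[OF s] by metis
  have J1: "smooth_at S real_mfd (\<lambda>s. J s \<eta>) (actH \<one>\<^bsub>H\<^esub> s)" using momentum(1)[OF sp \<eta>] one by simp
  have aJ: "smooth_at HH real_mfd (\<lambda>h. J (actH h s) \<eta>) \<one>\<^bsub>H\<^esub>"
    by (rule smooth_at_compose[OF HD(3) aS atlas_mfd_real orbit_smooth(2)[OF s] J1])
  let ?a = "\<lambda>h. J s (Ad H h \<eta>)"
  have J_act: "J (actH h s) \<eta> = ?a (inv\<^bsub>H\<^esub> h)" if "h \<in> carrier H" for h
    using equivariant[OF that sp] \<eta> by (simp add: coAd_def)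
  have inv1: "smooth_at HH HH (\<lambda>h. inv\<^bsub>H\<^esub> h) \<one>\<^bsub>H\<^esub>" using HD(7)[OF HD(5)] .
  have aJ': "smooth_at HH real_mfd (\<lambda>h. J (actH h s) \<eta>) (inv\<^bsub>H\<^esub> \<one>\<^bsub>H\<^esub>)" using aJ by simp
  \<comment> \<open>Smoothness of \<open>?a\<close> is taken from the action: by equivariance
    \<open>?a h\<close> is the momentum at the point moved by the inverse of \<open>h\<close>,
    paired with \<eta>.\<close>
  have "smooth_at HH real_mfd (\<lambda>h. J (actH (inv\<^bsub>H\<^esub> h) s) \<eta>) \<one>\<^bsub>H\<^esub>"
    by (rule smooth_at_compose[OF HD(3) HD(3) atlas_mfd_real inv1 aJ'])
  then have a: "smooth_at HH real_mfd ?a \<one>\<^bsub>H\<^esub>"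
    by (rule smooth_at_cong[OF HD(3) openin_points[OF HD(3)] _ _ atlas_mfd_real, rotated 2])
       (auto simp: HD(4) J_act)
  then have a': "smooth_at HH real_mfd ?a (inv\<^bsub>H\<^esub> \<one>\<^bsub>H\<^esub>)" by simp
  have "tangent_map S real_mfd (\<lambda>s. J s \<eta>) s (inf_gen H S actH \<xi> s) =
      tangent_map HH real_mfd (\<lambda>h. J (actH h s) \<eta>) \<one>\<^bsub>H\<^esub> \<xi>"
    using tangent_map_compose[OF HD(3) aS atlas_mfd_real orbit_smooth(2)[OF s] J1 \<xi>']
      by (simp add: inf_gen_def one)
  also have "\<dots> = tangent_map HH real_mfd (\<lambda>h. ?a (inv\<^bsub>H\<^esub> h)) \<one>\<^bsub>H\<^esub> \<xi>"
    by (rule tangent_map_cong[OF HD(3) openin_points[OF HD(3)] _ _ \<xi>']) (auto simp: HD(4) J_act)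
  also have "\<dots> = tangent_map HH real_mfd ?a (inv\<^bsub>H\<^esub> \<one>\<^bsub>H\<^esub>) (tangent_map HH HH (\<lambda>h. inv\<^bsub>H\<^esub> h) \<one>\<^bsub>H\<^esub> \<xi>)"
    by (rule tangent_map_compose[OF HD(3) HD(3) atlas_mfd_real inv1 a' \<xi>'])
  also have "\<dots> = tangent_map HH real_mfd ?a \<one>\<^bsub>H\<^esub> ((- 1) *\<^sub>R \<xi>)"
    by (simp add: tangent_map_inverse[OF H(1) \<xi>])
  also have "\<dots> = - tangent_map HH real_mfd ?a \<one>\<^bsub>H\<^esub> \<xi>"
    by (simp only: tangent_map_scale[OF HD(3) atlas_mfd_real a \<xi>' \<xi>']) simp
  also have "\<dots> = - J s (lie_bracket H \<xi> \<eta>)"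
    by (simp add: pairing_lie_bracket[OF H(1) J_dual[OF sp] \<xi> \<eta>])
  finally show ?thesis
    using momentum(2)[OF sp \<eta> mem[OF \<xi>]] \<omega>_antisym[OF sp mem[OF \<xi>] mem[OF \<eta>]] by simp
qed

section \<open>One component of the quotient and its coadjoint orbit\<close>

context
  fixes C K s0
  assumes s0: "s0 \<in> N" "\<pi> s0 \<in> C" and C: "C \<in> connected_components_of (mtop Q)"
    and K: "K = (\<lambda>h. actH h s0) ` carrier H"
begin

lemma C_open: "openin (mtop Q) C"
  by (rule openin_connected_component_mfd[OF aQ C])

lemma K_subset: "K \<subseteq> N" using act_N s0 by (auto simp: K)

text \<open>The \<open>H\<close>-orbit of \<open>s0\<close> is a component of \<open>N\<close>, so
  its image is connected and lies in \<open>C\<close>. This image is open, and the rest of the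
  quotient is a union of images of other open \<open>H\<close>-orbits; connectedness of
  \<open>C\<close> leaves no room for the rest.\<close>

lemma C_eq: "C = \<pi> ` K"
proof
  obtain K' where K': "s0 \<in> K'" "K' = (\<lambda>h. actH h s0) ` carrier H" "openin (mtop NN) K'"
      "connectedin (mtop NN) K'"
    using component_of[OF s0(1)] by metis
  then have KK: "K' = K" by (simp add: K)
  have cont: "continuous_map (mtop NN) (mtop Q) \<pi>" using Q(3)
    by (simp add: submersion_def smooth_map_def)
  have "connectedin (mtop Q) (\<pi> ` K)" using connectedin_continuous_map_image[OF cont] K' KK by simp
  then show sub: "\<pi> ` K \<subseteq> C"
    using connected_components_of_maximal[OF C] s0 K' KK by (auto simp: disjnt_iff)
  have o: "openin (mtop Q) (\<pi> ` K)" using submersion_open_image[OF aN aQ Q(3)] K' KK by simp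
  \<comment> \<open>The complement of the image of \<open>K\<close> in the quotient. It is rewritten
    as a union over whole \<open>H\<close>-orbits, each of which is open in
    \<open>N\<close>.\<close>
  define R where "R = \<pi> ` (N - {s \<in> N. \<pi> s \<in> \<pi> ` K})"
  have "openin (mtop Q) (\<pi> ` T)" if "T \<in> {(\<lambda>h. actH h t) ` carrier H | t. t \<in> N
      \<and> \<pi> t \<notin> \<pi> ` K}" for T
  proof -
    obtain t where t: "t \<in> N" "T = (\<lambda>h. actH h t) ` carrier H" using \<open>T \<in> _\<close> by auto
    then have "openin (mtop NN) T" using component_of[OF t(1)] by metis
    then show ?thesis by (rule submersion_open_image[OF aN aQ Q(3)])
  qed
  then have "openin (mtop Q) (\<Union>T\<in>{(\<lambda>h. actH h t) ` carrier H | t. t \<in> N \<and> \<pi> t \<notin> \<pi> ` K}. \<pi> ` T)"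
    by blast
  moreover have "(\<Union>T\<in>{(\<lambda>h. actH h t) ` carrier H | t. t \<in> N \<and> \<pi> t \<notin> \<pi> ` K}. \<pi> ` T) = R"
  proof (intro equalityI subsetI)
    fix q assume "q \<in> (\<Union>T\<in>{(\<lambda>h. actH h t) ` carrier H | t. t \<in> N \<and> \<pi> t \<notin> \<pi> ` K}. \<pi> ` T)"
    then obtain t h where t: "t \<in> N" "\<pi> t \<notin> \<pi> ` K" "h \<in> carrier H" "q = \<pi> (actH h t)" by auto
    interpret group H by (rule HD(1))
    \<comment> \<open>Otherwise moving back by the inverse of \<open>h\<close>, which is legitimate
      on classes by \<open>\<pi>_act\<close>, would put the class of \<open>t\<close> into the image
      of \<open>K\<close>.\<close>
    have "\<pi> (actH h t) \<notin> \<pi> ` K"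
    proof
      assume "\<pi> (actH h t) \<in> \<pi> ` K"
      then obtain g where g: "g \<in> carrier H" "\<pi> (actH h t) = \<pi> (actH g s0)" by (auto simp: K)
      have "\<pi> (actH (inv\<^bsub>H\<^esub> h) (actH h t)) = \<pi> (actH (inv\<^bsub>H\<^esub> h) (actH g s0))"
        using t g s0 by (intro \<pi>_act) (auto intro: act_N)
      moreover have "actH (inv\<^bsub>H\<^esub> h) (actH h t) = t"
        using t act_mult[of "inv\<^bsub>H\<^esub> h" h t] by (simp add: N_points act_one)
      moreover have "actH (inv\<^bsub>H\<^esub> h) (actH g s0) = actH (inv\<^bsub>H\<^esub> h \<otimes>\<^bsub>H\<^esub> g) s0"
        using t g s0 by (simp add: N_points act_mult)
      ultimately have "\<pi> t \<in> \<pi> ` K" using t g by (auto simp: K)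
      with t show False by simp
    qed
    then show "q \<in> R" using t act_N by (auto simp: R_def)
  next
    fix q assume "q \<in> R"
    then obtain t where t: "t \<in> N" "\<pi> t \<notin> \<pi> ` K" "q = \<pi> t" by (auto simp: R_def)
    moreover have "t \<in> (\<lambda>h. actH h t) ` carrier H"
      using act_one[OF N_points[OF t(1)]] HD(5) by (metis imageI)
    ultimately show "q \<in> (\<Union>T\<in>{(\<lambda>h. actH h t) ` carrier H | t. t \<in> N \<and> \<pi> t \<notin> \<pi> ` K}. \<pi> ` T)" by blast
  qed
  ultimately have oR: "openin (mtop Q) R" by simp
  have "C \<subseteq> \<pi> ` N"
    using connected_components_of_subset[OF C] topspace_mtop[OF aQ] Q(2) by simp
  also have "\<pi> ` N \<subseteq> \<pi> ` K \<union> R"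
  proof
    fix q assume "q \<in> \<pi> ` N"
    then obtain t where "t \<in> N" "q = \<pi> t" by auto
    then show "q \<in> \<pi> ` K \<union> R" by (cases "q \<in> \<pi> ` K") (auto simp: R_def)
  qed
  finally have cover: "C \<subseteq> \<pi> ` K \<union> R" .
  have "q \<notin> \<pi> ` K" if "q \<in> R" for q using that unfolding R_def by force
  then have disj: "\<pi> ` K \<inter> R \<inter> C = {}" by blast
  have ne: "\<pi> ` K \<inter> C \<noteq> {}" using s0(2) imageI[OF K'(1), of \<pi>] KK by blast
  have con: "\<nexists>E1 E2. openin (mtop Q) E1 \<and> openin (mtop Q) E2 \<and> C \<subseteq> E1 \<union> E2 \<and>
      E1 \<inter> E2 \<inter> C = {} \<and> E1 \<inter> C \<noteq> {} \<and> E2 \<inter> C \<noteq> {}"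
    using connectedin_connected_components_of[OF C] unfolding connectedin by (rule conjunct2)
  show "C \<subseteq> \<pi> ` K"
  proof (rule ccontr)
    assume "\<not> C \<subseteq> \<pi> ` K"
    then have "R \<inter> C \<noteq> {}" using cover by blast
    with o oR cover disj ne con show False by metis
  qed
qed

lemma Jbar_inj: "inj_on Jbar C"
proof (rule inj_onI)
  fix q r assume "q \<in> C" "r \<in> C" and eq: "Jbar q = Jbar r"
  then obtain s t where st: "s \<in> N" "t \<in> N" "q = \<pi> s" "r = \<pi> t" using C_eq K_subset by blast
  then show "q = r" using eq Jbar_\<pi> fibres[OF st(1,2)] by simp
qed

abbreviation "Orb \<equiv> transport_mfd Q C Jbar"
abbreviation "Finv \<equiv> inv_into C Jbar"

lemma aO: "atlas_mfd Orb" by (rule atlas_mfd_transport[OF aQ C_open Jbar_inj])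

lemma Jbar_inverse [simp]: "q \<in> C \<Longrightarrow> Finv (Jbar q) = q" using Jbar_inj by simp

lemma pt:
  assumes "\<nu> \<in> Jbar ` C"
  obtains s where "s \<in> K" "s \<in> N" "\<nu> = J s" "Finv \<nu> = \<pi> s" "\<pi> s \<in> C" "Jbar (\<pi> s) = \<nu>"
proof -
  obtain s where s: "s \<in> K" "\<nu> = Jbar (\<pi> s)" using assms C_eq by auto
  have sN: "s \<in> N" using s(1) K_subset by blast
  have sC: "\<pi> s \<in> C" using s(1) unfolding C_eq by (rule imageI)
  have J: "\<nu> = J s" using s(2) Jbar_\<pi>[OF sN] by simp
  have i: "Finv \<nu> = \<pi> s" using Jbar_inverse[OF sC] by (simp only: s(2))
  show thesis by (rule that[OF s(1) sN J i sC s(2)[symmetric]])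
qed

lemma act_K: "h \<in> carrier H \<Longrightarrow> s \<in> K \<Longrightarrow> actH h s \<in> K"
proof -
  assume h: "h \<in> carrier H" and "s \<in> K"
  then obtain g where g: "g \<in> carrier H" "s = actH g s0" by (auto simp: K)
  interpret group H by (rule HD(1))
  have "actH h s = actH (h \<otimes>\<^bsub>H\<^esub> g) s0" using h g act_mult s0 N_points by simp
  then show ?thesis using h g by (auto simp: K)
qed

lemma coAd_Jbar: "h \<in> carrier H \<Longrightarrow> s \<in> K \<Longrightarrow> coAd H h (J s) = Jbar (\<pi> (actH h s))"
  using equivariant[of h s] N_points K_subset act_N Jbar_\<pi> by auto

lemma act_in_C: "h \<in> carrier H \<Longrightarrow> s \<in> N \<Longrightarrow> \<pi> s \<in> C \<Longrightarrow> \<pi> (actH h s) \<in> C"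
proof -
  assume h: "h \<in> carrier H" and s: "s \<in> N" "\<pi> s \<in> C"
  then obtain t where t: "t \<in> K" "\<pi> s = \<pi> t" using C_eq by auto
  then have "\<pi> (actH h s) = \<pi> (actH h t)" using h s K_subset by (intro \<pi>_act) auto
  then show ?thesis using act_K[OF h t(1)] C_eq by simp
qed

lemma orbit_points: "Jbar ` C = coadjoint_orbit H (J s0)"
proof -
  have "Jbar ` C = J ` K"
    unfolding C_eq image_image using K_subset by (intro image_cong[OF refl] Jbar_\<pi>) blast
  also have "\<dots> = coadjoint_orbit H (J s0)"
    unfolding K coadjoint_orbit_def image_image
    by (intro image_cong[OF refl] equivariant N_points[OF s0(1)])
  finally show ?thesis .
qed

text \<open>A local section of \<pi> after the inverse of \<open>Jbar\<close> chooses points of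
  \<open>N\<close> with prescribed momentum, smoothly for the transported structure. Smoothness of
  the action and of the evaluations on the orbit is obtained by lifting along it.\<close>

lemma local_section:
  assumes \<nu>: "\<nu> \<in> Jbar ` C"
  obtains V sec where "openin (mtop Orb) V" "\<nu> \<in> V"
    "\<And>\<nu>. \<nu> \<in> V \<Longrightarrow> smooth_at Orb NN (\<lambda>\<nu>. sec (Finv \<nu>)) \<nu> \<and> sec (Finv \<nu>) \<in> N \<and> \<pi> (sec (Finv \<nu>))
        = Finv \<nu> \<and> J (sec (Finv \<nu>)) = \<nu> \<and> \<nu> \<in> Jbar ` C"
proof -
  obtain s where s: "s \<in> N" "Finv \<nu> = \<pi> s" using pt[OF \<nu>] by metis
  obtain W sec where W: "openin (mtop Q) W" "\<pi> s \<in> W"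
    and sec: "\<And>q. q \<in> W \<Longrightarrow> smooth_at Q NN sec q \<and> sec q \<in> N \<and> \<pi> (sec q) = q"
    using section_at[OF s(1)] by metis
  define V where "V = {\<nu> \<in> Jbar ` C. Finv \<nu> \<in> W}"
  have "continuous_map (mtop Orb) (mtop Q) Finv"
    using smooth_map_transport_inv[OF aQ C_open Jbar_inj] by (simp add: smooth_map_def)
  from openin_continuous_map_preimage[OF this W(1)] have "openin (mtop Orb) V"
    by (simp add: V_def topspace_mtop[OF aO])
  moreover have "\<nu> \<in> V" using s W \<nu> by (simp add: V_def)
  moreover have "smooth_at Orb NN (\<lambda>\<nu>. sec (Finv \<nu>)) \<nu> \<and> sec (Finv \<nu>) \<in> N \<and> \<pi> (sec (Finv \<nu>))
      = Finv \<nu> \<and> J (sec (Finv \<nu>)) = \<nu> \<and> \<nu> \<in> Jbar ` C"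
    if "\<nu> \<in> V" for \<nu>
  proof -
    have \<nu>: "\<nu> \<in> Jbar ` C" "Finv \<nu> \<in> W" using that by (auto simp: V_def)
    have "smooth_at Orb NN (\<lambda>\<nu>. sec (Finv \<nu>)) \<nu>"
      using smooth_at_compose[OF aO aQ aN smooth_at_transport_inv[OF aQ C_open Jbar_inj \<nu>(1)]]
          sec[OF \<nu>(2)] by blast
    moreover have "J (sec (Finv \<nu>)) = Jbar (\<pi> (sec (Finv \<nu>)))"
      by (rule Jbar_\<pi>[symmetric]) (use sec[OF \<nu>(2)] in blast)
    moreover have "Jbar (Finv \<nu>) = \<nu>" using \<nu>(1) by (simp add: f_inv_into_f)
    ultimately show ?thesis using sec[OF \<nu>(2)] \<nu>(1) by simp
  qed
  ultimately show thesis using that by blast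
qed

text \<open>Near a point the coadjoint action is a composite of smooth maps: lift the functional to
  \<open>N\<close>, act by \<open>H\<close> in \<open>S\<close>, project by \<pi>, apply
  \<open>Jbar\<close>. Equivariance identifies the composite with \<open>coAd\<close>.\<close>

lemma orbit_action: "left_action H Orb (coAd H)"
  unfolding left_action_def
proof (intro conjI ballI)
  interpret group H by (rule HD(1))
  fix \<nu> assume "\<nu> \<in> points Orb"
  then obtain s where s: "s \<in> K" "s \<in> N" "\<nu> = J s" using pt by (metis transport_simps(4))
  note sp = N_points[OF s(2)]
  show "coAd H \<one>\<^bsub>H\<^esub> \<nu> = \<nu>" using equivariant[OF HD(5) sp] act_one[OF sp] s(3) by simp
  fix g h assume gh: "g \<in> carrier H" "h \<in> carrier H"
  have "coAd H (g \<otimes>\<^bsub>H\<^esub> h) \<nu> = J (actH g (actH h s))"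
    using equivariant[OF m_closed[OF gh] sp] act_mult[OF gh sp] s(3) by simp
  also have "\<dots> = coAd H g (coAd H h \<nu>)"
    using equivariant[OF gh(1) act_points[OF gh(2) sp]] equivariant[OF gh(2) sp] s(3) by simp
  finally show "coAd H (g \<otimes>\<^bsub>H\<^esub> h) \<nu> = coAd H g (coAd H h \<nu>)" .
next
  note PA = atlas_mfd_prod[OF HD(3) aO]
  have "smooth_at (prod_mfd HH Orb) Orb (\<lambda>(h, \<nu>). coAd H h \<nu>) (h, \<nu>)" if h: "h \<in> carrier H"
      and \<nu>: "\<nu> \<in> Jbar ` C" for h \<nu>
  proof -
    obtain V sec where V: "openin (mtop Orb) V" "\<nu> \<in> V"
      and sec: "\<And>\<nu>. \<nu> \<in> V \<Longrightarrow> smooth_at Orb NN (\<lambda>\<nu>. sec (Finv \<nu>)) \<nu> \<and> sec (Finv \<nu>) \<in> N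
          \<and> \<pi> (sec (Finv \<nu>)) = Finv \<nu> \<and> J (sec (Finv \<nu>)) = \<nu> \<and> \<nu> \<in> Jbar ` C"
      using local_section[OF \<nu>] by metis
    let ?P = "prod_mfd HH Orb"
    have p: "(h, \<nu>) \<in> points HH \<times> points Orb" using h \<nu> by (simp add: HD(4))
    have "smooth_map ?P Orb snd" using smooth_at_snd[OF HD(3) aO]
      by (simp add: smooth_map_iff[OF PA aO])
    then have "continuous_map (mtop ?P) (mtop Orb) snd" by (simp add: smooth_map_def)
    define U where "U = {p \<in> topspace (mtop ?P). snd p \<in> V}"
    have U: "openin (mtop ?P) U" "(h, \<nu>) \<in> U"
      using openin_continuous_map_preimage[OF \<open>continuous_map _ _ snd\<close> V(1)] p V(2)
      by (simp_all add: U_def topspace_mtop[OF PA])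
    have inU: "fst p \<in> carrier H" "snd p \<in> V" if "p \<in> U" for p
      using that by (auto simp: U_def topspace_mtop[OF PA] HD(4))
    let ?t = "\<lambda>p. sec (Finv (snd p))"
    let ?a = "\<lambda>p. actH (fst p) (?t p)"
    have "smooth_at ?P NN ?t (h, \<nu>)"
      by (rule smooth_at_compose[OF PA aO aN smooth_at_snd[OF HD(3) aO p], where g
          = "\<lambda>\<nu>. sec (Finv \<nu>)"])
         (use sec V in auto)
    then have t: "smooth_at ?P S ?t (h, \<nu>)"
      by (rule smooth_at_compose[OF PA aN aS]) (use inc_smooth sec V in auto)
    have "smooth_at ?P S (\<lambda>p. (\<lambda>(h, s). actH h s) (fst p, ?t p)) (h, \<nu>)"
      by (rule smooth_at_compose[OF PA atlas_mfd_prod[OF HD(3) aS] aS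
            smooth_at_Pair[OF PA HD(3) aS smooth_at_fst[OF HD(3) aO p] t]])
         (use act_smooth[OF h] N_points sec V in auto)
    then have "smooth_at ?P S ?a (h, \<nu>)" by simp
    \<comment> \<open>The action is given as smooth into \<open>S\<close>; its values stay in
      \<open>N\<close> on all of \<open>U\<close>, so it is smooth into \<open>N\<close>, where
      \<pi> is defined as a submersion.\<close>
    then have "smooth_at ?P NN ?a (h, \<nu>)"
      by (rule smooth_at_sub_mfd[OF PA aS N _ U]) (use inU sec act_N in auto)
    then have "smooth_at ?P Q (\<lambda>p. \<pi> (?a p)) (h, \<nu>)"
      by (rule smooth_at_compose[OF PA aN aQ]) (use \<pi>_smooth act_N[OF h] sec V in auto)
    then have "smooth_at ?P Orb (\<lambda>p. Jbar (\<pi> (?a p))) (h, \<nu>)"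
    proof (rule smooth_at_compose[OF PA aQ aO])
      have "\<pi> (sec (Finv \<nu>)) \<in> C" using sec[OF V(2)] \<nu> by auto
      then have "\<pi> (actH h (sec (Finv \<nu>))) \<in> C" using act_in_C[OF h] sec[OF V(2)] by blast
      then show "smooth_at Q Orb Jbar (\<pi> (?a (h, \<nu>)))"
        using smooth_at_transport[OF aQ C_open Jbar_inj] by simp
    qed
    then show ?thesis
    proof (rule smooth_at_cong[OF PA U _ aO, rotated])
      fix q assume q: "q \<in> U"
      have "Jbar (\<pi> (?a q)) = J (?a q)" using inU[OF q] sec act_N Jbar_\<pi> by simp
      also have "\<dots> = coAd H (fst q) (J (?t q))" using inU[OF q] sec equivariant N_points by simp
      also have "\<dots> = coAd H (fst q) (snd q)" using inU[OF q] sec by simp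
      finally show "Jbar (\<pi> (?a q)) = (\<lambda>(h, \<nu>). coAd H h \<nu>) q" by (simp add: case_prod_unfold)
    qed
  qed
  then show "smooth_map (prod_mfd HH Orb) Orb (\<lambda>(h, \<nu>). coAd H h \<nu>)"
    by (auto simp: smooth_map_iff[OF PA aO] HD(4))
qed

text \<open>Differentiate \<open>coAd_Jbar\<close> at the identity: the generator on the orbit is
  the push-forward of the velocity in \<open>N\<close>.\<close>

lemma orbit_generator:
  assumes s: "s \<in> K" and \<xi>: "\<xi> \<in> lie_alg H"
  shows "inf_gen H Orb (coAd H) \<xi> (J s) = tangent_map Q Orb Jbar (\<pi> s)
      (tangent_map NN Q \<pi> s (vel s \<xi>))"
proof -
  have sN: "s \<in> N" and sC: "\<pi> s \<in> C" using s K_subset C_eq by blast+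
  have \<xi>': "\<xi> \<in> tangent_space HH \<one>\<^bsub>H\<^esub>" using \<xi> by (simp add: lie_alg_def)
  note one = act_one[OF N_points[OF sN]]
  have Fs: "smooth_at Q Orb Jbar (\<pi> (actH \<one>\<^bsub>H\<^esub> s))"
    using smooth_at_transport[OF aQ C_open Jbar_inj sC] one by simp
  have "inf_gen H Orb (coAd H) \<xi> (J s) = tangent_map HH Orb (\<lambda>h. Jbar (\<pi> (actH h s))) \<one>\<^bsub>H\<^esub> \<xi>"
    unfolding inf_gen_def
    by (rule tangent_map_cong[OF HD(3) openin_points[OF HD(3)] _ _ \<xi>']) (use coAd_Jbar s HD in auto)
  also have "\<dots> = tangent_map Q Orb Jbar (\<pi> s) (tangent_map HH Q (\<lambda>h. \<pi> (actH h s)) \<one>\<^bsub>H\<^esub> \<xi>)"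
    using tangent_map_compose[OF HD(3) aQ aO vel(4)[OF sN \<xi>] Fs \<xi>'] one by simp
  finally show ?thesis using vel(3)[OF sN \<xi>] by simp
qed

lemma orbit_tangent:
  assumes \<nu>: "\<nu> \<in> Jbar ` C" and u: "u \<in> tangent_space Orb \<nu>" and s: "s \<in> N" "Finv \<nu> = \<pi> s"
  obtains v where "v \<in> tangent_space NN s" "u
      = tangent_map Q Orb Jbar (\<pi> s) (tangent_map NN Q \<pi> s v)"
proof -
  have "tangent_map Orb Q Finv \<nu> u \<in> tangent_space Q (\<pi> s)"
    using tangent_map_mem[OF aO aQ smooth_at_transport_inv[OF aQ C_open Jbar_inj \<nu>] u] s by simp
  then obtain v where v: "v \<in> tangent_space NN s" "tangent_map NN Q \<pi> s v
      = tangent_map Orb Q Finv \<nu> u"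
    using \<pi>_surj[OF s(1)] by blast
  moreover have "tangent_map Q Orb Jbar (\<pi> s) (tangent_map Orb Q Finv \<nu> u) = u"
    using tangent_map_transport(2)[OF aQ C_open Jbar_inj \<nu> u] s by simp
  ultimately show thesis using that by metis
qed

text \<open>A tangent vector of the orbit lifts to \<open>N\<close>, and
  \<open>\<pi>_tangent\<close> replaces the lift by a velocity with the same image, that is, by a
  generator.\<close>

lemma orbit_tangent_space:
  assumes \<nu>: "\<nu> \<in> Jbar ` C"
  shows "tangent_space Orb \<nu> = gen_space H Orb (coAd H) \<nu>"
proof (intro equalityI subsetI)
  obtain s where s: "s \<in> K" "s \<in> N" "\<nu> = J s" "Finv \<nu> = \<pi> s" "\<pi> s \<in> C" "Jbar (\<pi> s) = \<nu>"
    using pt[OF \<nu>] by metis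
  fix u assume u: "u \<in> tangent_space Orb \<nu>"
  obtain v where v: "v \<in> tangent_space NN s" "u
      = tangent_map Q Orb Jbar (\<pi> s) (tangent_map NN Q \<pi> s v)"
    using orbit_tangent[OF \<nu> u s(2,4)] by metis
  obtain \<xi> where \<xi>: "\<xi> \<in> lie_alg H" "tangent_map NN Q \<pi> s v = tangent_map NN Q \<pi> s (vel s \<xi>)"
    using \<pi>_tangent[OF s(2) v(1)] by metis
  then have "u = inf_gen H Orb (coAd H) \<xi> \<nu>"
    using v(2) orbit_generator[OF s(1) \<xi>(1)] s(3) by simp
  then show "u \<in> gen_space H Orb (coAd H) \<nu>" using \<xi>(1) unfolding gen_space_def by blast
next
  obtain s where s: "s \<in> K" "s \<in> N" "\<nu> = J s" "Finv \<nu> = \<pi> s" "\<pi> s \<in> C" "Jbar (\<pi> s) = \<nu>"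
    using pt[OF \<nu>] by metis
  fix u assume "u \<in> gen_space H Orb (coAd H) \<nu>"
  then obtain \<xi> where \<xi>: "\<xi> \<in> lie_alg H" "u = inf_gen H Orb (coAd H) \<xi> \<nu>"
    by (auto simp: gen_space_def)
  have "tangent_map NN Q \<pi> s (vel s \<xi>) \<in> tangent_space Q (\<pi> s)"
    using \<pi>_mem[OF s(2)] vel(1)[OF s(2) \<xi>(1)] by simp
  from tangent_map_mem[OF aQ aO smooth_at_transport[OF aQ C_open Jbar_inj s(5)] this]
  show "u \<in> tangent_space Orb \<nu>" using orbit_generator[OF s(1) \<xi>(1)] \<xi>(2) s by simp
qed

text \<open>Along a local section the evaluation at \<eta> is the momentum map paired with \<eta>,
  and these pairings are smooth on \<open>S\<close>.\<close>

lemma evaluation_smooth: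
  assumes \<eta>: "\<eta> \<in> lie_alg H" and \<nu>: "\<nu> \<in> Jbar ` C"
  shows "smooth_at Orb real_mfd (\<lambda>\<nu>. \<nu> \<eta>) \<nu>"
proof -
  obtain V sec where V: "openin (mtop Orb) V" "\<nu> \<in> V"
    and sec: "\<And>\<nu>. \<nu> \<in> V \<Longrightarrow> smooth_at Orb NN (\<lambda>\<nu>. sec (Finv \<nu>)) \<nu> \<and> sec (Finv \<nu>) \<in> N
        \<and> \<pi> (sec (Finv \<nu>)) = Finv \<nu> \<and> J (sec (Finv \<nu>)) = \<nu> \<and> \<nu> \<in> Jbar ` C"
    using local_section[OF \<nu>] by metis
  have "smooth_at Orb S (\<lambda>\<nu>. sec (Finv \<nu>)) \<nu>"
    by (rule smooth_at_compose[OF aO aN aS, where f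
        = "\<lambda>\<nu>. sec (Finv \<nu>)"]) (use inc_smooth sec V in auto)
  then have "smooth_at Orb real_mfd (\<lambda>\<nu>. J (sec (Finv \<nu>)) \<eta>) \<nu>"
    by (rule smooth_at_compose[OF aO aS atlas_mfd_real, where g = "\<lambda>s. J s \<eta>"])
       (use momentum(1)[OF _ \<eta>] N_points sec V in auto)
  then show ?thesis
    by (rule smooth_at_cong[OF aO V _ atlas_mfd_real, rotated]) (use sec in auto)
qed

text \<open>Lift \<open>u\<close> to a vector \<open>v\<close> of \<open>N\<close>. The evaluation
  at \<eta> has derivative \<open>\<omega>(\<eta>\<^sub>S, v)\<close>, so all evaluations vanish
  only if \<open>v\<close> is orthogonal to every generator. As generators exhaust the vectors
  tangent to \<open>N\<close>, \<open>\<pi>_kernel\<close> applies to \<open>v\<close>.\<close>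

lemma evaluations_separate:
  assumes \<nu>: "\<nu> \<in> Jbar ` C" and u: "u \<in> tangent_space Orb \<nu>"
    and zero: "\<And>\<eta>. \<eta> \<in> lie_alg H \<Longrightarrow> tangent_map Orb real_mfd (\<lambda>\<nu>. \<nu> \<eta>) \<nu> u = 0"
  shows "u = 0"
proof -
  obtain s where s: "s \<in> K" "s \<in> N" "\<nu> = J s" "Finv \<nu> = \<pi> s" "\<pi> s \<in> C" "Jbar (\<pi> s) = \<nu>"
    using pt[OF \<nu>] by metis
  obtain v where v: "v \<in> tangent_space NN s" "u
      = tangent_map Q Orb Jbar (\<pi> s) (tangent_map NN Q \<pi> s v)"
    using orbit_tangent[OF \<nu> u s(2,4)] by metis
  note Fs = smooth_at_transport[OF aQ C_open Jbar_inj s(5)]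
  note sp = N_points[OF s(2)]
  have gen0: "\<omega> s (inf_gen H S actH \<eta> s) (tangent_map NN S (\<lambda>s. s) s v) = 0"
      if \<eta>: "\<eta> \<in> lie_alg H" for \<eta>
  proof -
    have ev: "smooth_at Orb real_mfd (\<lambda>\<nu>. \<nu> \<eta>) (Jbar (\<pi> s))"
      using evaluation_smooth[OF \<eta> \<nu>] s by simp
    have FP: "smooth_at NN Orb (\<lambda>t. Jbar (\<pi> t)) s"
      by (rule smooth_at_compose[OF aN aQ aO \<pi>_smooth[OF s(2)] Fs])
    have "0 = tangent_map Orb real_mfd (\<lambda>\<nu>. \<nu> \<eta>) (Jbar (\<pi> s)) (tangent_map NN Orb
        (\<lambda>t. Jbar (\<pi> t)) s v)"
      using zero[OF \<eta>] v(2) s tangent_map_compose[OF aN aQ aO \<pi>_smooth[OF s(2)] Fs v(1)] by simp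
    also have "\<dots> = tangent_map NN real_mfd (\<lambda>t. Jbar (\<pi> t) \<eta>) s v"
      by (rule tangent_map_compose[OF aN aO atlas_mfd_real FP ev v(1), symmetric])
    also have "\<dots> = tangent_map NN real_mfd (\<lambda>t. J t \<eta>) s v"
      by (rule tangent_map_cong[OF aN openin_points[OF aN] _ _ v(1)]) (use s Jbar_\<pi> in auto)
    also have "\<dots> = tangent_map S real_mfd (\<lambda>t. J t \<eta>) s (tangent_map NN S (\<lambda>s. s) s v)"
      by (rule tangent_map_compose[OF aN aS atlas_mfd_real inc_smooth[OF s(2)]
          momentum(1)[OF sp \<eta>] v(1)])
    also have "\<dots> = \<omega> s (inf_gen H S actH \<eta> s) (tangent_map NN S (\<lambda>s. s) s v)"
      by (rule momentum(2)[OF sp \<eta> inc_mem[OF s(2) v(1)]])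
    finally show ?thesis by simp
  qed
  have "tangent_map NN Q \<pi> s v = 0"
  proof (rule \<pi>_kernel[OF s(2) v(1)])
    fix w assume w: "w \<in> tangent_space NN s"
    obtain \<eta> where \<eta>: "\<eta> \<in> lie_alg H" "tangent_map NN S (\<lambda>s. s) s w = inf_gen H S actH \<eta> s"
      using \<pi>_tangent[OF s(2) w] by metis
    show "\<omega> s (tangent_map NN S (\<lambda>s. s) s v) (tangent_map NN S (\<lambda>s. s) s w) = 0"
      using \<omega>_antisym[OF sp inc_mem[OF s(2) v(1)] inc_mem[OF s(2) w]] gen0[OF \<eta>(1)] \<eta>(2) by simp
  qed
  then have "u = tangent_map Q Orb Jbar (\<pi> s) (0 *\<^sub>R tangent_map NN Q \<pi> s v)" using v(2) by simp
  also have "\<dots> = 0 *\<^sub>R tangent_map Q Orb Jbar (\<pi> s) (tangent_map NN Q \<pi> s v)"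
    using \<pi>_mem[OF s(2) v(1)] by (intro tangent_map_scale[OF aQ aO Fs])
  finally show ?thesis by simp
qed

lemma orbit_mfd: "coadjoint_orbit_mfd H (J s0) Orb"
  unfolding coadjoint_orbit_mfd_def
proof (intro conjI ballI impI)
  show "points Orb = coadjoint_orbit H (J s0)" using orbit_points by simp
  show "manifold Orb" by (rule manifold_transport[OF aQ C_open Jbar_inj Q(1)])
  show "left_action H Orb (coAd H)" by (rule orbit_action)
  show "\<And>\<nu>. \<nu> \<in> points Orb \<Longrightarrow> tangent_space Orb \<nu> = gen_space H Orb (coAd H) \<nu>"
    using orbit_tangent_space by simp
  show "\<And>\<eta>. \<eta> \<in> lie_alg H \<Longrightarrow> smooth_map Orb real_mfd (\<lambda>\<nu>. \<nu> \<eta>)"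
    using evaluation_smooth by (simp add: smooth_map_iff[OF aO atlas_mfd_real])
  fix \<nu> u assume "\<nu> \<in> points Orb" "u \<in> tangent_space Orb \<nu>"
    "\<forall>\<eta>\<in>lie_alg H. tangent_map Orb real_mfd (\<lambda>\<nu>. \<nu> \<eta>) \<nu> u = 0"
  then show "u = 0" using evaluations_separate[of \<nu> u] by simp
qed

text \<open>The inverse of \<open>Jbar\<close> takes generators on the orbit to projected
  velocities. There the reduced form is evaluated by \<omega> on the generators in \<open>S\<close>,
  where \<open>form_generators\<close> gives the bracket.\<close>

lemma orbit_form: "kks_form H Orb (pullback Orb Q Finv \<omega>Q)"
  unfolding kks_form_def
proof (intro conjI ballI)
  show "symplectic_manifold Orb (pullback Orb Q Finv \<omega>Q)"
    by (rule symplectic_manifold_transport[OF aQ C_open Jbar_inj \<omega>Q(1)])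
  fix \<nu> \<xi> \<eta> assume "\<nu> \<in> points Orb" and \<xi>: "\<xi> \<in> lie_alg H" and \<eta>: "\<eta> \<in> lie_alg H"
  then have \<nu>: "\<nu> \<in> Jbar ` C" by simp
  obtain s where s: "s \<in> K" "s \<in> N" "\<nu> = J s" "Finv \<nu> = \<pi> s" "\<pi> s \<in> C" "Jbar (\<pi> s) = \<nu>"
    using pt[OF \<nu>] by metis
  have *: "tangent_map Orb Q Finv \<nu> (inf_gen H Orb (coAd H) \<zeta> \<nu>) = tangent_map NN Q \<pi> s (vel s \<zeta>)"
    if \<zeta>: "\<zeta> \<in> lie_alg H" for \<zeta>
    using tangent_map_transport(1)[OF aQ C_open Jbar_inj s(5) \<pi>_mem[OF s(2) vel(1)[OF s(2) \<zeta>]]]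
      orbit_generator[OF s(1) \<zeta>] s by simp
  show "pullback Orb Q Finv \<omega>Q \<nu> (inf_gen H Orb (coAd H) \<xi> \<nu>) (inf_gen H Orb (coAd H) \<eta> \<nu>)
      = \<nu> (lie_bracket H \<xi> \<eta>)"
    unfolding pullback_def *[OF \<xi>] *[OF \<eta>] s(4)
      form_\<pi>[OF s(2) vel(1)[OF s(2) \<xi>] vel(1)[OF s(2) \<eta>]] vel(2)[OF s(2) \<xi>] vel(2)[OF s(2) \<eta>]
    using form_generators[OF s(2) \<xi> \<eta>] s(3) by simp
qed

end

theorem component_symplectic_diffeo_orbit:
  assumes C: "C \<in> connected_components_of (mtop Q)"
  shows "\<exists>\<mu> \<in> dual (lie_alg H). \<exists>(\<O> :: ('f \<Rightarrow> real, 'q) mfd) \<omega>\<^sub>\<O> f.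
    coadjoint_orbit_mfd H \<mu> \<O> \<and> kks_form H \<O> \<omega>\<^sub>\<O> \<and>
    symplectic_diffeo (sub_mfd Q C) (pullback (sub_mfd Q C) Q (\<lambda>x. x) \<omega>Q) \<O> \<omega>\<^sub>\<O> f"
proof -
  obtain q where q: "q \<in> C" using nonempty_connected_components_of[OF C] by blast
  then have "q \<in> \<pi> ` N"
    using connected_components_of_subset[OF C] topspace_mtop[OF aQ] Q(2) by auto
  then obtain s0 where s0: "s0 \<in> N" "\<pi> s0 \<in> C" using q by blast
  note ctxt = s0 C refl
  have "symplectic_diffeo (sub_mfd Q C) (pullback (sub_mfd Q C) Q (\<lambda>x. x) \<omega>Q)
      (transport_mfd Q C Jbar)
      (pullback (transport_mfd Q C Jbar) Q (inv_into C Jbar) \<omega>Q) Jbar"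
    by (rule symplectic_diffeo_transport[OF aQ C_open[OF ctxt] Jbar_inj[OF ctxt]])
  then show ?thesis
    using orbit_mfd[OF ctxt] orbit_form[OF ctxt] J_dual[OF N_points[OF s0(1)]] by blast
qed

end

section \<open>From the two commuting actions to the fibres and tangent spaces of the level
  set\<close>

theorem proposition2p5:
  fixes S :: "('s, 'e::lctvs) mfd" and \<omega> :: "('s, 'e) form2"
    and G :: "('g, 'd::lctvs) lie_group" and actG :: "'s \<Rightarrow> 'g \<Rightarrow> 's"
    and H :: "('h, 'f::lctvs) lie_group" and actH :: "'h \<Rightarrow> 's \<Rightarrow> 's"
    and J\<^sub>L :: "'s \<Rightarrow> 'f \<Rightarrow> real"
    and br :: "'k::lctvs \<Rightarrow> 'k \<Rightarrow> 'k" and p :: "'k \<Rightarrow> 'd"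
    and J\<^sub>R :: "'s \<Rightarrow> 'k \<Rightarrow> real"
    and \<rho> :: "('k \<Rightarrow> real) \<Rightarrow> 'g \<Rightarrow> ('k \<Rightarrow> real)"
    and \<sigma> :: "'k \<Rightarrow> real"
    and Q :: "('s set, 'q::lctvs) mfd" and \<omega>\<^sub>\<sigma> :: "('s set, 'q) form2"
  defines "\<g>\<^sub>S \<equiv> gen_space G S (\<lambda>g s. actG s g)"
    and "\<h>\<^sub>S \<equiv> gen_space H S actH"
    and "G\<^sub>\<sigma> \<equiv> {g \<in> carrier G. \<rho> \<sigma> g = \<sigma>}"
    and "N \<equiv> level_set S J\<^sub>R \<sigma>"
  defines "\<pi> \<equiv> (\<lambda>s. actG s ` G\<^sub>\<sigma>)"
  assumes S: "symplectic_manifold S \<omega>"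
    and G: "is_lie_group G" "right_action G S actG"
      "\<And>g. g \<in> carrier G \<Longrightarrow> symplectic_map S \<omega> S \<omega> (\<lambda>s. actG s g)"
    and H: "is_lie_group H" "left_action H S actH"
      "\<And>h. h \<in> carrier H \<Longrightarrow> symplectic_map S \<omega> S \<omega> (actH h)"
    and commuting: "\<And>g h s. g \<in> carrier G \<Longrightarrow> h \<in> carrier H \<Longrightarrow> s \<in> points S \<Longrightarrow>
      actH h (actG s g) = actG (actH h s) g"
    and orthogonal: "\<And>s. s \<in> points S \<Longrightarrow> \<g>\<^sub>S s = symplectic_complement S \<omega> s (\<h>\<^sub>S s)"
      "\<And>s. s \<in> points S \<Longrightarrow> \<h>\<^sub>S s = symplectic_complement S \<omega> s (\<g>\<^sub>S s)"
    and H_connected: "connected_space (mtop (gmfd H))"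
    and J\<^sub>L: "momentum_map S \<omega> (lie_alg H) (inf_gen H S actH) J\<^sub>L"
      "\<And>h s. h \<in> carrier H \<Longrightarrow> s \<in> points S \<Longrightarrow> J\<^sub>L (actH h s) = coAd H h (J\<^sub>L s)"
    and extension: "central_extension G br p"
    and J\<^sub>R: "momentum_map S \<omega> UNIV (\<lambda>x. inf_gen G S (\<lambda>g s. actG s g) (p x)) J\<^sub>R"
      "\<And>x y s. s \<in> points S \<Longrightarrow>
        tangent_map S real_mfd (\<lambda>s. J\<^sub>R s y) s (inf_gen G S (\<lambda>g s. actG s g) (p x) s) = J\<^sub>R s (br x y)"
    and integration: "integrates_coadjoint G br p \<rho>"
      "\<And>g s. g \<in> carrier G \<Longrightarrow> s \<in> points S \<Longrightarrow> J\<^sub>R (actG s g) = \<rho> (J\<^sub>R s) g"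
    and transitive_G: "\<And>\<mu>. \<mu> \<in> dual (lie_alg H) \<Longrightarrow>
      transitive_on (carrier G) (\<lambda>g s. actG s g) (level_set S J\<^sub>L \<mu>)"
    and transitive_H: "\<And>\<kappa> C. \<kappa> \<in> dual UNIV \<Longrightarrow> C \<in> component_sets S (level_set S J\<^sub>R \<kappa>) \<Longrightarrow>
      transitive_on (carrier H) actH C"
    and \<sigma>: "\<sigma> \<in> dual UNIV"
    and N: "submanifold S N"
    and Q: "manifold Q" "points Q = \<pi> ` N" "submersion (sub_mfd S N) Q \<pi>"
    and \<omega>\<^sub>\<sigma>: "symplectic_manifold Q \<omega>\<^sub>\<sigma>"
      "form2_eq (sub_mfd S N) (pullback (sub_mfd S N) Q \<pi> \<omega>\<^sub>\<sigma>) (pullback (sub_mfd S N) S (\<lambda>s. s) \<omega>)"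
  shows "\<forall>C \<in> connected_components_of (mtop Q).
    \<exists>\<mu> \<in> dual (lie_alg H). \<exists>(\<O> :: ('f \<Rightarrow> real, 'q) mfd) \<omega>\<^sub>\<O> f.
      coadjoint_orbit_mfd H \<mu> \<O> \<and> kks_form H \<O> \<omega>\<^sub>\<O> \<and>
      symplectic_diffeo (sub_mfd Q C) (pullback (sub_mfd Q C) Q (\<lambda>x. x) \<omega>\<^sub>\<sigma>) \<O> \<omega>\<^sub>\<O> f"
proof
  have S': "atlas_mfd S" using S by (simp add: symplectic_manifold_def manifold_atlas)
  note aN = atlas_mfd_sub[OF S' N]
  have NS: "s \<in> points S" "J\<^sub>R s = \<sigma>" if "s \<in> N" for s
    using that by (auto simp: N_def level_set_def)
  have G_group: "Group.group G" using lie_groupD(1)[OF G(1)] .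
  interpret G: Group.group G by (rule G_group)
  have act: "actG s \<one>\<^bsub>G\<^esub> = s" "g \<in> carrier G \<Longrightarrow> h \<in> carrier G
      \<Longrightarrow> actG s (g \<otimes>\<^bsub>G\<^esub> h) = actG (actG s g) h"
    if "s \<in> points S" for s g h
    using G(2) that by (auto simp: right_action_def)
  have \<rho>: "\<rho> \<sigma> \<one>\<^bsub>G\<^esub> = \<sigma>" "g \<in> carrier G \<Longrightarrow> h \<in> carrier G \<Longrightarrow> \<rho> \<sigma> (g \<otimes>\<^bsub>G\<^esub> h) = \<rho> (\<rho> \<sigma> g) h" for g h
    using integration(1) \<sigma> by (auto simp: integrates_coadjoint_def)
  have stab: "\<one>\<^bsub>G\<^esub> \<in> G\<^sub>\<sigma>" "g \<in> G\<^sub>\<sigma> \<Longrightarrow> h \<in> G\<^sub>\<sigma> \<Longrightarrow> g \<otimes>\<^bsub>G\<^esub> h \<in> G\<^sub>\<sigma>" "g \<in> G\<^sub>\<sigma> \<Longrightarrow> inv\<^bsub>G\<^esub> g \<in> G\<^sub>\<sigma>" for g h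
  proof -
    show "\<one>\<^bsub>G\<^esub> \<in> G\<^sub>\<sigma>" using \<rho>(1) by (simp add: G\<^sub>\<sigma>_def)
    show "g \<in> G\<^sub>\<sigma> \<Longrightarrow> h \<in> G\<^sub>\<sigma> \<Longrightarrow> g \<otimes>\<^bsub>G\<^esub> h \<in> G\<^sub>\<sigma>" using \<rho>(2) by (simp add: G\<^sub>\<sigma>_def)
    show "g \<in> G\<^sub>\<sigma> \<Longrightarrow> inv\<^bsub>G\<^esub> g \<in> G\<^sub>\<sigma>"
      using \<rho>(2)[of g "inv\<^bsub>G\<^esub> g"] \<rho>(1) by (simp add: G\<^sub>\<sigma>_def)
  qed
  have J_dual: "J\<^sub>L s \<in> dual (lie_alg H)" if "s \<in> points S" for s
    using J\<^sub>L(1) that by (simp add: momentum_map_def)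
  \<comment> \<open>Transitivity on the level sets of \<open>J\<^sub>L\<close> supplies an element
    of \<open>G\<close> from \<open>s\<close> to \<open>t\<close>; equivariance of
    \<open>J\<^sub>R\<close> for \<rho> puts it into the stabilizer, because both points have value
    \<sigma>.\<close>
  have fibres: "J\<^sub>L s = J\<^sub>L t \<longleftrightarrow> \<pi> s = \<pi> t" if s: "s \<in> N" and t: "t \<in> N" for s t
  proof
    assume "J\<^sub>L s = J\<^sub>L t"
    then have "s \<in> level_set S J\<^sub>L (J\<^sub>L s)" "t \<in> level_set S J\<^sub>L (J\<^sub>L s)"
      using NS s t by (auto simp: level_set_def)
    then obtain g where g: "g \<in> carrier G" "actG s g = t"
      using transitive_G[OF J_dual[OF NS(1)[OF s]]] unfolding transitive_on_def by blast
    then have gs: "g \<in> G\<^sub>\<sigma>"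
      using integration(2)[OF g(1) NS(1)[OF s]] NS(2)[OF s] NS(2)[OF t] by (simp add: G\<^sub>\<sigma>_def)
    have sub: "G\<^sub>\<sigma> \<subseteq> carrier G" by (auto simp: G\<^sub>\<sigma>_def)
    \<comment> \<open>Classes are sets of points, so their equality is shown by reparametrizing the
      stabilizer: multiplication by \<open>g\<close> or by its inverse permutes it.\<close>
    have 1: "actG t k = actG s (g \<otimes>\<^bsub>G\<^esub> k)" if "k \<in> G\<^sub>\<sigma>" for k
      using act(2)[OF NS(1)[OF s] g(1)] g(2) that sub by auto
    have 2: "actG s k = actG t (inv\<^bsub>G\<^esub> g \<otimes>\<^bsub>G\<^esub> k)" if k: "k \<in> G\<^sub>\<sigma>" for k
    proof -
      have "g \<otimes>\<^bsub>G\<^esub> (inv\<^bsub>G\<^esub> g \<otimes>\<^bsub>G\<^esub> k) = k"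
        using g(1) k sub by (simp add: G.m_assoc[symmetric] subset_iff)
      then show ?thesis using 1[of "inv\<^bsub>G\<^esub> g \<otimes>\<^bsub>G\<^esub> k"] stab(2)[OF stab(3)[OF gs] k] by simp
    qed
    show "\<pi> s = \<pi> t"
      unfolding \<pi>_def
    proof (intro equalityI subsetI)
      fix x assume "x \<in> actG s ` G\<^sub>\<sigma>"
      then show "x \<in> actG t ` G\<^sub>\<sigma>" using 2 stab(2)[OF stab(3)[OF gs]] by auto
    next
      fix x assume "x \<in> actG t ` G\<^sub>\<sigma>"
      then show "x \<in> actG s ` G\<^sub>\<sigma>" using 1 stab(2)[OF gs] by auto
    qed
  next
    assume "\<pi> s = \<pi> t"
    \<comment> \<open>The unit of the stabilizer puts each point into its own class, so equal
      classes yield a group element relating the two points.\<close>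
    moreover have "s \<in> \<pi> s" unfolding \<pi>_def using act(1)[OF NS(1)[OF s]] stab(1) by (metis imageI)
    ultimately obtain g where g: "g \<in> G\<^sub>\<sigma>" "s = actG t g" by (auto simp: \<pi>_def)
    have "t \<in> level_set S J\<^sub>L (J\<^sub>L t)" using NS(1)[OF t] by (simp add: level_set_def)
    then have "actG t g \<in> level_set S J\<^sub>L (J\<^sub>L t)"
      using transitive_G[OF J_dual[OF NS(1)[OF t]]] g(1) by (auto simp: transitive_on_def G\<^sub>\<sigma>_def)
    then show "J\<^sub>L s = J\<^sub>L t" using g(2) by (simp add: level_set_def)
  qed
  \<comment> \<open>\<open>J\<^sub>R\<close> is constant on \<open>N\<close>, so its differential
    annihilates vectors tangent to \<open>N\<close>. By the momentum condition they are orthogonal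
    to the generators of \<open>G\<close>, and by complete orthogonality they are generators of
    \<open>H\<close>.\<close>
  have tangent: "tangent_map (sub_mfd S N) S (\<lambda>s. s) s v \<in> gen_space H S actH s"
    if s: "s \<in> N" and v: "v \<in> tangent_space (sub_mfd S N) s" for s v
  proof -
    note inc = smooth_at_inclusion[OF S' N s] and sp = NS(1)[OF s]
    let ?w = "tangent_map (sub_mfd S N) S (\<lambda>s. s) s v"
    have w: "?w \<in> tangent_space S s" by (rule tangent_map_mem[OF aN S' inc v])
    have "\<omega> s ?w u = 0" if u: "u \<in> \<g>\<^sub>S s" for u
    proof -
      have uS: "u \<in> tangent_space S s" using u orthogonal(1)[OF sp]
        by (simp add: symplectic_complement_def)
      obtain \<zeta> where \<zeta>: "\<zeta> \<in> lie_alg G" "u = inf_gen G S (\<lambda>g s. actG s g) \<zeta> s"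
        using u by (auto simp: \<g>\<^sub>S_def gen_space_def)
      \<comment> \<open>\<open>J\<^sub>R\<close> pairs with elements of the extension. Surjectivity
        of the projection lets every generator of \<open>G\<close> be tested by such an
        element.\<close>
      have "range p = lie_alg G" using extension by (simp add: central_extension_def)
      then obtain x where x: "\<zeta> = p x" using \<zeta>(1) by blast
      have J: "smooth_at S real_mfd (\<lambda>s. J\<^sub>R s x) s"
        "tangent_map S real_mfd (\<lambda>s. J\<^sub>R s x) s ?w = \<omega> s (inf_gen G S (\<lambda>g s. actG s g) (p x) s) ?w"
        using J\<^sub>R(1) sp w unfolding momentum_map_def smooth_map_iff[OF S' atlas_mfd_real] by auto
      have "tangent_map S real_mfd (\<lambda>s. J\<^sub>R s x) s ?w
          = tangent_map (sub_mfd S N) real_mfd (\<lambda>s. J\<^sub>R s x) s v"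
        by (rule tangent_map_compose[OF aN S' atlas_mfd_real inc J(1) v, symmetric])
      also have "\<dots> = tangent_map (sub_mfd S N) real_mfd (\<lambda>_. \<sigma> x) s v"
        by (rule tangent_map_cong[OF aN openin_points[OF aN] _ _ v]) (use s NS in \<open>auto
            simp: sub_mfd_simps\<close>)
      also have "\<dots> = 0"
        by (rule smooth_at_const(2)[OF aN atlas_mfd_real _ _ v]) (use s in \<open>auto
            simp: sub_mfd_simps\<close>)
      finally have "\<omega> s u ?w = 0" using J(2) \<zeta> x by simp
      moreover have "\<omega> s ?w u = - \<omega> s u ?w"
        using S sp w uS unfolding symplectic_manifold_def smooth_form2_def by blast
      ultimately show ?thesis by simp
    qed
    then have "?w \<in> \<h>\<^sub>S s" unfolding orthogonal(2)[OF sp] symplectic_complement_def using w by blast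
    then show ?thesis by (simp add: \<h>\<^sub>S_def)
  qed
  \<comment> \<open>From here on \<open>G\<close> is present only through \<open>fibres\<close> and
    \<open>tangent\<close>, and the hypothesis on \<open>H\<close> is taken at the single value
    \<sigma>.\<close>
  interpret momentum_quotient S \<omega> H actH J\<^sub>L N Q \<omega>\<^sub>\<sigma> \<pi>
  proof (unfold_locales)
    show "\<And>K. K \<in> component_sets S N \<Longrightarrow> transitive_on (carrier H) actH K"
      using transitive_H[OF \<sigma>] by (simp add: N_def)
  qed (fact S H J\<^sub>L N Q \<omega>\<^sub>\<sigma> fibres tangent)+
  fix C assume "C \<in> connected_components_of (mtop Q)"
  then show "\<exists>\<mu> \<in> dual (lie_alg H). \<exists>(\<O> :: ('f \<Rightarrow> real, 'q) mfd) \<omega>\<^sub>\<O> f.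
      coadjoint_orbit_mfd H \<mu> \<O> \<and> kks_form H \<O> \<omega>\<^sub>\<O> \<and>
      symplectic_diffeo (sub_mfd Q C) (pullback (sub_mfd Q C) Q (\<lambda>x. x) \<omega>\<^sub>\<sigma>) \<O> \<omega>\<^sub>\<O> f"
    by (rule component_symplectic_diffeo_orbit)
qed

end
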